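(* Let $(A_n)_{n\ge0}$ denote Diffusion Limited Aggregation on $\mathbf{Z}^2$ (defined in the context). For any nonempty finite connected subset $a$ of $\mathbf{Z}^2$, $$P\bigl(H(A_n)\to\infty \text{ as } n\to\infty \,\bigm|\, A_0=a\bigr)=1 .$$
   Context: Two points of $\mathbf{Z}^2$ are adjacent if their Euclidean distance is $1$; a subset $b$ of $\mathbf{Z}^2$ is connected if any two points of $b$ can be joined by a nearest-neighbor lattice path all of whose points belong to $b$. The boundary $\partial b$ of $b\subset\mathbf{Z}^2$ is the set of lattice points adjacent to a point of $b$ but not in $b$. Diffusion Limited Aggregation (DLA) on $\mathbf{Z}^2$ is the Markov chain $(A_n)_{n\ge0}$ of finite connected subsets of $\mathbf{Z}^2$ with transition probabilities $P(A_{n+1}=A_n\cup\{x\}\mid A_n)=\mu_{\partial A_n}(x)$ for $x\in\partial A_n$, where for a finite nonempty set $B\subset\mathbf{Z}^2$, $\mu_B$ is harmonic measure on $B$ (from infinity), i.e. $\mu_B(x)=\lim_{|y|\to\infty}P_y(S_{\tau_B}=x)$, with $S$ a symmetric nearest-neighbor simple random walk on $\mathbf{Z}^2$ started at $y$ and $\tau_B$ its hitting time of $B$. A hole of $b\subset\mathbf{Z}^2$ is a finite maximal connected subset (finite connected component) of $\mathbf{Z}^2\setminus b$, and $H(b)$ is the number of holes of $b$. *)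

theory Defs
  imports "HOL-Probability.Probability"
begin

type_synonym site = "int \<times> int"

text \<open>The inclusion of the lattice into the Euclidean plane; \<^const>\<open>dist\<close> and
  \<^const>\<open>norm\<close> on \<^typ>\<open>real \<times> real\<close> are the Euclidean ones.\<close>

definition embed :: "site \<Rightarrow> real \<times> real" where
  "embed x = (real_of_int (fst x), real_of_int (snd x))"

definition adjacent :: "site \<Rightarrow> site \<Rightarrow> bool" where
  "adjacent x y \<longleftrightarrow> dist (embed x) (embed y) = 1"

definition lattice_connected :: "site set \<Rightarrow> bool" where
  "lattice_connected b \<longleftrightarrow>
     (\<forall>x\<in>b. \<forall>y\<in>b. \<exists>p. p \<noteq> [] \<and> hd p = x \<and> last p = y \<and> successively adjacent p \<and> set p \<subseteq> b)"

definition boundary :: "site set \<Rightarrow> site set" where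
  "boundary b = {x. x \<notin> b \<and> (\<exists>y\<in>b. adjacent x y)}"

definition holes :: "site set \<Rightarrow> site set set" where
  "holes b = {c. finite c \<and> c \<noteq> {} \<and> c \<subseteq> - b \<and> lattice_connected c \<and>
                 (\<forall>d. c \<subseteq> d \<and> d \<subseteq> - b \<and> lattice_connected d \<longrightarrow> d = c)}"

definition num_holes :: "site set \<Rightarrow> nat" where
  "num_holes b = card (holes b)"

text \<open>Simple random walk, realised as partial sums of a sequence of independent steps, each
  uniform on the four unit vectors. The law of the steps does not depend on the starting point,
  which enters through \<open>walk\<close>.\<close>

definition steps_measure :: "(nat \<Rightarrow> site) measure" where
  "steps_measure =
     (\<Pi>\<^sub>M i\<in>(UNIV :: nat set). measure_pmf (pmf_of_set {(1, 0), (-1, 0), (0, 1), (0, -1)}))"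

definition walk :: "site \<Rightarrow> (nat \<Rightarrow> site) \<Rightarrow> nat \<Rightarrow> site" where
  "walk y \<xi> n = y + (\<Sum>i<n. \<xi> i)"

text \<open>The hitting time of \<open>B\<close>; its value is only meaningful on sequences that visit \<open>B\<close>.\<close>

definition hitting_time :: "site set \<Rightarrow> (nat \<Rightarrow> site) \<Rightarrow> nat" where
  "hitting_time B s = (LEAST n. s n \<in> B)"

definition hit_prob :: "site set \<Rightarrow> site \<Rightarrow> site \<Rightarrow> real" where
  "hit_prob B y x =
     \<P>(\<xi> in steps_measure. (\<exists>n. walk y \<xi> n \<in> B) \<and>
                          walk y \<xi> (hitting_time B (walk y \<xi>)) = x)"

text \<open>Harmonic measure from infinity. The filter expresses that the Euclidean norm of the
  starting point tends to infinity.\<close>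

definition harmonic_measure :: "site set \<Rightarrow> site \<Rightarrow> real" where
  "harmonic_measure B x =
     Lim (filtercomap (\<lambda>y. norm (embed y)) at_top) (\<lambda>y. hit_prob B y x)"

text \<open>Markov chains on a countable state space \<open>S\<close> with transition matrix \<open>p\<close>, with no
  restriction on the initial distribution. Measurability into \<^term>\<open>count_space S\<close> includes that
  the chain takes its values in \<open>S\<close>.\<close>

definition markov_chain ::
  "'w measure \<Rightarrow> 's set \<Rightarrow> ('s \<Rightarrow> 's \<Rightarrow> real) \<Rightarrow> (nat \<Rightarrow> 'w \<Rightarrow> 's) \<Rightarrow> bool" where
  "markov_chain M S p X \<longleftrightarrow>
     prob_space M \<and> countable S \<and>
     (\<forall>n. X n \<in> measurable M (count_space S)) \<and>
     (\<forall>n h t. t \<in> S \<longrightarrow> \<P>(\<omega> in M. \<forall>i\<le>n. X i \<omega> = h i) > 0 \<longrightarrow>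
        cond_prob M (\<lambda>\<omega>. X (Suc n) \<omega> = t) (\<lambda>\<omega>. \<forall>i\<le>n. X i \<omega> = h i) = p (h n) t)"

definition clusters :: "site set set" where
  "clusters = {b. finite b \<and> b \<noteq> {} \<and> lattice_connected b}"

text \<open>The sum below has at most one term, since \<open>x\<close> is determined by \<open>b\<close> and \<open>c\<close> if
  \<open>x \<notin> b\<close>.\<close>

definition dla_transition :: "site set \<Rightarrow> site set \<Rightarrow> real" where
  "dla_transition b c =
     (\<Sum>x\<in>{x \<in> boundary b. c = b \<union> {x}}. harmonic_measure (boundary b) x)"

definition is_DLA :: "'w measure \<Rightarrow> (nat \<Rightarrow> 'w \<Rightarrow> site set) \<Rightarrow> bool" where
  "is_DLA M A \<longleftrightarrow> markov_chain M clusters dla_transition A"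

end

theory Submission
  imports Defs
begin

text \<open>A hole never disappears: a walker from infinity cannot enter it, so no particle is attached inside
(\<open>num_holes_mono\<close>). It therefore suffices that, whatever the cluster is, a new hole appears later
with probability 1 (\<open>AE_new_hole\<close>). No useful lower bound holds for the probability that a given
step closes a hole; the proof finds a Lyapunov function instead.

A \<^emph>\<open>place\<close> of the cluster \<open>A\<close> is a site of \<open>A\<close> beyond which a ball of radius 15, in the metric
\<open>l1\<close>, is free. Nine particles attached there in a prescribed order (\<open>cells\<close>) enclose a hole that
consists of one site. A place is at stage \<open>k\<close> if \<open>k\<close> of the nine are laid. Its weight \<open>e\<close> is the
harmonic measure at the centre of the ball, for the boundary of the 15-neighbourhood of the cluster
without the laid particles. This weight does not change when the next particle is laid, and the
next particle is laid with probability at least a constant times \<open>e\<close> (\<open>place_hm_le\<close>).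

Let \<open>V k\<close> and \<open>\<Phi> k\<close> be the sums of \<open>e\<^sup>2\<close> and \<open>e\<^sup>3\<close> over the places at stage \<open>k\<close> (\<open>sq_sum\<close> and
\<open>cube_sum\<close>). In one step of the chain \<open>V (k + 1)\<close> gains at least \<open>c \<Phi> k\<close> in expectation, from places
that advance. Attaching a particle elsewhere can screen a place or spoil it, but by Young's
inequality the expected loss of \<open>V k\<close> is at most \<open>C (\<epsilon> \<Phi> 0 + \<epsilon>\<^sup>-\<^sup>2 \<Phi> k)\<close> for every \<open>\<epsilon>\<close> in \<open>(0, 1]\<close>
(\<open>expected_loss\<close>). With weights \<open>\<kappa> k\<close> that increase fast enough the gains beat the losses at all
stages but the last one. For \<open>Z = \<Sum> \<kappa> k V k\<close> the expected increment of \<open>ln Z\<close> is then at least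
\<open>(\<Sum> \<kappa> k \<Phi> k) / Z\<close> minus a constant times the probability that this step closes a hole. There are
\<open>O (card A)\<close> places, and the weights at stage 0 sum to at least 1, so by Cauchy and Schwarz this ratio
is at least \<open>c / card A\<close> (\<open>lyapunov_drift\<close>). The cluster grows by one site at a time, \<open>\<Sum> 1 / n\<close>
diverges, and \<open>ln Z\<close> is bounded above: hence the event that no further hole is closed has
probability 0 (\<open>decay_to_zero\<close>). The logarithm is what makes this work for clusters of any shape,
since it only sees ratios.

Two facts of potential theory carry the estimates. Losses and gains are compared through hitting
kernels whose row sums are 1; their column sums are bounded because a bounded function that is
harmonic off a finite set has total flux 0 there (\<open>flux_zero\<close>, \<open>hit_prob_collar_sum\<close>). Hence mass can
be transported between boundary sites and places at the cost of a constant in cube sums (\<open>schur\<close>), which takes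
care of boundary sites in narrow channels, where no hole can be built. Recurrence enters only through
functions that are close to 1 on large sets, vanish far away and have small Dirichlet energy
(\<open>energy_cutoff_tendsto\<close>); they yield the maximum principle on unbounded domains, flux 0, and the
existence of the limit that defines harmonic measure (\<open>harmonic_measure_limit\<close>).\<close>

section \<open>Dirichlet energy on the square lattice\<close>

definition nbrs :: "site \<Rightarrow> site set" where
  "nbrs u = {u + (1, 0), u - (1, 0), u + (0, 1), u - (0, 1)}"

definition lap :: "(site \<Rightarrow> real) \<Rightarrow> site \<Rightarrow> real" where
  "lap f u = (\<Sum>v\<in>nbrs u. f v) - 4 * f u"

definition supnorm :: "site \<Rightarrow> nat" where
  "supnorm u = nat (max \<bar>fst u\<bar> \<bar>snd u\<bar>)"

definition square :: "nat \<Rightarrow> site set" where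
  "square N = {u. supnorm u \<le> N}"

definition energy :: "site set \<Rightarrow> (site \<Rightarrow> real) \<Rightarrow> real" where
  "energy X f = (\<Sum>x\<in>X. (f (x + (1, 0)) - f x)\<^sup>2 + (f (x + (0, 1)) - f x)\<^sup>2)"

lemma sum_nbrs:
  "(\<Sum>v\<in>nbrs u. f v) = f (u + (1, 0)) + f (u - (1, 0)) + f (u + (0, 1)) + f (u - (0, 1))"
  for f :: "site \<Rightarrow> real"
  by (cases u) (simp add: nbrs_def)

lemma finite_nbrs [simp]: "finite (nbrs u)"
  by (simp add: nbrs_def)

lemma card_nbrs [simp]: "card (nbrs u) = 4"
  by (cases u) (simp add: nbrs_def card_insert_if)

lemma nbrs_sym: "v \<in> nbrs u \<longleftrightarrow> u \<in> nbrs v"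
  by (cases u; cases v) (auto simp: nbrs_def)

lemma lap_eq:
  "lap f u = (f (u + (1, 0)) + f (u - (1, 0)) - 2 * f u) + (f (u + (0, 1)) + f (u - (0, 1)) - 2 * f u)"
  by (simp add: lap_def sum_nbrs)

lemma square_eq: "square N = {- int N..int N} \<times> {- int N..int N}"
  by (auto simp: square_def supnorm_def)

lemma finite_square [simp]: "finite (square N)"
  by (simp add: square_eq)

lemma square_mono: "M \<le> N \<Longrightarrow> square M \<subseteq> square N"
  by (auto simp: square_def)

lemma finite_subset_square:
  assumes "finite B" shows "\<exists>N. B \<subseteq> square N"
proof -
  have "finite (supnorm ` B)" using assms by simp
  then obtain N where "\<forall>n\<in>supnorm ` B. n \<le> N" using finite_nat_set_iff_bounded_le by blast
  then show ?thesis by (auto simp: square_def)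
qed

text \<open>Translation by \<open>s\<close> turns the terms with \<open>f (x - s)\<close> into terms with \<open>\<eta> (x + s)\<close>; the hypothesis on
the support of \<open>\<eta>\<close> makes sure that \<open>X\<close> contains both ends of every edge that contributes.\<close>

lemma summation_by_parts_direction:
  fixes \<eta> f :: "site \<Rightarrow> real"
  assumes "finite X" and supp: "\<And>x. \<eta> x \<noteq> 0 \<Longrightarrow> x \<in> X \<and> x - s \<in> X"
  shows "(\<Sum>x\<in>X. \<eta> x * (f (x + s) + f (x - s) - 2 * f x)) =
         - (\<Sum>x\<in>X. (\<eta> (x + s) - \<eta> x) * (f (x + s) - f x))"
proof -
  have "(\<Sum>x\<in>X. \<eta> x * (f (x - s) - f x)) = (\<Sum>x\<in>{x\<in>X. \<eta> x \<noteq> 0}. \<eta> x * (f (x - s) - f x))"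
    by (rule sum.mono_neutral_right) (use assms in auto)
  also have "\<dots> = (\<Sum>x\<in>{x\<in>X. \<eta> (x + s) \<noteq> 0}. \<eta> (x + s) * (f x - f (x + s)))"
    by (rule sum.reindex_bij_witness[where i = "\<lambda>x. x + s" and j = "\<lambda>x. x - s"])
       (auto dest: supp)
  also have "\<dots> = (\<Sum>x\<in>X. \<eta> (x + s) * (f x - f (x + s)))"
    by (rule sum.mono_neutral_left) (use assms in auto)
  finally have "(\<Sum>x\<in>X. \<eta> x * (f (x - s) - f x)) = (\<Sum>x\<in>X. \<eta> (x + s) * (f x - f (x + s)))" .
  moreover have "(\<Sum>x\<in>X. \<eta> x * (f (x + s) + f (x - s) - 2 * f x)) =
      (\<Sum>x\<in>X. \<eta> x * (f (x + s) - f x)) + (\<Sum>x\<in>X. \<eta> x * (f (x - s) - f x))"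
    by (simp add: sum.distrib[symmetric] algebra_simps)
  ultimately show ?thesis
    by (simp add: sum.distrib[symmetric] sum_negf[symmetric] algebra_simps)
qed

lemma summation_by_parts:
  fixes \<eta> f :: "site \<Rightarrow> real"
  assumes supp: "\<And>x. N \<le> supnorm x \<Longrightarrow> \<eta> x = 0"
  shows "(\<Sum>x\<in>square N. \<eta> x * lap f x) =
         - (\<Sum>x\<in>square N. (\<eta> (x + (1, 0)) - \<eta> x) * (f (x + (1, 0)) - f x)
                       + (\<eta> (x + (0, 1)) - \<eta> x) * (f (x + (0, 1)) - f x))"
proof -
  have *: "x \<in> square N \<and> x - (1, 0) \<in> square N \<and> x - (0, 1) \<in> square N" if "\<eta> x \<noteq> 0" for x
  proof -
    have "supnorm x < N" using supp[of x] that by force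
    then show ?thesis by (cases x) (auto simp: square_def supnorm_def)
  qed
  have "(\<Sum>x\<in>square N. \<eta> x * lap f x) =
      (\<Sum>x\<in>square N. \<eta> x * (f (x + (1, 0)) + f (x - (1, 0)) - 2 * f x))
      + (\<Sum>x\<in>square N. \<eta> x * (f (x + (0, 1)) + f (x - (0, 1)) - 2 * f x))"
    by (simp only: lap_eq distrib_left sum.distrib)
  also have "\<dots> = - (\<Sum>x\<in>square N. (\<eta> (x + (1, 0)) - \<eta> x) * (f (x + (1, 0)) - f x))
      + - (\<Sum>x\<in>square N. (\<eta> (x + (0, 1)) - \<eta> x) * (f (x + (0, 1)) - f x))"
    by (intro arg_cong2[where f = "(+)"] summation_by_parts_direction) (use * in auto)
  finally show ?thesis by (simp add: sum.distrib)
qed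

text \<open>The contribution of one edge to the inequality below: \<open>a\<close>, \<open>b\<close> are the values of a cutoff and \<open>p\<close>, \<open>q\<close> those
of the function at its ends. By the product rule the increment of \<open>a\<^sup>2 p\<close> is the average of the squared
cutoffs times \<open>p - q\<close>, up to a term with \<open>a - b\<close> that Young's inequality absorbs.\<close>

lemma energy_term_bound:
  fixes a b p q M :: real
  assumes "\<bar>p\<bar> \<le> M" "\<bar>q\<bar> \<le> M"
  shows "(a\<^sup>2 + b\<^sup>2) / 2 * (p - q)\<^sup>2
         \<le> 2 * ((a\<^sup>2 * p - b\<^sup>2 * q) * (p - q)) + 4 * M\<^sup>2 * (a - b)\<^sup>2"
proof -
  let ?m = "(p + q) / 2" and ?d = "p - q"
  have "?m\<^sup>2 \<le> M\<^sup>2" using assms by (intro power2_le_iff_abs_le[THEN iffD2]) auto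
  then have m: "?m\<^sup>2 * (a - b)\<^sup>2 \<le> M\<^sup>2 * (a - b)\<^sup>2" by (intro mult_right_mono) auto
  have split: "(a\<^sup>2 * p - b\<^sup>2 * q) * ?d = (a\<^sup>2 + b\<^sup>2) / 2 * ?d\<^sup>2 + ?m * (a - b) * ((a + b) * ?d)"
    by (simp add: field_simps power2_eq_square)
  define u where "u = ?m * (a - b)"
  define v where "v = (a + b) * ?d"
  define D where "D = (a\<^sup>2 + b\<^sup>2) / 2 * ?d\<^sup>2"
  have "- (u * v) \<le> 2 * u\<^sup>2 + v\<^sup>2 / 8"
    using zero_le_power2[of "4 * u + v"] by (simp add: power2_eq_square algebra_simps)
  moreover have "v\<^sup>2 \<le> 4 * D"
  proof -
    have "(a + b)\<^sup>2 \<le> 2 * (a\<^sup>2 + b\<^sup>2)"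
      using zero_le_power2[of "a - b"] by (simp add: power2_eq_square algebra_simps)
    then have "(a + b)\<^sup>2 * ?d\<^sup>2 \<le> 2 * (a\<^sup>2 + b\<^sup>2) * ?d\<^sup>2" by (rule mult_right_mono) simp
    moreover have "4 * D = 2 * (a\<^sup>2 + b\<^sup>2) * ?d\<^sup>2" by (simp add: D_def)
    ultimately show ?thesis by (simp add: power_mult_distrib v_def)
  qed
  moreover have "u\<^sup>2 \<le> M\<^sup>2 * (a - b)\<^sup>2" using m by (simp only: u_def power_mult_distrib)
  moreover have "(a\<^sup>2 * p - b\<^sup>2 * q) * ?d = D + u * v" using split by (simp add: D_def u_def v_def)
  ultimately have "D \<le> 2 * ((a\<^sup>2 * p - b\<^sup>2 * q) * ?d) + 4 * (M\<^sup>2 * (a - b)\<^sup>2)" by linarith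
  then show ?thesis by (simp add: D_def mult.assoc)
qed

text \<open>Testing the Laplacian of \<open>f\<close> against \<open>\<eta>\<^sup>2 f\<close> (the Caccioppoli inequality). The size of the support of \<open>\<eta>\<close>
does not enter, only the energy of \<open>\<eta>\<close>.\<close>

lemma caccioppoli:
  fixes \<eta> f :: "site \<Rightarrow> real"
  assumes bound: "\<And>x. \<bar>f x\<bar> \<le> M" and supp: "\<And>x. N \<le> supnorm x \<Longrightarrow> \<eta> x = 0"
  shows "(\<Sum>x\<in>square N. ((\<eta> (x + (1, 0)))\<^sup>2 + (\<eta> x)\<^sup>2) / 2 * (f (x + (1, 0)) - f x)\<^sup>2
                   + ((\<eta> (x + (0, 1)))\<^sup>2 + (\<eta> x)\<^sup>2) / 2 * (f (x + (0, 1)) - f x)\<^sup>2)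
         \<le> 4 * M\<^sup>2 * energy (square N) \<eta> - 2 * (\<Sum>x\<in>square N. (\<eta> x)\<^sup>2 * f x * lap f x)"
proof -
  define g where "g x = (\<eta> x)\<^sup>2 * f x" for x
  have sbp: "(\<Sum>x\<in>square N. g x * lap f x) =
         - (\<Sum>x\<in>square N. (g (x + (1, 0)) - g x) * (f (x + (1, 0)) - f x)
                       + (g (x + (0, 1)) - g x) * (f (x + (0, 1)) - f x))"
    by (rule summation_by_parts) (simp add: g_def supp)
  have "(\<Sum>x\<in>square N. ((\<eta> (x + (1, 0)))\<^sup>2 + (\<eta> x)\<^sup>2) / 2 * (f (x + (1, 0)) - f x)\<^sup>2
                   + ((\<eta> (x + (0, 1)))\<^sup>2 + (\<eta> x)\<^sup>2) / 2 * (f (x + (0, 1)) - f x)\<^sup>2)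
    \<le> (\<Sum>x\<in>square N. (2 * ((g (x + (1, 0)) - g x) * (f (x + (1, 0)) - f x)) + 4 * M\<^sup>2 * (\<eta> (x + (1, 0)) - \<eta> x)\<^sup>2)
                 + (2 * ((g (x + (0, 1)) - g x) * (f (x + (0, 1)) - f x)) + 4 * M\<^sup>2 * (\<eta> (x + (0, 1)) - \<eta> x)\<^sup>2))"
    unfolding g_def by (intro sum_mono add_mono energy_term_bound bound)
  also have "\<dots> = 4 * M\<^sup>2 * energy (square N) \<eta> - 2 * (\<Sum>x\<in>square N. g x * lap f x)"
    by (simp only: sbp energy_def sum.distrib sum_distrib_left[symmetric]) (simp add: algebra_simps)
  finally show ?thesis by (simp add: g_def)
qed

text \<open>The logarithmic cutoff. Its energy tends to 0 while its values tend to 1, which is possible because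
the plane is recurrent.\<close>

definition cutoff :: "nat \<Rightarrow> site \<Rightarrow> real" where
  "cutoff N x = max 0 (1 - harm (supnorm x) / harm N)"

lemma card_shell: "card (square (Suc N) - square N) = 8 * Suc N"
proof -
  have c: "card (square n) = (2 * n + 1) * (2 * n + 1)" for n
    by (simp add: square_eq nat_add_distrib nat_mult_distrib)
  have "card (square (Suc N) - square N) = card (square (Suc N)) - card (square N)"
    by (intro card_Diff_subset) (auto simp: square_mono)
  then show ?thesis by (simp add: c algebra_simps)
qed

text \<open>A shell of radius \<open>k\<close> has \<open>8 k\<close> sites, so its share is \<open>8 / k\<close>.\<close>

lemma sum_inverse_square_le: "(\<Sum>x\<in>square N. 1 / (real (max 1 (supnorm x)))\<^sup>2) \<le> 1 + 8 * harm N"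
proof (induction N)
  case 0
  have "square 0 = {(0, 0)}" by (auto simp: square_eq)
  then show ?case by (simp add: supnorm_def harm_expand)
next
  case (Suc N)
  have "square (Suc N) = square N \<union> (square (Suc N) - square N)" using square_mono[of N "Suc N"] by auto
  then have "(\<Sum>x\<in>square (Suc N). 1 / (real (max 1 (supnorm x)))\<^sup>2)
    = (\<Sum>x\<in>square N. 1 / (real (max 1 (supnorm x)))\<^sup>2) + (\<Sum>x\<in>square (Suc N) - square N. 1 / (real (max 1 (supnorm x)))\<^sup>2)"
    by (metis (no_types, lifting) Diff_disjoint finite_Diff finite_square sum.union_disjoint)
  also have "(\<Sum>x\<in>square (Suc N) - square N. 1 / (real (max 1 (supnorm x)))\<^sup>2)
    = (\<Sum>x\<in>square (Suc N) - square N. 1 / (real (Suc N))\<^sup>2)"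
    by (intro sum.cong) (auto simp: square_def le_Suc_eq)
  also have "\<dots> = 8 * inverse (real (Suc N))"
    by (simp only: sum_constant card_shell) (simp add: power2_eq_square divide_inverse del: of_nat_Suc mult_Suc_right)
  finally show ?case using Suc by (simp add: harm_Suc)
qed

lemma supnorm_step:
  assumes "s \<in> {(1, 0), (0, 1)}"
  shows "supnorm (x + s) \<le> Suc (supnorm x)" "supnorm x \<le> Suc (supnorm (x + s))"
  using assms by (cases x; auto simp: supnorm_def)+

lemma harm_diff_le:
  assumes "m \<le> Suc n" "n \<le> Suc m"
  shows "\<bar>harm m - harm n\<bar> \<le> 1 / real (max 1 n)"
proof -
  consider "m = n" | "m = Suc n" | "n = Suc m" using assms by linarith
  then show ?thesis
  proof cases
    case 2
    then show ?thesis by (auto simp: harm_Suc field_simps max_def)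
  next
    case 3
    then show ?thesis by (auto simp: harm_Suc field_simps max_def)
  qed auto
qed

lemma cutoff_step:
  assumes "s \<in> {(1, 0), (0, 1)}" and "0 < N"
  shows "(cutoff N (x + s) - cutoff N x)\<^sup>2 \<le> 1 / (real (max 1 (supnorm x)))\<^sup>2 / (harm N)\<^sup>2"
proof -
  have h: "harm N > (0::real)" using assms by (simp add: harm_pos)
  have "\<bar>cutoff N (x + s) - cutoff N x\<bar> \<le> \<bar>harm (supnorm (x + s)) / harm N - harm (supnorm x) / harm N\<bar>"
    by (auto simp: cutoff_def max_def abs_if)
  also have "\<dots> = \<bar>harm (supnorm (x + s)) - harm (supnorm x)\<bar> / harm N"
    using h by (simp add: diff_divide_distrib[symmetric])
  also have "\<dots> \<le> 1 / real (max 1 (supnorm x)) / harm N"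
    using h by (intro divide_right_mono harm_diff_le supnorm_step assms less_imp_le)
  finally have "\<bar>cutoff N (x + s) - cutoff N x\<bar>\<^sup>2 \<le> (1 / real (max 1 (supnorm x)) / harm N)\<^sup>2"
    by (intro power_mono) auto
  then show ?thesis by (simp add: power_divide power_mult_distrib)
qed

lemma energy_cutoff_le:
  assumes "0 < N" shows "energy (square N) (cutoff N) \<le> 18 / harm N"
proof -
  have h: "harm N \<ge> (1::real)" using harm_mono[of 1 N, where 'a = real] assms by (simp add: harm_expand)
  have "energy (square N) (cutoff N) \<le> (\<Sum>x\<in>square N. 1 / (real (max 1 (supnorm x)))\<^sup>2 / (harm N)\<^sup>2
           + 1 / (real (max 1 (supnorm x)))\<^sup>2 / (harm N)\<^sup>2)"
    unfolding energy_def by (intro sum_mono add_mono cutoff_step assms) auto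
  also have "\<dots> = 2 * (\<Sum>x\<in>square N. 1 / (real (max 1 (supnorm x)))\<^sup>2) / (harm N)\<^sup>2"
    by (simp add: sum_divide_distrib sum_distrib_left sum.distrib mult.commute)
  also have "\<dots> \<le> 2 * (1 + 8 * harm N) / (harm N)\<^sup>2"
    by (intro divide_right_mono mult_left_mono sum_inverse_square_le) auto
  also have "\<dots> \<le> (18 * harm N) / (harm N)\<^sup>2" using h by (intro divide_right_mono) auto
  also have "\<dots> = 18 / harm N" using h by (simp add: power2_eq_square)
  finally show ?thesis .
qed

lemma energy_cutoff_tendsto: "(\<lambda>N. energy (square N) (cutoff N)) \<longlonglongrightarrow> 0"
proof (rule tendsto_sandwich[OF _ _ tendsto_const])
  show "eventually (\<lambda>N. 0 \<le> energy (square N) (cutoff N)) sequentially"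
    by (simp add: energy_def sum_nonneg)
  show "eventually (\<lambda>N. energy (square N) (cutoff N) \<le> 18 / harm N) sequentially"
    using eventually_gt_at_top[of 0] by eventually_elim (rule energy_cutoff_le)
  show "(\<lambda>N. 18 / harm N :: real) \<longlonglongrightarrow> 0"
    by (intro tendsto_divide_0[OF tendsto_const] filterlim_at_top_imp_at_infinity harm_at_top)
qed

lemma cutoff_tendsto: "(\<lambda>N. cutoff N x) \<longlonglongrightarrow> 1"
proof -
  have "(\<lambda>N. harm (supnorm x) / harm N :: real) \<longlonglongrightarrow> 0"
    by (intro tendsto_divide_0[OF tendsto_const] filterlim_at_top_imp_at_infinity harm_at_top)
  then have "(\<lambda>N. max 0 (1 - harm (supnorm x) / harm N) :: real) \<longlonglongrightarrow> max 0 (1 - 0)"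
    by (intro tendsto_intros)
  then show ?thesis by (simp add: cutoff_def)
qed

lemma cutoff_range: "0 \<le> cutoff N x" "cutoff N x \<le> 1"
  by (auto simp: cutoff_def harm_nonneg)

lemma cutoff_eq_0:
  assumes "0 < N" "N \<le> supnorm x" shows "cutoff N x = 0"
proof -
  have "harm N > (0::real)" using assms by (simp add: harm_pos)
  then have "1 \<le> harm (supnorm x) / (harm N :: real)"
    using harm_mono[OF assms(2), where 'a = real] by (simp add: field_simps)
  then show ?thesis by (simp add: cutoff_def)
qed

section \<open>Bounded functions that are harmonic off a finite set\<close>

text \<open>The Caccioppoli inequality for the logarithmic cutoffs, in the limit in which their own energy
disappears.\<close>

lemma energy_le_of_weighted:
  fixes f :: "site \<Rightarrow> real"
  assumes bound: "\<And>x. \<bar>f x\<bar> \<le> M"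
    and K: "\<And>N. - 2 * (\<Sum>x\<in>square N. (cutoff N x)\<^sup>2 * f x * lap f x) \<le> K"
  shows "energy (square n) f \<le> K"
proof -
  define w where "w s N x = ((cutoff N (x + s))\<^sup>2 + (cutoff N x)\<^sup>2) / 2" for s :: site and N x
  define F where "F N = (\<Sum>x\<in>square n. w (1, 0) N x * (f (x + (1, 0)) - f x)\<^sup>2
      + w (0, 1) N x * (f (x + (0, 1)) - f x)\<^sup>2)" for N
  have "F \<longlonglongrightarrow> (\<Sum>x\<in>square n. (1\<^sup>2 + 1\<^sup>2) / 2 * (f (x + (1, 0)) - f x)\<^sup>2
      + (1\<^sup>2 + 1\<^sup>2) / 2 * (f (x + (0, 1)) - f x)\<^sup>2)"
    unfolding F_def w_def by (intro tendsto_intros cutoff_tendsto) auto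
  then have "F \<longlonglongrightarrow> energy (square n) f" by (simp add: energy_def)
  moreover have "(\<lambda>N. 4 * M\<^sup>2 * energy (square N) (cutoff N) + K) \<longlonglongrightarrow> 4 * M\<^sup>2 * 0 + K"
    by (intro tendsto_intros energy_cutoff_tendsto)
  moreover have "eventually (\<lambda>N. F N \<le> 4 * M\<^sup>2 * energy (square N) (cutoff N) + K) sequentially"
    using eventually_ge_at_top[of "max 1 n"]
  proof eventually_elim
    case (elim N)
    have "F N \<le> (\<Sum>x\<in>square N. w (1, 0) N x * (f (x + (1, 0)) - f x)\<^sup>2
      + w (0, 1) N x * (f (x + (0, 1)) - f x)\<^sup>2)"
      unfolding F_def using elim by (intro sum_mono2 square_mono) (auto simp: w_def)
    also have "\<dots> \<le> 4 * M\<^sup>2 * energy (square N) (cutoff N) - 2 * (\<Sum>x\<in>square N. (cutoff N x)\<^sup>2 * f x * lap f x)"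
      unfolding w_def using elim by (intro caccioppoli bound cutoff_eq_0) auto
    finally show ?case using K[of N] by simp
  qed
  ultimately show ?thesis using tendsto_le[OF sequentially_bot] by fastforce
qed

lemma constant_if_energy_zero:
  assumes "\<And>n. energy (square n) f \<le> 0"
  shows "f x = f y"
proof -
  have step: "f (x + (1, 0)) = f x \<and> f (x + (0, 1)) = f x" for x
  proof -
    have x: "x \<in> square (supnorm x)" by (simp add: square_def)
    have "0 \<le> energy (square (supnorm x)) f" by (auto simp: energy_def intro!: sum_nonneg)
    then have "energy (square (supnorm x)) f = 0" using assms[of "supnorm x"] by simp
    then have "(f (x + (1, 0)) - f x)\<^sup>2 + (f (x + (0, 1)) - f x)\<^sup>2 = 0"
      unfolding energy_def using x by (subst (asm) sum_nonneg_eq_0_iff) auto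
    then show ?thesis by (simp add: sum_power2_eq_zero_iff)
  qed
  have 1: "f (i, j) = f (0, j)" for i j
  proof (induction i rule: int_induct[where k = 0])
    case (step1 i) then show ?case using step[of "(i, j)"] by simp
  next
    case (step2 i) then show ?case using step[of "(i - 1, j)"] by simp
  qed simp
  have 2: "f (0, j) = f (0, 0)" for j
  proof (induction j rule: int_induct[where k = 0])
    case (step1 j) then show ?case using step[of "(0, j)"] by simp
  next
    case (step2 j) then show ?case using step[of "(0, j - 1)"] by simp
  qed simp
  show ?thesis using 1 2 by (metis prod.collapse)
qed

text \<open>The Liouville property of a recurrent graph: here the source term in \<open>energy_le_of_weighted\<close> has the
sign that forces the energy to be 0.\<close>

theorem bounded_subharmonic_constant:
  assumes "\<And>x. 0 \<le> f x" "\<And>x. f x \<le> M" "\<And>x. 0 \<le> lap f x"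
  shows "f x = f y"
proof (rule constant_if_energy_zero)
  fix n show "energy (square n) f \<le> 0"
  proof (rule energy_le_of_weighted)
    show "\<bar>f x\<bar> \<le> M" for x using assms(1,2)[of x] by simp
    show "- 2 * (\<Sum>x\<in>square N. (cutoff N x)\<^sup>2 * f x * lap f x) \<le> 0" for N
      using assms by (auto intro!: sum_nonneg mult_nonneg_nonneg)
  qed
qed

text \<open>Recurrence makes this hold on infinite domains too: the positive part of \<open>f\<close>, continued by 0 off \<open>D\<close>, is a bounded subharmonic
function on the whole lattice, hence constant, and it vanishes somewhere.\<close>

theorem maximum_principle:
  assumes bd: "\<And>x. f x \<le> M" and sub: "\<And>x. x \<in> D \<Longrightarrow> 0 \<le> lap f x" and "D \<noteq> UNIV"
    and bdry: "\<And>x y. x \<in> D \<Longrightarrow> y \<in> nbrs x \<Longrightarrow> y \<notin> D \<Longrightarrow> f y \<le> 0"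
    and "x \<in> D"
  shows "f x \<le> 0"
proof -
  define u where "u x = (if x \<in> D then max 0 (f x) else 0)" for x
  have "0 \<le> lap u x" for x
  proof (cases "0 < u x")
    case True
    then have x: "x \<in> D" "u x = f x" by (auto simp: u_def split: if_splits)
    have "(\<Sum>v\<in>nbrs x. f v) \<le> (\<Sum>v\<in>nbrs x. u v)"
      using bdry[OF x(1)] by (intro sum_mono) (auto simp: u_def)
    then show ?thesis using sub[OF x(1)] x by (simp add: lap_def)
  next
    case False
    then have "u x = 0" by (auto simp: u_def split: if_splits)
    then show ?thesis by (auto simp: lap_def u_def intro!: sum_nonneg)
  qed
  moreover have "0 \<le> u x" "u x \<le> max 0 M" for x using bd[of x] by (auto simp: u_def)
  ultimately have "u x = u y" for y by (intro bounded_subharmonic_constant)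
  moreover obtain y where "y \<notin> D" using \<open>D \<noteq> UNIV\<close> by auto
  ultimately show ?thesis using \<open>x \<in> D\<close> by (metis max.cobounded2 u_def)
qed

lemma energy_bounded:
  assumes bound: "\<And>x. \<bar>f x\<bar> \<le> M" and "finite B" and harm: "\<And>x. x \<notin> B \<Longrightarrow> lap f x = 0"
  obtains C where "0 \<le> C" "\<And>n. energy (square n) f \<le> C"
proof
  define C where "C = 2 * (\<Sum>x\<in>B. \<bar>f x * lap f x\<bar>)"
  show "0 \<le> C" by (simp add: C_def sum_nonneg)
  show "energy (square n) f \<le> C" for n
  proof (rule energy_le_of_weighted[OF bound])
    fix N
    have "- (\<Sum>x\<in>square N. (cutoff N x)\<^sup>2 * f x * lap f x) = - (\<Sum>x\<in>square N \<inter> B. (cutoff N x)\<^sup>2 * f x * lap f x)"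
      by (intro arg_cong[where f = uminus] sum.mono_neutral_right) (auto simp: harm)
    also have "\<dots> \<le> (\<Sum>x\<in>square N \<inter> B. \<bar>f x * lap f x\<bar>)"
      unfolding sum_negf[symmetric]
    proof (intro sum_mono)
      fix x
      have "(cutoff N x)\<^sup>2 \<le> 1" using cutoff_range[of N x] by (simp add: power_le_one)
      then have "(cutoff N x)\<^sup>2 * \<bar>f x * lap f x\<bar> \<le> 1 * \<bar>f x * lap f x\<bar>" by (intro mult_right_mono) auto
      moreover have "- ((cutoff N x)\<^sup>2 * f x * lap f x) \<le> \<bar>(cutoff N x)\<^sup>2 * (f x * lap f x)\<bar>" by (simp add: mult.assoc)
      moreover have "\<bar>(cutoff N x)\<^sup>2 * (f x * lap f x)\<bar> = (cutoff N x)\<^sup>2 * \<bar>f x * lap f x\<bar>" by (simp add: abs_mult)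
      ultimately show "- ((cutoff N x)\<^sup>2 * f x * lap f x) \<le> \<bar>f x * lap f x\<bar>" by linarith
    qed
    also have "\<dots> \<le> (\<Sum>x\<in>B. \<bar>f x * lap f x\<bar>)" using \<open>finite B\<close> by (intro sum_mono2) auto
    finally show "- 2 * (\<Sum>x\<in>square N. (cutoff N x)\<^sup>2 * f x * lap f x) \<le> C" by (simp add: C_def)
  qed
qed

text \<open>By parts against a cutoff, the flux becomes a mixed energy of the cutoff and \<open>f\<close>. It tends to 0 by
Cauchy and Schwarz, as the energy of \<open>f\<close> is finite and that of the cutoff tends to 0.\<close>

theorem flux_zero:
  assumes bound: "\<And>x. \<bar>f x\<bar> \<le> M" and "finite B" and harm: "\<And>x. x \<notin> B \<Longrightarrow> lap f x = 0"
  shows "(\<Sum>b\<in>B. lap f b) = 0"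
proof -
  obtain C where C: "0 \<le> C" "\<And>n. energy (square n) f \<le> C" using energy_bounded[OF assms] by blast
  obtain N0 where N0: "B \<subseteq> square N0" using finite_subset_square[OF \<open>finite B\<close>] by blast
  define S where "S N = (\<Sum>x\<in>B. cutoff N x * lap f x)" for N
  have "S \<longlonglongrightarrow> (\<Sum>x\<in>B. 1 * lap f x)" unfolding S_def by (intro tendsto_intros cutoff_tendsto)
  then have lim: "(\<lambda>N. \<bar>S N\<bar>) \<longlonglongrightarrow> \<bar>\<Sum>x\<in>B. lap f x\<bar>" by (simp add: tendsto_rabs)
  have S: "\<bar>S N\<bar> \<le> energy (square N) (cutoff N) / (2 * t) + t / 2 * C" if "max 1 N0 \<le> N" "0 < t" for N t
  proof -
    have young: "\<bar>a * b\<bar> \<le> a\<^sup>2 / (2 * t) + t / 2 * b\<^sup>2" for a b :: real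
    proof -
      have "0 \<le> (\<bar>a\<bar> - t * \<bar>b\<bar>)\<^sup>2" by simp
      then have "2 * t * \<bar>a * b\<bar> \<le> a\<^sup>2 + t * t * b\<^sup>2" by (simp add: power2_diff power_mult_distrib abs_mult) (simp add: power2_eq_square mult_ac)
      then show ?thesis using \<open>0 < t\<close> by (simp add: field_simps)
    qed
    have "S N = (\<Sum>x\<in>square N. cutoff N x * lap f x)"
      unfolding S_def using N0 square_mono[of N0 N] that by (intro sum.mono_neutral_left) (auto simp: harm)
    also have "\<dots> = - (\<Sum>x\<in>square N. (cutoff N (x + (1, 0)) - cutoff N x) * (f (x + (1, 0)) - f x)
                       + (cutoff N (x + (0, 1)) - cutoff N x) * (f (x + (0, 1)) - f x))"
      using that by (intro summation_by_parts cutoff_eq_0) auto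
    finally have "\<bar>S N\<bar> \<le> (\<Sum>x\<in>square N. \<bar>(cutoff N (x + (1, 0)) - cutoff N x) * (f (x + (1, 0)) - f x)
                       + (cutoff N (x + (0, 1)) - cutoff N x) * (f (x + (0, 1)) - f x)\<bar>)" by (simp add: sum_abs)
    also have "\<dots> \<le> (\<Sum>x\<in>square N. ((cutoff N (x + (1, 0)) - cutoff N x)\<^sup>2 / (2 * t) + t / 2 * (f (x + (1, 0)) - f x)\<^sup>2)
                + ((cutoff N (x + (0, 1)) - cutoff N x)\<^sup>2 / (2 * t) + t / 2 * (f (x + (0, 1)) - f x)\<^sup>2))"
      by (intro sum_mono order_trans[OF abs_triangle_ineq] add_mono young)
    also have "\<dots> = energy (square N) (cutoff N) / (2 * t) + t / 2 * energy (square N) f"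
      by (simp only: energy_def sum.distrib sum_divide_distrib sum_distrib_left add_divide_distrib distrib_left)
    also have "\<dots> \<le> energy (square N) (cutoff N) / (2 * t) + t / 2 * C" using C \<open>0 < t\<close> by simp
    finally show ?thesis .
  qed
  have *: "\<bar>\<Sum>x\<in>B. lap f x\<bar> \<le> t / 2 * C" if "0 < t" for t
  proof (rule tendsto_le[OF sequentially_bot _ lim])
    show "(\<lambda>N. energy (square N) (cutoff N) / (2 * t) + t / 2 * C) \<longlonglongrightarrow> t / 2 * C"
      using tendsto_add[OF tendsto_divide[OF energy_cutoff_tendsto tendsto_const[of "2 * t"]] tendsto_const[of "t / 2 * C"]] that
      by simp
    show "eventually (\<lambda>N. \<bar>S N\<bar> \<le> energy (square N) (cutoff N) / (2 * t) + t / 2 * C) sequentially"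
      using eventually_ge_at_top[of "max 1 N0"] by eventually_elim (rule S[OF _ that])
  qed
  have "\<bar>\<Sum>x\<in>B. lap f x\<bar> \<le> e" if "0 < e" for e
  proof -
    have "0 < 2 * e / (C + 1)" using that C by simp
    then have "\<bar>\<Sum>x\<in>B. lap f x\<bar> \<le> 2 * e / (C + 1) / 2 * C" by (rule *)
    also have "\<dots> = e * (C / (C + 1))" using C(1) add_nonneg_eq_0_iff[of C 1] by (simp add: divide_simps)
    also have "\<dots> \<le> e * 1" using that C by (intro mult_left_mono) auto
    finally show ?thesis by simp
  qed
  then show ?thesis by (metis abs_le_zero_iff field_le_epsilon add_0)
qed

abbreviation at_inf :: "site filter" where
  "at_inf \<equiv> filtercomap (\<lambda>y. norm (embed y)) at_top"

lemma norm_embed_le: "norm (embed y) \<le> 2 * real (supnorm y)"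
proof -
  have "norm (embed y) \<le> norm (fst (embed y)) + norm (snd (embed y))"
    by (metis norm_Pair_le prod.collapse)
  also have "\<dots> \<le> 2 * real (supnorm y)" by (auto simp: embed_def supnorm_def)
  finally show ?thesis .
qed

lemma eventually_at_inf_supnorm: "eventually (\<lambda>y. n \<le> supnorm y) at_inf"
proof -
  have "eventually (\<lambda>y. 2 * real n \<le> norm (embed y)) at_inf"
    by (rule eventually_filtercomapI) (rule eventually_ge_at_top)
  then show ?thesis
  proof eventually_elim
    case (elim y)
    then show ?case using norm_embed_le[of y] by linarith
  qed
qed

lemma eventually_at_inf_notin:
  assumes "finite S" shows "eventually (\<lambda>y. y \<notin> S) at_inf"
proof -
  obtain N where "S \<subseteq> square N" using finite_subset_square[OF assms] by blast
  then show ?thesis using eventually_at_inf_supnorm[of "Suc N"] by (auto elim!: eventually_mono simp: square_def)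
qed

lemma at_inf_neq_bot [simp]: "at_inf \<noteq> bot"
proof
  assume "at_inf = bot"
  then have "eventually (\<lambda>_. False) at_inf" by simp
  then obtain P where P: "eventually P at_top" "\<And>y. \<not> P (norm (embed y))"
    unfolding eventually_filtercomap by blast
  from P(1) obtain r where "\<And>x. x \<ge> r \<Longrightarrow> P x" unfolding eventually_at_top_linorder by blast
  moreover have "norm (embed (int (nat \<lceil>\<bar>r\<bar>\<rceil>), 0)) \<ge> r"
    by (simp add: embed_def norm_Pair) linarith
  ultimately show False using P(2) by blast
qed

text \<open>The variation of \<open>f\<close> along the four sides of the square of radius \<open>k\<close>.\<close>

definition ring_var :: "(site \<Rightarrow> real) \<Rightarrow> nat \<Rightarrow> real" where
  "ring_var f k = (\<Sum>j\<in>{- int k..<int k}.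
      \<bar>f (int k, j + 1) - f (int k, j)\<bar> + \<bar>f (- int k, j + 1) - f (- int k, j)\<bar>
    + \<bar>f (j + 1, int k) - f (j, int k)\<bar> + \<bar>f (j + 1, - int k) - f (j, - int k)\<bar>)"

lemma segment_le:
  fixes g :: "int \<Rightarrow> real"
  assumes "- k \<le> i" "i \<le> k"
  shows "\<bar>g i - g k\<bar> \<le> (\<Sum>j\<in>{- k..<k}. \<bar>g (j + 1) - g j\<bar>)"
proof -
  have "\<bar>g i - g k\<bar> \<le> (\<Sum>j\<in>{i..<k}. \<bar>g (j + 1) - g j\<bar>)"
    using assms(2)
  proof (induction i rule: int_le_induct)
    case (step i)
    have "{i - 1..<k} = insert (i - 1) {i..<k}" using step by auto
    then show ?case using step by simp
  qed simp
  also have "\<dots> \<le> (\<Sum>j\<in>{- k..<k}. \<bar>g (j + 1) - g j\<bar>)"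
    using assms by (intro sum_mono2) auto
  finally show ?thesis .
qed

lemma ring_osc:
  assumes "supnorm y = k"
  shows "\<bar>f y - f (int k, int k)\<bar> \<le> ring_var f k"
proof -
  obtain a b where y: "y = (a, b)" by fastforce
  let ?k = "int k"
  have ab: "- ?k \<le> a" "a \<le> ?k" "- ?k \<le> b" "b \<le> ?k" "\<bar>a\<bar> = ?k \<or> \<bar>b\<bar> = ?k"
    using assms by (auto simp: supnorm_def y max_def split: if_splits)
  let ?s = "\<lambda>g. \<Sum>j\<in>{- ?k..<?k}. \<bar>g (j + 1) - g j\<bar>"
  have split: "ring_var f k = ?s (\<lambda>j. f (?k, j)) + ?s (\<lambda>j. f (- ?k, j)) + ?s (\<lambda>j. f (j, ?k)) + ?s (\<lambda>j. f (j, - ?k))"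
    by (simp add: ring_var_def sum.distrib)
  have nn: "0 \<le> ?s g" for g :: "int \<Rightarrow> real" by (intro sum_nonneg abs_ge_zero)
  note seg = segment_le[of ?k _ "\<lambda>j. f (?k, j)"] segment_le[of ?k _ "\<lambda>j. f (- ?k, j)"]
    segment_le[of ?k _ "\<lambda>j. f (j, ?k)"] segment_le[of ?k _ "\<lambda>j. f (j, - ?k)"]
  consider "a = ?k" | "a = - ?k" | "b = ?k" | "b = - ?k" using ab(5) by linarith
  then show ?thesis
  proof cases
    case 1
    show ?thesis unfolding split y 1
      using seg(1)[of b] ab nn[of "\<lambda>j. f (- ?k, j)"] nn[of "\<lambda>j. f (j, ?k)"] nn[of "\<lambda>j. f (j, - ?k)"] by linarith
  next
    case 2
    show ?thesis unfolding split y 2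
      using seg(2)[of b] seg(3)[of "- ?k"] ab nn[of "\<lambda>j. f (?k, j)"] nn[of "\<lambda>j. f (j, - ?k)"] by linarith
  next
    case 3
    show ?thesis unfolding split y 3
      using seg(3)[of a] ab nn[of "\<lambda>j. f (- ?k, j)"] nn[of "\<lambda>j. f (?k, j)"] nn[of "\<lambda>j. f (j, - ?k)"] by linarith
  next
    case 4
    show ?thesis unfolding split y 4
      using seg(4)[of a] seg(1)[of "- ?k"] ab nn[of "\<lambda>j. f (- ?k, j)"] nn[of "\<lambda>j. f (j, ?k)"] by linarith
  qed
qed

lemma sum_rings_le:
  fixes F :: "site \<Rightarrow> real"
  assumes "\<And>x. 0 \<le> F x" and \<pi>: "\<pi> \<in> {\<lambda>(k, j). (int k, j), \<lambda>(k, j). (- int k, j), \<lambda>(k, j). (j, int k), \<lambda>(k, j). (j, - int k)}"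
  shows "(\<Sum>k\<in>{1..N}. \<Sum>j\<in>{- int k..<int k}. F (\<pi> (k, j))) \<le> (\<Sum>x\<in>square N. F x)"
proof -
  let ?S = "SIGMA k:{1..N}. {- int k..<int k}"
  have inj: "inj_on \<pi> ?S" using \<pi> by (auto simp: inj_on_def)
  have "(\<Sum>k\<in>{1..N}. \<Sum>j\<in>{- int k..<int k}. F (\<pi> (k, j))) = (\<Sum>p\<in>?S. F (\<pi> p))"
    by (subst sum.Sigma) (auto intro!: sum.cong)
  also have "\<dots> = (\<Sum>x\<in>\<pi> ` ?S. F x)" using inj by (simp add: sum.reindex)
  also have "\<dots> \<le> (\<Sum>x\<in>square N. F x)"
    using \<pi> assms(1) by (intro sum_mono2 finite_square) (auto simp: square_def supnorm_def)
  finally show ?thesis .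
qed

text \<open>Cauchy and Schwarz on each ring, which has \<open>8 k\<close> edges; different rings have no edge in common.\<close>

lemma sum_ring_var_le: "(\<Sum>k\<in>{1..N}. (ring_var f k)\<^sup>2 / real k) \<le> 64 * energy (square N) f"
proof -
  define h v where "h x = (f (x + (1, 0)) - f x)\<^sup>2" and "v x = (f (x + (0, 1)) - f x)\<^sup>2" for x
  let ?a = "\<lambda>k. \<Sum>j\<in>{- int k..<int k}. v (int k, j)" and ?b = "\<lambda>k. \<Sum>j\<in>{- int k..<int k}. v (- int k, j)"
  let ?c = "\<lambda>k. \<Sum>j\<in>{- int k..<int k}. h (j, int k)" and ?d = "\<lambda>k. \<Sum>j\<in>{- int k..<int k}. h (j, - int k)"
  have "(ring_var f k)\<^sup>2 / real k \<le> 8 * (?a k + ?b k + ?c k + ?d k)" if "k \<in> {1..N}" for k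
  proof -
    let ?g = "\<lambda>j. \<bar>f (int k, j + 1) - f (int k, j)\<bar> + \<bar>f (- int k, j + 1) - f (- int k, j)\<bar>
    + \<bar>f (j + 1, int k) - f (j, int k)\<bar> + \<bar>f (j + 1, - int k) - f (j, - int k)\<bar>"
    have four: "(a + b + c + d)\<^sup>2 \<le> 4 * (a\<^sup>2 + b\<^sup>2 + c\<^sup>2 + d\<^sup>2)" for a b c d :: real
      using zero_le_power2[of "a - b"] zero_le_power2[of "a - c"] zero_le_power2[of "a - d"]
        zero_le_power2[of "b - c"] zero_le_power2[of "b - d"] zero_le_power2[of "c - d"]
      by (simp add: power2_eq_square algebra_simps)
    have "(ring_var f k)\<^sup>2 = (\<Sum>j\<in>{- int k..<int k}. ?g j * 1)\<^sup>2" by (simp add: ring_var_def)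
    also have "\<dots> \<le> (\<Sum>j\<in>{- int k..<int k}. (?g j)\<^sup>2) * (\<Sum>j\<in>{- int k..<int k}. 1\<^sup>2)"
      by (rule Cauchy_Schwarz_ineq_sum)
    also have "(\<Sum>j\<in>{- int k..<int k}. 1\<^sup>2) = 2 * real k" by simp
    also have "(\<Sum>j\<in>{- int k..<int k}. (?g j)\<^sup>2) \<le> (\<Sum>j\<in>{- int k..<int k}. 4 * (v (int k, j) + v (- int k, j) + h (j, int k) + h (j, - int k)))"
      unfolding v_def h_def by (intro sum_mono order_trans[OF four]) simp
    also have "\<dots> = 4 * (?a k + ?b k + ?c k + ?d k)" by (simp add: sum.distrib sum_distrib_left)
    finally have "(ring_var f k)\<^sup>2 \<le> 4 * (?a k + ?b k + ?c k + ?d k) * (2 * real k)" by (simp add: mult_right_mono)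
    then show ?thesis using that by (simp add: field_simps)
  qed
  then have "(\<Sum>k\<in>{1..N}. (ring_var f k)\<^sup>2 / real k) \<le> (\<Sum>k\<in>{1..N}. 8 * (?a k + ?b k + ?c k + ?d k))"
    by (rule sum_mono)
  also have "\<dots> = 8 * ((\<Sum>k\<in>{1..N}. ?a k) + (\<Sum>k\<in>{1..N}. ?b k) + (\<Sum>k\<in>{1..N}. ?c k) + (\<Sum>k\<in>{1..N}. ?d k))"
    by (simp only: sum.distrib sum_distrib_left[symmetric])
  also have "\<dots> \<le> 8 * (sum v (square N) + sum v (square N) + sum h (square N) + sum h (square N))"
    using sum_rings_le[of v "\<lambda>(k, j). (int k, j)" N] sum_rings_le[of v "\<lambda>(k, j). (- int k, j)" N]
      sum_rings_le[of h "\<lambda>(k, j). (j, int k)" N] sum_rings_le[of h "\<lambda>(k, j). (j, - int k)" N]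
    by (simp add: h_def v_def) 
  also have "\<dots> \<le> 64 * energy (square N) f"
  proof -
    have "energy (square N) f = sum h (square N) + sum v (square N)" by (simp add: energy_def h_def v_def sum.distrib)
    moreover have "0 \<le> sum h (square N)" "0 \<le> sum v (square N)" by (auto simp: h_def v_def intro!: sum_nonneg)
    ultimately show ?thesis by simp
  qed
  finally show ?thesis .
qed

text \<open>If the variation stayed above \<open>\<epsilon>\<close>, the energy would be at least a multiple of the harmonic series
(the Courant--Lebesgue argument).\<close>

lemma small_ring:
  assumes E: "\<And>n. energy (square n) f \<le> C" and "0 < \<epsilon>"
  shows "\<exists>k\<ge>k0. ring_var f k < \<epsilon>"
proof (rule ccontr)
  assume "\<not> ?thesis"
  then have big: "\<epsilon> \<le> ring_var f k" if "k0 \<le> k" for k using that by force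
  have "\<epsilon>\<^sup>2 * (harm N - harm k0) \<le> 64 * C" if "k0 \<le> N" for N
  proof -
    have "(\<Sum>k\<in>{k0<..N}. 1 / real k) = harm N - harm k0"
      using that by (induction N rule: dec_induct) (auto simp: harm_Suc inverse_eq_divide sum.head_if atLeastSucAtMost_greaterThanAtMost[symmetric])
    then have "\<epsilon>\<^sup>2 * (harm N - harm k0) = (\<Sum>k\<in>{k0<..N}. \<epsilon>\<^sup>2 / real k)"
      by (simp add: sum_distrib_left flip: \<open>_ = harm N - harm k0\<close>)
    also have "\<dots> \<le> (\<Sum>k\<in>{k0<..N}. (ring_var f k)\<^sup>2 / real k)"
      using big \<open>0 < \<epsilon>\<close> by (intro sum_mono divide_right_mono power_mono) auto
    also have "\<dots> \<le> (\<Sum>k\<in>{1..N}. (ring_var f k)\<^sup>2 / real k)" by (intro sum_mono2) auto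
    also have "\<dots> \<le> 64 * C" using sum_ring_var_le[of f N] E[of N] by linarith
    finally show ?thesis .
  qed
  moreover have "eventually (\<lambda>N. harm N > 64 * C / \<epsilon>\<^sup>2 + harm k0) sequentially"
    using harm_at_top by (simp add: filterlim_at_top_dense)
  then have "eventually (\<lambda>N. harm N > 64 * C / \<epsilon>\<^sup>2 + harm k0 \<and> k0 \<le> N) sequentially"
    using eventually_ge_at_top by (rule eventually_conj)
  then obtain N where "harm N > 64 * C / \<epsilon>\<^sup>2 + harm k0" "k0 \<le> N"
    using eventually_happens by fastforce
  ultimately show False using \<open>0 < \<epsilon>\<close> by (force simp: field_simps)
qed

text \<open>On a ring of small variation \<open>f\<close> is nearly constant, and the maximum principle extends this to
everything outside the ring.\<close>

theorem harmonic_limit_at_infinity: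
  assumes bound: "\<And>x. \<bar>f x\<bar> \<le> M" and "finite B" and harm: "\<And>x. x \<notin> B \<Longrightarrow> lap f x = 0"
  shows "\<exists>L. (f \<longlongrightarrow> L) at_inf"
proof -
  obtain C where C: "\<And>n. energy (square n) f \<le> C" using energy_bounded[OF assms] by blast
  obtain N0 where N0: "B \<subseteq> square N0" using finite_subset_square[OF \<open>finite B\<close>] by blast
  have osc: "\<exists>c k. \<forall>y. k \<le> supnorm y \<longrightarrow> \<bar>f y - c\<bar> \<le> e" if "0 < e" for e
  proof -
    obtain k where k: "Suc N0 \<le> k" "ring_var f k < e" using small_ring[OF C \<open>0 < e\<close>] by blast
    let ?c = "f (int k, int k)"
    let ?D = "{x. k < supnorm x}"
    have ring: "\<bar>f y - ?c\<bar> \<le> e" if "supnorm y = k" for y using ring_osc[OF that, of f] k by linarith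
    have nbr: "supnorm y = k" if "x \<in> ?D" "y \<in> nbrs x" "y \<notin> ?D" for x y
      using that by (cases x) (auto simp: nbrs_def supnorm_def)
    have lap0: "lap f x = 0" if "x \<in> ?D" for x using that N0 k by (intro harm) (auto simp: square_def)
    have "(0, 0) \<notin> ?D" by (simp add: supnorm_def)
    then have nU: "?D \<noteq> UNIV" by blast
    have in_D: "\<bar>f x - ?c\<bar> \<le> e" if x: "x \<in> ?D" for x
    proof -
      have "f x - ?c - e \<le> 0"
      proof (rule maximum_principle[where f = "\<lambda>y. f y - ?c - e" and x = x and D = ?D and M = "2 * M - e"])
        show "f y - ?c - e \<le> 2 * M - e" for y using bound[of y] bound[of "(int k, int k)"] by linarith
        show "0 \<le> lap (\<lambda>y. f y - ?c - e) y" if "y \<in> ?D" for y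
          using lap0[OF that] by (simp add: lap_def sum_subtractf)
        show "f z - ?c - e \<le> 0" if "y \<in> ?D" "z \<in> nbrs y" "z \<notin> ?D" for y z using ring[OF nbr[OF that]] by linarith
      qed (use x nU in auto)
      moreover have "?c - f x - e \<le> 0"
      proof (rule maximum_principle[where f = "\<lambda>y. ?c - f y - e" and x = x and D = ?D and M = "2 * M - e"])
        show "?c - f y - e \<le> 2 * M - e" for y using bound[of y] bound[of "(int k, int k)"] by linarith
        show "0 \<le> lap (\<lambda>y. ?c - f y - e) y" if "y \<in> ?D" for y
          using lap0[OF that] by (simp add: lap_def sum_subtractf)
        show "?c - f z - e \<le> 0" if "y \<in> ?D" "z \<in> nbrs y" "z \<notin> ?D" for y z using ring[OF nbr[OF that]] by linarith
      qed (use x nU in auto)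
      ultimately show ?thesis by linarith
    qed
    show ?thesis using ring in_D by (intro exI[of _ ?c] exI[of _ k]) (auto simp: le_less)
  qed
  define s where "s n = f (int n, int n)" for n
  have "Cauchy s"
  proof (rule CauchyI)
    fix e :: real assume "0 < e"
    then obtain c k where ck: "\<And>y. k \<le> supnorm y \<Longrightarrow> \<bar>f y - c\<bar> \<le> e / 3" using osc[of "e / 3"] by auto
    have *: "\<bar>s n - c\<bar> \<le> e / 3" if "n \<ge> k" for n
      using ck[of "(int n, int n)"] that by (simp add: s_def supnorm_def)
    have "norm (s m - s n) < e" if "m \<ge> k" "n \<ge> k" for m n
    proof -
      have "\<bar>s m - c\<bar> \<le> e / 3" "\<bar>s n - c\<bar> \<le> e / 3" using that * by auto
      then show ?thesis using \<open>0 < e\<close> unfolding real_norm_def by linarith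
    qed
    then show "\<exists>M. \<forall>m\<ge>M. \<forall>n\<ge>M. norm (s m - s n) < e" by blast
  qed
  then obtain L where L: "s \<longlonglongrightarrow> L" using Cauchy_convergent convergent_def by blast
  have "(f \<longlongrightarrow> L) at_inf"
  proof (rule tendstoI)
    fix e :: real assume "0 < e"
    then obtain c k where ck: "\<And>y. k \<le> supnorm y \<Longrightarrow> \<bar>f y - c\<bar> \<le> e / 3" using osc[of "e / 3"] by auto
    have "\<bar>L - c\<bar> \<le> e / 3"
    proof (rule tendsto_le[OF sequentially_bot tendsto_const])
      show "(\<lambda>n. \<bar>s n - c\<bar>) \<longlonglongrightarrow> \<bar>L - c\<bar>" by (intro tendsto_intros L)
      show "eventually (\<lambda>n. \<bar>s n - c\<bar> \<le> e / 3) sequentially"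
        using eventually_ge_at_top[of k]
      proof eventually_elim
        case (elim n)
        then show ?case using ck[of "(int n, int n)"] by (simp add: s_def supnorm_def)
      qed
    qed
    show "eventually (\<lambda>y. dist (f y) L < e) at_inf"
      using eventually_at_inf_supnorm[of k]
    proof eventually_elim
      case (elim y)
      then show ?case using ck[of y] \<open>\<bar>L - c\<bar> \<le> e / 3\<close> \<open>0 < e\<close> unfolding dist_real_def by linarith
    qed
  qed
  then show ?thesis ..
qed

section \<open>Hitting probabilities and harmonic measure\<close>

abbreviation step_pmf :: "site pmf" where
  "step_pmf \<equiv> pmf_of_set {(1, 0), (- 1, 0), (0, 1), (0, - 1)}"

lemma prob_space_steps: "prob_space steps_measure"
  unfolding steps_measure_def by (intro prob_space_PiM prob_space_measure_pmf)

lemma space_steps [simp]: "space steps_measure = UNIV"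
  by (simp add: steps_measure_def space_PiM)

lemma measurable_step: "(\<lambda>\<xi>. \<xi> i) \<in> measurable steps_measure (count_space UNIV)"
proof -
  have "(\<lambda>\<xi>. \<xi> i) \<in> measurable steps_measure (measure_pmf step_pmf)"
    unfolding steps_measure_def by (rule measurable_component_singleton) simp
  then show ?thesis by (simp cong: measurable_cong_sets)
qed

lemma walk_0 [simp]: "walk y \<xi> 0 = y"
  by (simp add: walk_def)

lemma walk_Suc: "walk y \<xi> (Suc n) = walk y \<xi> n + \<xi> n"
  by (simp add: walk_def add.assoc)

lemma walk_case_nat: "walk y (case_nat s \<xi>) (Suc n) = walk (y + s) \<xi> n"
  by (induction n) (simp_all add: walk_Suc)

lemma measurable_walk: "(\<lambda>\<xi>. walk y \<xi> n) \<in> measurable steps_measure (count_space UNIV)"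
proof (induction n)
  case (Suc n)
  have "(\<lambda>\<xi>. u + \<xi> n) \<in> measurable steps_measure (count_space UNIV)" for u
    by (rule measurable_compose[OF measurable_step]) simp
  then show ?case unfolding walk_Suc
    by (rule measurable_compose_countable[OF _ Suc, where f = "\<lambda>u \<xi>. u + \<xi> n"])
qed simp

text \<open>The event in \<^const>\<open>hit_prob\<close>, stated without the least hitting time, so that it is easy to see what
becomes of it when the first step is removed.\<close>

definition hits_at :: "site set \<Rightarrow> site \<Rightarrow> site \<Rightarrow> (nat \<Rightarrow> site) set" where
  "hits_at B y x = {\<xi>. \<exists>n. walk y \<xi> n \<in> B \<and> (\<forall>m<n. walk y \<xi> m \<notin> B) \<and> walk y \<xi> n = x}"

lemma hits_at_eq:
  "{\<xi>. (\<exists>n. walk y \<xi> n \<in> B) \<and> walk y \<xi> (hitting_time B (walk y \<xi>)) = x} = hits_at B y x"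
proof (intro set_eqI)
  fix \<xi>
  show "\<xi> \<in> {\<xi>. (\<exists>n. walk y \<xi> n \<in> B) \<and> walk y \<xi> (hitting_time B (walk y \<xi>)) = x} \<longleftrightarrow> \<xi> \<in> hits_at B y x"
  proof
    assume "\<xi> \<in> {\<xi>. (\<exists>n. walk y \<xi> n \<in> B) \<and> walk y \<xi> (hitting_time B (walk y \<xi>)) = x}"
    then obtain n where n: "walk y \<xi> n \<in> B" and x: "walk y \<xi> (hitting_time B (walk y \<xi>)) = x" by blast
    have "walk y \<xi> (hitting_time B (walk y \<xi>)) \<in> B"
      unfolding hitting_time_def by (rule LeastI) (rule n)
    moreover have "\<forall>m<hitting_time B (walk y \<xi>). walk y \<xi> m \<notin> B"
      unfolding hitting_time_def using not_less_Least by auto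
    ultimately show "\<xi> \<in> hits_at B y x"
      unfolding hits_at_def using x by auto
  next
    assume "\<xi> \<in> hits_at B y x"
    then obtain n where n: "walk y \<xi> n \<in> B" "\<forall>m<n. walk y \<xi> m \<notin> B" "walk y \<xi> n = x" by (auto simp: hits_at_def)
    then have "hitting_time B (walk y \<xi>) = n" unfolding hitting_time_def
      by (intro Least_equality) (auto simp: not_less[symmetric])
    then show "\<xi> \<in> {\<xi>. (\<exists>n. walk y \<xi> n \<in> B) \<and> walk y \<xi> (hitting_time B (walk y \<xi>)) = x}" using n by auto
  qed
qed

lemma hit_prob_eq: "hit_prob B y x = measure steps_measure (hits_at B y x)"
  unfolding hit_prob_def by (simp add: hits_at_eq)

lemma sets_hits_at [measurable]: "hits_at B y x \<in> sets steps_measure"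
proof -
  note measurable_walk[measurable]
  have "{\<xi> \<in> space steps_measure. \<exists>n. walk y \<xi> n \<in> B \<and> (\<forall>m<n. walk y \<xi> m \<notin> B) \<and> walk y \<xi> n = x} \<in> sets steps_measure"
    by measurable
  then show ?thesis by (simp add: hits_at_def)
qed

lemma hit_prob_nonneg: "0 \<le> hit_prob B y x"
  by (simp add: hit_prob_eq)

lemma hit_prob_le_1: "hit_prob B y x \<le> 1"
  by (simp add: hit_prob_eq prob_space.prob_le_1[OF prob_space_steps])

lemma hit_prob_on: "y \<in> B \<Longrightarrow> hit_prob B y x = (if x = y then 1 else 0)"
proof -
  assume y: "y \<in> B"
  have "hits_at B y x = (if x = y then UNIV else {})"
  proof -
    have "(\<exists>n. walk y \<xi> n \<in> B \<and> (\<forall>m<n. walk y \<xi> m \<notin> B) \<and> walk y \<xi> n = x) \<longleftrightarrow> x = y" for \<xi>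
    proof
      assume "\<exists>n. walk y \<xi> n \<in> B \<and> (\<forall>m<n. walk y \<xi> m \<notin> B) \<and> walk y \<xi> n = x"
      then obtain n where n: "\<forall>m<n. walk y \<xi> m \<notin> B" "walk y \<xi> n = x" by blast
      have "n = 0" using n(1) y by (metis gr0I walk_0)
      then show "x = y" using n(2) by simp
    next
      assume "x = y"
      then show "\<exists>n. walk y \<xi> n \<in> B \<and> (\<forall>m<n. walk y \<xi> m \<notin> B) \<and> walk y \<xi> n = x" using y by (intro exI[of _ 0]) simp
    qed
    then show ?thesis by (auto simp: hits_at_def)
  qed
  then show ?thesis using prob_space.prob_space[OF prob_space_steps] by (simp add: hit_prob_eq)
qed

lemma hits_at_case_nat:
  assumes "y \<notin> B"
  shows "case_nat s \<xi> \<in> hits_at B y x \<longleftrightarrow> \<xi> \<in> hits_at B (y + s) x"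
proof
  assume "case_nat s \<xi> \<in> hits_at B y x"
  then obtain n where n: "walk y (case_nat s \<xi>) n \<in> B" "\<forall>m<n. walk y (case_nat s \<xi>) m \<notin> B"
    "walk y (case_nat s \<xi>) n = x" by (auto simp: hits_at_def)
  then obtain k where k: "n = Suc k" using assms by (cases n) auto
  have "\<forall>m<k. walk (y + s) \<xi> m \<notin> B" using n(2) by (auto simp: k walk_case_nat[symmetric])
  then show "\<xi> \<in> hits_at B (y + s) x" using n(1,3) by (auto simp: k walk_case_nat hits_at_def)
next
  assume "\<xi> \<in> hits_at B (y + s) x"
  then obtain n where n: "walk (y + s) \<xi> n \<in> B" "\<forall>m<n. walk (y + s) \<xi> m \<notin> B"
    "walk (y + s) \<xi> n = x" by (auto simp: hits_at_def)
  have "walk y (case_nat s \<xi>) m \<notin> B" if "m < Suc n" for m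
    using that n(2) assms by (cases m) (auto simp: walk_case_nat)
  then show "case_nat s \<xi> \<in> hits_at B y x"
    using n(1,3) unfolding hits_at_def by (intro CollectI exI[of _ "Suc n"]) (auto simp: walk_case_nat)
qed

text \<open>The steps after the first one are independent of it and have the law of the whole sequence.\<close>

lemma hit_prob_first_step:
  assumes "y \<notin> B"
  shows "4 * hit_prob B y x = (\<Sum>v\<in>nbrs y. hit_prob B v x)"
proof -
  interpret sequence_space "measure_pmf step_pmf" by unfold_locales
  interpret W: prob_space steps_measure by (rule prob_space_steps)
  have S: "S = steps_measure" by (simp add: steps_measure_def)
  let ?c = "\<lambda>(s, \<omega>). case_nat s \<omega>"
  have c: "?c \<in> measurable (measure_pmf step_pmf \<Otimes>\<^sub>M S) S" by measurable
  have "emeasure S (hits_at B y x) = emeasure (distr (measure_pmf step_pmf \<Otimes>\<^sub>M S) S ?c) (hits_at B y x)"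
    by (simp add: PiM_iter)
  also have "\<dots> = emeasure (measure_pmf step_pmf \<Otimes>\<^sub>M S) (?c -` hits_at B y x \<inter> space (measure_pmf step_pmf \<Otimes>\<^sub>M S))"
    by (rule emeasure_distr[OF c]) (simp add: S)
  also have "\<dots> = (\<integral>\<^sup>+ s. emeasure S (Pair s -` (?c -` hits_at B y x \<inter> space (measure_pmf step_pmf \<Otimes>\<^sub>M S))) \<partial>measure_pmf step_pmf)"
    by (rule P.emeasure_pair_measure_alt) (rule measurable_sets[OF c], simp add: S)
  also have "\<dots> = (\<integral>\<^sup>+ s. emeasure S (hits_at B (y + s) x) \<partial>measure_pmf step_pmf)"
    by (intro nn_integral_cong arg_cong[where f = "emeasure S"])
       (auto simp: space_pair_measure space_PiM hits_at_case_nat[OF assms])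
  also have "\<dots> = (\<integral>\<^sup>+ s. ennreal (hit_prob B (y + s) x) \<partial>measure_pmf step_pmf)"
    by (simp only: S W.emeasure_eq_measure hit_prob_eq)
  also have "\<dots> = ennreal (\<integral> s. hit_prob B (y + s) x \<partial>measure_pmf step_pmf)"
    by (intro nn_integral_eq_integral measure_pmf.integrable_const_bound[where B = 1])
       (auto simp: hit_prob_nonneg hit_prob_le_1)
  finally have "hit_prob B y x = (\<integral> s. hit_prob B (y + s) x \<partial>measure_pmf step_pmf)"
    by (simp add: S W.emeasure_eq_measure hit_prob_eq[symmetric] hit_prob_nonneg integral_nonneg)
  also have "\<dots> = (\<Sum>s\<in>{(1, 0), (- 1, 0), (0, 1), (0, - 1)}. hit_prob B (y + s) x) / 4"
    by (subst integral_pmf_of_set) auto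
  finally show ?thesis by (cases y) (simp add: sum_nbrs)
qed

lemma lap_hit_prob: "y \<notin> B \<Longrightarrow> lap (\<lambda>y. hit_prob B y x) y = 0"
  by (simp add: lap_def hit_prob_first_step)

lemma abs_hit_prob_le: "\<bar>hit_prob B y x\<bar> \<le> 1"
  using hit_prob_nonneg[of B y x] hit_prob_le_1[of B y x] by simp

text \<open>As a function of \<open>y\<close>, \<open>hit_prob B y x\<close> is bounded and harmonic off \<open>B\<close>; hence the limit that defines harmonic
measure exists.\<close>

theorem harmonic_measure_limit:
  assumes "finite B"
  shows "((\<lambda>y. hit_prob B y x) \<longlongrightarrow> harmonic_measure B x) at_inf"
proof -
  obtain L where "((\<lambda>y. hit_prob B y x) \<longlongrightarrow> L) at_inf"
    using harmonic_limit_at_infinity[where f = "\<lambda>y. hit_prob B y x" and M = 1 and B = B] assms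
    by (auto simp: lap_hit_prob abs_hit_prob_le)
  moreover from this have "harmonic_measure B x = L"
    unfolding harmonic_measure_def by (intro tendsto_Lim) auto
  ultimately show ?thesis by simp
qed

lemma harmonic_measure_nonneg: "finite B \<Longrightarrow> 0 \<le> harmonic_measure B x"
  by (rule tendsto_lowerbound[OF harmonic_measure_limit]) (auto simp: hit_prob_nonneg)

section \<open>Hitting kernels of nested sets\<close>

lemma adjacent_iff: "adjacent x y \<longleftrightarrow> y \<in> nbrs x"
proof -
  obtain a b c d where xy: "x = (a, b)" "y = (c, d)" by fastforce
  have "adjacent x y \<longleftrightarrow> (real_of_int (a - c))\<^sup>2 + (real_of_int (b - d))\<^sup>2 = 1"
    by (simp add: adjacent_def xy embed_def dist_Pair_Pair dist_real_def)
  also have "\<dots> \<longleftrightarrow> (a - c)\<^sup>2 + (b - d)\<^sup>2 = 1"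
    by (simp only: of_int_power[symmetric] of_int_add[symmetric] of_int_eq_1_iff)
  also have "\<dots> \<longleftrightarrow> y \<in> nbrs x"
  proof
    assume *: "(a - c)\<^sup>2 + (b - d)\<^sup>2 = 1"
    have sq: "i \<in> {-1, 0, 1}" if "i\<^sup>2 \<le> 1" for i :: int
    proof -
      have "\<bar>i\<bar> \<le> 1" using that by (simp add: abs_square_le_1)
      then show ?thesis by auto
    qed
    have "a - c \<in> {-1, 0, 1}" "b - d \<in> {-1, 0, 1}"
      using * zero_le_power2[of "a - c"] zero_le_power2[of "b - d"] by (intro sq; linarith)+
    with * show "y \<in> nbrs x" by (auto simp: xy nbrs_def)
  qed (auto simp: xy nbrs_def)
  finally show ?thesis .
qed

lemma boundary_eq: "boundary X = {x. x \<notin> X \<and> nbrs x \<inter> X \<noteq> {}}"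
  by (auto simp: boundary_def adjacent_iff)

text \<open>Where a walker can be while it has not met the boundary of \<open>X\<close>, unless it starts in \<open>X\<close>.\<close>

definition exterior :: "site set \<Rightarrow> site set" where
  "exterior X = - (X \<union> boundary X)"

lemma exterior_iff: "x \<in> exterior X \<longleftrightarrow> x \<notin> X \<and> nbrs x \<inter> X = {}"
  by (auto simp: exterior_def boundary_eq)

lemma finite_boundary [simp]: "finite X \<Longrightarrow> finite (boundary X)"
  by (rule finite_subset[of _ "\<Union>x\<in>X. nbrs x"]) (auto simp: boundary_eq nbrs_sym)

lemma nbrs_exterior: "x \<in> exterior X \<Longrightarrow> y \<in> nbrs x \<Longrightarrow> y \<notin> exterior X \<Longrightarrow> y \<in> boundary X"
  by (auto simp: exterior_iff boundary_eq)

lemma exterior_neq_UNIV: "X \<noteq> {} \<Longrightarrow> exterior X \<noteq> UNIV"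
  by (auto simp: exterior_iff)

lemma ex_rightmost:
  fixes X :: "site set"
  assumes "finite X" "X \<noteq> {}"
  obtains x where "x \<in> X" "x + (1, 0) \<notin> X"
proof -
  have "Max (fst ` X) \<in> fst ` X" using assms by (intro Max_in) auto
  then obtain x where x: "x \<in> X" "fst x = Max (fst ` X)" by auto
  have "x + (1, 0) \<notin> X"
  proof
    assume "x + (1, 0) \<in> X"
    then have "fst (x + (1, 0)) \<le> Max (fst ` X)" using assms(1) by (intro Max_ge finite_imageI imageI)
    then show False using x(2) by (simp del: Max_ge)
  qed
  then show thesis using x(1) that by blast
qed

lemma boundary_nonempty:
  assumes "finite X" "X \<noteq> {}" shows "boundary X \<noteq> {}"
proof -
  obtain x where x: "x \<in> X" "x + (1, 0) \<notin> X" using ex_rightmost[OF assms] .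
  moreover have "x \<in> nbrs (x + (1, 0))" by (simp add: nbrs_def)
  ultimately have "x + (1, 0) \<in> boundary X" by (auto simp: boundary_eq)
  then show ?thesis by blast
qed

lemma boundary_subset: "X \<subseteq> Y \<Longrightarrow> boundary X \<subseteq> Y \<union> boundary Y"
  by (auto simp: boundary_eq)

lemma exterior_antimono: "X \<subseteq> Y \<Longrightarrow> exterior Y \<subseteq> exterior X"
  unfolding exterior_iff subset_iff by blast

lemma eventually_exterior: "finite X \<Longrightarrow> eventually (\<lambda>y. y \<in> exterior X) at_inf"
  using eventually_at_inf_notin[of "X \<union> boundary X"] by (simp add: exterior_def)

lemma harmonic_unique:
  assumes bd: "\<And>x. \<bar>f x\<bar> \<le> M" and sub: "\<And>x. x \<in> D \<Longrightarrow> lap f x = 0" and "D \<noteq> UNIV"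
    and bdry: "\<And>x y. x \<in> D \<Longrightarrow> y \<in> nbrs x \<Longrightarrow> y \<notin> D \<Longrightarrow> f y = 0"
    and "x \<in> D"
  shows "f x = 0"
proof -
  have "f x \<le> 0"
    by (rule maximum_principle[where f = f and D = D and M = M and x = x])
      (use assms in \<open>auto intro: order_trans[OF abs_ge_self]\<close>)
  moreover have "- f x \<le> 0"
  proof (rule maximum_principle[where f = "\<lambda>x. - f x" and D = D and M = M and x = x])
    show "- f x \<le> M" for x using bd[of x] by linarith
    show "0 \<le> lap (\<lambda>x. - f x) y" if "y \<in> D" for y using sub[OF that] by (simp add: lap_def sum_negf)
  qed (use assms in auto)
  ultimately show ?thesis by simp
qed

lemma lap_sum: "lap (\<lambda>y. \<Sum>u\<in>U. f u y) x = (\<Sum>u\<in>U. lap (f u) x)"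
  by (simp add: lap_def sum_subtractf sum_distrib_left sum.swap[of _ "nbrs x"])

lemma lap_mult_right: "lap (\<lambda>y. f y * c) x = lap f x * c"
  by (simp add: lap_def sum_distrib_right left_diff_distrib)

lemma lap_diff: "lap (\<lambda>y. f y - g y) x = lap f x - lap g x"
  by (simp add: lap_def sum_subtractf)

lemma lap_const [simp]: "lap (\<lambda>y. c) x = 0"
  by (simp add: lap_def)

text \<open>Recurrence of the walk: the defect is a bounded function that is harmonic off \<open>B\<close> and 0 on \<open>B\<close>.\<close>

lemma hit_prob_sum_1:
  assumes "finite B" "B \<noteq> {}"
  shows "(\<Sum>b\<in>B. hit_prob B y b) = 1"
proof (cases "y \<in> B")
  case True
  then show ?thesis using \<open>finite B\<close> by (simp add: hit_prob_on)
next
  case False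
  have "1 - (\<Sum>b\<in>B. hit_prob B y b) = 0"
  proof (rule harmonic_unique[where D = "- B" and f = "\<lambda>y. 1 - (\<Sum>b\<in>B. hit_prob B y b)" and x = y and M = "1 + card B"])
    show "\<bar>1 - (\<Sum>b\<in>B. hit_prob B x b)\<bar> \<le> 1 + card B" for x
    proof -
      have "(\<Sum>b\<in>B. hit_prob B x b) \<le> (\<Sum>b\<in>B. 1)" by (intro sum_mono hit_prob_le_1)
      moreover have "0 \<le> (\<Sum>b\<in>B. hit_prob B x b)" by (intro sum_nonneg hit_prob_nonneg)
      ultimately show ?thesis by simp
    qed
    show "lap (\<lambda>y. 1 - (\<Sum>b\<in>B. hit_prob B y b)) x = 0" if "x \<in> - B" for x
      using that by (simp add: lap_diff lap_sum lap_hit_prob)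
    show "1 - (\<Sum>b\<in>B. hit_prob B x b) = 0" if "x \<notin> - B" for x
      using that \<open>finite B\<close> by (simp add: hit_prob_on)
  qed (use assms False in auto)
  then show ?thesis by simp
qed

lemma harmonic_measure_sum_1:
  assumes "finite B" "B \<noteq> {}"
  shows "(\<Sum>b\<in>B. harmonic_measure B b) = 1"
proof -
  have "((\<lambda>y. \<Sum>b\<in>B. hit_prob B y b) \<longlongrightarrow> (\<Sum>b\<in>B. harmonic_measure B b)) at_inf"
    by (intro tendsto_sum harmonic_measure_limit assms)
  moreover have "((\<lambda>y. \<Sum>b\<in>B. hit_prob B y b) \<longlongrightarrow> 1) at_inf"
    using assms by (simp add: hit_prob_sum_1)
  ultimately show ?thesis by (rule tendsto_unique[OF at_inf_neq_bot])
qed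

lemma harmonic_measure_le_1: "finite B \<Longrightarrow> harmonic_measure B x \<le> 1"
  by (rule tendsto_upperbound[OF harmonic_measure_limit]) (auto simp: hit_prob_le_1)

text \<open>The strong Markov property at the first visit to \<open>boundary Y\<close>. As functions of \<open>y\<close>, both sides are bounded,
harmonic outside \<open>Y\<close>, and equal on the boundary of \<open>Y\<close>.\<close>

theorem hit_prob_via:
  assumes XY: "X \<subseteq> Y" and "finite Y" "X \<noteq> {}" and y: "y \<in> exterior Y"
  shows "hit_prob (boundary X) y v =
    (\<Sum>u\<in>boundary Y. hit_prob (boundary Y) y u * hit_prob (boundary X) u v)"
proof -
  let ?g = "\<lambda>y. \<Sum>u\<in>boundary Y. hit_prob (boundary Y) y u * hit_prob (boundary X) u v"
  have fin: "finite (boundary Y)" using \<open>finite Y\<close> by simp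
  have g: "0 \<le> ?g x" "?g x \<le> card (boundary Y)" for x
  proof -
    show "0 \<le> ?g x" by (intro sum_nonneg mult_nonneg_nonneg hit_prob_nonneg)
    have "?g x \<le> (\<Sum>u\<in>boundary Y. 1 * 1)" by (intro sum_mono mult_mono hit_prob_nonneg hit_prob_le_1) auto
    then show "?g x \<le> card (boundary Y)" by simp
  qed
  have "hit_prob (boundary X) y v - ?g y = 0"
  proof (rule harmonic_unique[where D = "exterior Y" and x = y and M = "1 + card (boundary Y)"
        and f = "\<lambda>y. hit_prob (boundary X) y v - ?g y"])
    show "\<bar>hit_prob (boundary X) x v - ?g x\<bar> \<le> 1 + card (boundary Y)" for x
      using g[of x] hit_prob_nonneg[of "boundary X" x v] hit_prob_le_1[of "boundary X" x v] by linarith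
    show "lap (\<lambda>y. hit_prob (boundary X) y v - ?g y) x = 0" if x: "x \<in> exterior Y" for x
    proof -
      have "x \<notin> boundary X" using boundary_subset[OF XY] x by (auto simp: exterior_def)
      moreover have "x \<notin> boundary Y" using x by (auto simp: exterior_def)
      ultimately show ?thesis by (simp add: lap_diff lap_sum lap_mult_right lap_hit_prob)
    qed
    show "hit_prob (boundary X) z v - ?g z = 0" if "x \<in> exterior Y" "z \<in> nbrs x" "z \<notin> exterior Y" for x z
    proof -
      have z: "z \<in> boundary Y" using nbrs_exterior that by blast
      have "?g z = (\<Sum>u\<in>boundary Y. if u = z then hit_prob (boundary X) z v else 0)"
        by (intro sum.cong refl) (simp add: hit_prob_on z)
      then show ?thesis using z fin by simp
    qed
    show "exterior Y \<noteq> UNIV" using assms by (intro exterior_neq_UNIV) auto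
  qed (rule y)
  then show ?thesis by simp
qed

theorem harmonic_measure_via:
  assumes XY: "X \<subseteq> Y" and "finite Y" "X \<noteq> {}"
  shows "harmonic_measure (boundary X) v =
    (\<Sum>u\<in>boundary Y. harmonic_measure (boundary Y) u * hit_prob (boundary X) u v)"
proof (rule tendsto_unique[OF at_inf_neq_bot])
  have fin: "finite (boundary X)" "finite (boundary Y)" using assms finite_subset[OF XY] by simp_all
  show "((\<lambda>y. hit_prob (boundary X) y v) \<longlongrightarrow> harmonic_measure (boundary X) v) at_inf"
    by (rule harmonic_measure_limit) (rule fin)
  have "((\<lambda>y. \<Sum>u\<in>boundary Y. hit_prob (boundary Y) y u * hit_prob (boundary X) u v) \<longlongrightarrow>
      (\<Sum>u\<in>boundary Y. harmonic_measure (boundary Y) u * hit_prob (boundary X) u v)) at_inf"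
    by (intro tendsto_intros harmonic_measure_limit fin)
  then show "((\<lambda>y. hit_prob (boundary X) y v) \<longlongrightarrow>
      (\<Sum>u\<in>boundary Y. harmonic_measure (boundary Y) u * hit_prob (boundary X) u v)) at_inf"
    by (rule Lim_transform_eventually)
      (use eventually_exterior[OF \<open>finite Y\<close>] in eventually_elim, simp add: hit_prob_via[OF assms])
qed

lemma harmonic_measure_ge_via:
  assumes "X \<subseteq> Y" and "finite Y" "X \<noteq> {}" and "u \<in> boundary Y"
  shows "harmonic_measure (boundary Y) u * hit_prob (boundary X) u v \<le> harmonic_measure (boundary X) v"
  unfolding harmonic_measure_via[OF assms(1-3)] using assms
  by (intro member_le_sum mult_nonneg_nonneg harmonic_measure_nonneg hit_prob_nonneg) auto

lemma hit_prob_ge_via: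
  assumes "X \<subseteq> Y" and "finite Y" "X \<noteq> {}" and "u \<in> boundary Y" "y \<in> exterior Y"
  shows "hit_prob (boundary Y) y u * hit_prob (boundary X) u v \<le> hit_prob (boundary X) y v"
  unfolding hit_prob_via[OF assms(1-3,5)] using assms
  by (intro member_le_sum mult_nonneg_nonneg hit_prob_nonneg) auto

text \<open>A walk of \<open>n\<close> steps from \<open>u\<close> to \<open>w\<close> all of whose sites are in \<open>S\<close>.\<close>

primrec linked :: "site set \<Rightarrow> nat \<Rightarrow> site \<Rightarrow> site \<Rightarrow> bool" where
  "linked S 0 u w \<longleftrightarrow> u = w \<and> u \<in> S"
| "linked S (Suc n) u w \<longleftrightarrow> u \<in> S \<and> (\<exists>v\<in>nbrs u. linked S n v w)"

lemma linked_in: "linked S n u w \<Longrightarrow> u \<in> S \<and> w \<in> S"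
  by (induction n arbitrary: u) auto

lemma linked_trans: "linked S m u v \<Longrightarrow> linked S n v w \<Longrightarrow> linked S (m + n) u w"
  by (induction m arbitrary: u) (auto dest: linked_in)

text \<open>A nonnegative function is at least a quarter of its value at any neighbour wherever it is harmonic;
this is iterated along the walk, in both directions.\<close>

lemma linked_harnack:
  assumes nn: "\<And>x. 0 \<le> f x" and harm: "\<And>x. x \<in> S \<Longrightarrow> lap f x = 0" and "linked S n u w"
  shows "f u \<le> 4 ^ n * f w" "f w \<le> 4 ^ n * f u"
proof -
  have one: "f v \<le> 4 * f u" if "u \<in> S" "v \<in> nbrs u" for u v
  proof -
    have "f v \<le> (\<Sum>v\<in>nbrs u. f v)" using that nn by (intro member_le_sum) auto
    then show ?thesis using harm[OF that(1)] by (simp add: lap_def)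
  qed
  have "f u \<le> 4 ^ n * f w \<and> f w \<le> 4 ^ n * f u"
    using \<open>linked S n u w\<close>
  proof (induction n arbitrary: u)
    case (Suc n)
    then obtain v where v: "v \<in> nbrs u" "linked S n v w" "u \<in> S" by auto
    have "f v \<le> 4 * f u" using one v by blast
    moreover have "f u \<le> 4 * f v" using one v linked_in nbrs_sym by blast
    moreover have "f v \<le> 4 ^ n * f w" "f w \<le> 4 ^ n * f v" using Suc.IH[OF v(2)] by auto
    moreover have "4 ^ n * f v \<le> 4 ^ n * (4 * f u)" using \<open>f v \<le> 4 * f u\<close> by (intro mult_left_mono) auto
    moreover have "4 ^ n * (4 * f u) = 4 ^ Suc n * f u" "4 * (4 ^ n * f w) = 4 ^ Suc n * f w" by simp_all
    ultimately show ?case by linarith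
  qed auto
  then show "f u \<le> 4 ^ n * f w" "f w \<le> 4 ^ n * f u" by auto
qed

definition l1 :: "site \<Rightarrow> site \<Rightarrow> int" where
  "l1 u v = \<bar>fst u - fst v\<bar> + \<bar>snd u - snd v\<bar>"

lemma l1_commute: "l1 u v = l1 v u" by (simp add: l1_def abs_minus_commute)
lemma l1_triangle: "l1 u w \<le> l1 u v + l1 v w" by (simp add: l1_def)
lemma l1_nonneg [simp]: "0 \<le> l1 u v" by (simp add: l1_def)
lemma l1_eq_0 [simp]: "l1 u v = 0 \<longleftrightarrow> u = v" by (auto simp: l1_def prod_eq_iff)
lemma l1_self [simp]: "l1 u u = 0" by simp
lemma nbrs_iff_l1: "v \<in> nbrs u \<longleftrightarrow> l1 u v = 1"
  by (cases u; cases v) (auto simp: nbrs_def l1_def)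

lemma nbrs_towards:
  assumes "u \<noteq> z" shows "\<exists>v\<in>nbrs u. l1 v z = l1 u z - 1"
proof -
  obtain a b c d where uz: "u = (a, b)" "z = (c, d)" by fastforce
  consider "a < c" | "c < a" | "a = c" "b < d" | "a = c" "d < b" using assms uz by fastforce
  then show ?thesis
    by cases (auto simp: uz nbrs_def l1_def)
qed

lemma linked_l1: "linked S n u w \<Longrightarrow> l1 u w \<le> n"
proof (induction n arbitrary: u)
  case (Suc n)
  then obtain v where "v \<in> nbrs u" "linked S n v w" by auto
  then have "l1 u v = 1" "l1 v w \<le> n" using Suc.IH by (auto simp: nbrs_iff_l1)
  then show ?case using l1_triangle[of u w v] by simp
qed simp

definition l1_ball :: "site \<Rightarrow> nat \<Rightarrow> site set" where
  "l1_ball c n = {u. l1 u c \<le> int n}"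

lemma l1_ball_subset: "l1_ball c n \<subseteq> {fst c - int n..fst c + int n} \<times> {snd c - int n..snd c + int n}"
  by (auto simp: l1_ball_def l1_def)

lemma finite_l1_ball [simp]: "finite (l1_ball c n)"
  by (rule finite_subset[OF l1_ball_subset]) simp

lemma card_l1_ball: "card (l1_ball c n) \<le> (2 * n + 1)\<^sup>2"
proof -
  have "card (l1_ball c n) \<le> card ({fst c - int n..fst c + int n} \<times> {snd c - int n..snd c + int n})"
    by (intro card_mono l1_ball_subset) simp
  also have "\<dots> = (2 * n + 1)\<^sup>2" by (simp add: card_cartesian_product power2_eq_square nat_add_distrib nat_mult_distrib)
  finally show ?thesis .
qed

lemma l1_ball_sym: "u \<in> l1_ball v n \<longleftrightarrow> v \<in> l1_ball u n"
  by (simp add: l1_ball_def l1_commute)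

text \<open>Go from \<open>u\<close> straight to \<open>z\<close>, and stop when the next site would leave the exterior.\<close>

lemma approach:
  assumes "u \<in> exterior X" "z \<notin> exterior X" "u \<in> l1_ball z n"
  shows "\<exists>m\<le>n. \<exists>w b. linked (exterior X) m u w \<and> b \<in> nbrs w \<and> b \<in> boundary X \<and> b \<in> l1_ball z n"
  using assms
proof (induction n arbitrary: u)
  case 0
  then have "u = z" using l1_nonneg[of u z] l1_eq_0[of u z] by (simp add: l1_ball_def)
  then show ?case using 0 by simp
next
  case (Suc n)
  have "u \<noteq> z" using Suc.prems by auto
  then obtain v where v: "v \<in> nbrs u" "l1 v z = l1 u z - 1" using nbrs_towards by blast
  then have vn: "v \<in> l1_ball z n" using Suc.prems by (simp add: l1_ball_def)
  show ?case
  proof (cases "v \<in> exterior X")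
    case True
    from Suc.IH[OF True Suc.prems(2) vn] obtain m w b where
      "m \<le> n" "linked (exterior X) m v w" "b \<in> nbrs w" "b \<in> boundary X" "b \<in> l1_ball z n" by blast
    moreover from this have "linked (exterior X) (Suc m) u w" using v(1) Suc.prems(1) by auto
    moreover have "l1_ball z n \<subseteq> l1_ball z (Suc n)" by (auto simp: l1_ball_def)
    ultimately show ?thesis using Suc_le_mono by blast
  next
    case False
    then have "v \<in> boundary X" using nbrs_exterior Suc.prems v by blast
    moreover have "linked (exterior X) 0 u u" using Suc.prems(1) by simp
    moreover have "v \<in> l1_ball z (Suc n)" using vn by (simp add: l1_ball_def)
    ultimately show ?thesis using v(1) by blast
  qed
qed

lemma linked_hit_prob:
  assumes "linked (exterior X) m u w" "b \<in> nbrs w" "b \<in> boundary X" "Suc m \<le> n"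
  shows "1 / 4 ^ n \<le> hit_prob (boundary X) u b"
proof -
  have harm: "lap (\<lambda>y. hit_prob (boundary X) y b) x = 0" if "x \<in> exterior X" for x
    using that by (intro lap_hit_prob) (auto simp: exterior_def)
  have w: "w \<in> exterior X" using linked_in assms by blast
  have "1 = hit_prob (boundary X) b b" using assms by (simp add: hit_prob_on)
  also have "\<dots> \<le> (\<Sum>v\<in>nbrs w. hit_prob (boundary X) v b)"
    using assms hit_prob_nonneg by (intro member_le_sum) auto
  also have "\<dots> = 4 * hit_prob (boundary X) w b" using harm[OF w] by (simp add: lap_def)
  also have "\<dots> \<le> 4 * (4 ^ m * hit_prob (boundary X) u b)"
    using linked_harnack(2)[OF _ harm assms(1)] hit_prob_nonneg by simp
  also have "\<dots> = 4 ^ Suc m * hit_prob (boundary X) u b" by simp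
  also have "\<dots> \<le> 4 ^ n * hit_prob (boundary X) u b"
    using assms(4) by (intro mult_right_mono power_increasing hit_prob_nonneg) auto
  finally show ?thesis by (simp add: field_simps)
qed

text \<open>The flux of \<open>hit_prob B _ v\<close> out of \<open>v\<close> returns to \<open>B\<close>. This bounds a column of the hitting kernel, whereas
\<open>hit_prob_sum_1\<close> is about a row.\<close>

lemma hit_prob_flux:
  assumes "finite B" "v \<in> B"
  shows "(\<Sum>b\<in>B. \<Sum>w\<in>nbrs b. hit_prob B w v) = 4"
proof -
  have "(\<Sum>b\<in>B. lap (\<lambda>y. hit_prob B y v) b) = 0"
    by (rule flux_zero[where M = 1]) (auto simp: abs_hit_prob_le assms lap_hit_prob)
  moreover have "(\<Sum>b\<in>B. hit_prob B b v) = 1"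
    using assms by (simp add: hit_prob_on)
  ultimately show ?thesis by (simp add: lap_def sum_subtractf sum_distrib_left[symmetric])
qed

text \<open>The form in which bounded multiplicities are used throughout.\<close>

lemma sum_fibers_le:
  fixes f :: "'b \<Rightarrow> real"
  assumes "finite S" "finite T" "\<And>s. s \<in> S \<Longrightarrow> g s \<in> T" "\<And>t. t \<in> T \<Longrightarrow> 0 \<le> f t"
    and "\<And>t. t \<in> T \<Longrightarrow> real (card {s \<in> S. g s = t}) \<le> m"
  shows "(\<Sum>s\<in>S. f (g s)) \<le> m * (\<Sum>t\<in>T. f t)"
proof -
  have "(\<Sum>s\<in>S. f (g s)) = (\<Sum>t\<in>T. \<Sum>s\<in>{s \<in> S. g s = t}. f (g s))"
    using assms by (intro sum.group[symmetric]) auto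
  also have "\<dots> = (\<Sum>t\<in>T. real (card {s \<in> S. g s = t}) * f t)"
    by (intro sum.cong refl) (simp add: sum_constant[symmetric] del: sum_constant)
  also have "\<dots> \<le> (\<Sum>t\<in>T. m * f t)" using assms by (intro sum_mono mult_right_mono) auto
  finally show ?thesis by (simp add: sum_distrib_left)
qed

definition collar :: "site set \<Rightarrow> nat \<Rightarrow> site set" where
  "collar X n = {u \<in> exterior X. \<exists>z\<in>X \<union> boundary X. u \<in> l1_ball z n}"

lemma finite_collar: "finite X \<Longrightarrow> finite (collar X n)"
  by (rule finite_subset[of _ "\<Union>z\<in>X \<union> boundary X. l1_ball z n"]) (auto simp: collar_def)

definition collar_const :: "nat \<Rightarrow> real" where
  "collar_const n = 4 ^ n * (2 * real n + 1)\<^sup>2 * 4"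

text \<open>Every site of the collar is linked to a neighbour of the boundary by at most \<open>n\<close> steps, and few sites
use the same neighbour. The constant depends on \<open>n\<close> alone.\<close>

theorem hit_prob_collar_sum:
  assumes X: "finite X" and v: "v \<in> boundary X"
  shows "(\<Sum>u\<in>collar X n. hit_prob (boundary X) u v) \<le> collar_const n"
proof -
  let ?h = "\<lambda>u. hit_prob (boundary X) u v"
  let ?P = "SIGMA b:boundary X. nbrs b"
  have harm: "lap ?h x = 0" if "x \<in> exterior X" for x
    using that by (intro lap_hit_prob) (auto simp: exterior_def)
  have "\<exists>p\<in>?P. snd p \<in> l1_ball u n \<and> ?h u \<le> 4 ^ n * ?h (snd p)" if u: "u \<in> collar X n" for u
  proof -
    from u obtain z where z: "u \<in> exterior X" "z \<notin> exterior X" "u \<in> l1_ball z n"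
      by (auto simp: collar_def exterior_def)
    obtain m w b where w: "m \<le> n" "linked (exterior X) m u w" "b \<in> nbrs w" "b \<in> boundary X"
      using approach[OF z] by blast
    have "?h u \<le> 4 ^ m * ?h w" by (rule linked_harnack(1)[OF _ harm w(2)]) (rule hit_prob_nonneg)
    also have "\<dots> \<le> 4 ^ n * ?h w" using w(1) by (intro mult_right_mono power_increasing hit_prob_nonneg) auto
    finally have "?h u \<le> 4 ^ n * ?h w" .
    moreover have "w \<in> l1_ball u n" using linked_l1[OF w(2)] w(1) by (simp add: l1_ball_def l1_commute)
    ultimately show ?thesis using w nbrs_sym by (intro bexI[of _ "(b, w)"]) auto
  qed
  then obtain \<phi> where \<phi>: "\<And>u. u \<in> collar X n \<Longrightarrow> \<phi> u \<in> ?P \<and> snd (\<phi> u) \<in> l1_ball u n \<and> ?h u \<le> 4 ^ n * ?h (snd (\<phi> u))"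
    by metis
  have "(\<Sum>u\<in>collar X n. ?h u) \<le> (\<Sum>u\<in>collar X n. 4 ^ n * ?h (snd (\<phi> u)))"
    using \<phi> by (intro sum_mono) auto
  also have "\<dots> \<le> (2 * real n + 1)\<^sup>2 * (\<Sum>p\<in>?P. 4 ^ n * ?h (snd p))"
  proof (rule sum_fibers_le)
    show "finite ?P" using X by (intro finite_SigmaI) auto
    show "\<phi> u \<in> ?P" if "u \<in> collar X n" for u using \<phi>[OF that] by blast
    fix p
    have "{u\<in>collar X n. \<phi> u = p} \<subseteq> l1_ball (snd p) n"
      using \<phi> l1_ball_sym[of _ "snd p" n] by blast
    then have "card {u\<in>collar X n. \<phi> u = p} \<le> card (l1_ball (snd p) n)"
      by (rule card_mono[OF finite_l1_ball])
    then have "real (card {u\<in>collar X n. \<phi> u = p}) \<le> real ((2 * n + 1)\<^sup>2)"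
      using card_l1_ball[of "snd p" n] unfolding of_nat_le_iff by linarith
    then show "real (card {u\<in>collar X n. \<phi> u = p}) \<le> (2 * real n + 1)\<^sup>2" by (simp add: add.commute)
  qed (use finite_collar[OF X] in \<open>auto simp: hit_prob_nonneg\<close>)
  also have "\<dots> = (2 * real n + 1)\<^sup>2 * 4 ^ n * (\<Sum>p\<in>?P. ?h (snd p))"
    by (simp add: sum_distrib_left mult.assoc)
  also have "(\<Sum>p\<in>?P. ?h (snd p)) = (\<Sum>b\<in>boundary X. \<Sum>w\<in>nbrs b. ?h w)"
    using X by (subst sum.Sigma) (auto intro!: sum.cong)
  also have "\<dots> = 4" using X v by (intro hit_prob_flux) auto
  finally show ?thesis by (simp add: collar_const_def mult_ac)
qed

section \<open>Places where a hole can be built\<close>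

lemma linked_snoc: "linked S n u v \<Longrightarrow> w \<in> nbrs v \<Longrightarrow> w \<in> S \<Longrightarrow> linked S (Suc n) u w"
proof (induction n arbitrary: u)
  case (Suc n)
  then obtain v' where "u \<in> S" "v' \<in> nbrs u" "linked S n v' v" by auto
  moreover from this have "linked S (Suc n) v' w" using Suc by blast
  ultimately show ?case unfolding linked.simps(2)[of S "Suc n"] by blast
qed auto

lemma linked_sym: "linked S n u w \<Longrightarrow> linked S n w u"
proof (induction n arbitrary: u)
  case (Suc n)
  then obtain v where "u \<in> S" "v \<in> nbrs u" "linked S n v w" by auto
  then show ?case using Suc.IH linked_snoc[of S n w v u] nbrs_sym by blast
qed auto

lemma linked_segment:
  assumes step: "\<And>t. p (t + 1) \<in> nbrs (p t)" and "s \<le> e" and "\<And>t. s \<le> t \<Longrightarrow> t \<le> e \<Longrightarrow> p t \<in> S"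
  shows "linked S (nat (e - s)) (p s) (p e)"
  using assms(2,3)
proof (induction e rule: int_ge_induct)
  case (step e)
  have "linked S (nat (e - s)) (p s) (p e)" using step by auto
  then have "linked S (Suc (nat (e - s))) (p s) (p (e + 1))"
    by (rule linked_snoc) (use step assms(1) in auto)
  then show ?case using step by (simp add: Suc_nat_eq_nat_zadd1 algebra_simps)
qed simp

lemma linked_segment':
  fixes p :: "int \<Rightarrow> site"
  assumes step: "\<And>t. p (t + 1) \<in> nbrs (p t)" and "\<And>t. min s e \<le> t \<Longrightarrow> t \<le> max s e \<Longrightarrow> p t \<in> S"
  shows "linked S (nat \<bar>e - s\<bar>) (p s) (p e)"
proof (cases "s \<le> e")
  case True
  then show ?thesis using linked_segment[of p s e S] assms by simp
next
  case False
  then have "linked S (nat (s - e)) (p e) (p s)" using linked_segment[of p e s S] assms by simp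
  then show ?thesis using False linked_sym by simp
qed

definition dirs :: "site set" where
  "dirs = {(1, 0), (- 1, 0), (0, 1), (0, - 1)}"

text \<open>The lattice isometry that takes the origin to \<open>a\<close> and the upward unit vector to \<open>d\<close>.\<close>

definition frame :: "site \<Rightarrow> site \<Rightarrow> site \<Rightarrow> site" where
  "frame a d u = (fst a + fst u * snd d + snd u * fst d, snd a - fst u * fst d + snd u * snd d)"

lemma l1_frame [simp]: "d \<in> dirs \<Longrightarrow> l1 (frame a d u) (frame a d v) = l1 u v"
  by (auto simp: dirs_def frame_def l1_def abs_minus_commute)

lemma frame_eq_iff [simp]: "d \<in> dirs \<Longrightarrow> frame a d u = frame a d v \<longleftrightarrow> u = v"
  using l1_frame[of d a u v] l1_eq_0 by metis

lemma frame_0: "frame a d (0, 0) = a"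
  by (simp add: frame_def)

lemma frame_nbrs_iff [simp]: "d \<in> dirs \<Longrightarrow> frame a d u \<in> nbrs (frame a d v) \<longleftrightarrow> u \<in> nbrs v"
  by (simp add: nbrs_iff_l1)

lemma nbrs_frame: "d \<in> dirs \<Longrightarrow> nbrs (frame a d v) = frame a d ` nbrs v"
  by (cases v) (auto simp: dirs_def nbrs_def frame_def algebra_simps)

text \<open>Local coordinates of the centre of a free ball of radius 15 that the origin touches from below. At
\<open>l1\<close> distance 16 one of the coordinates is at least 8 in absolute value, so that one of the four
frames applies. The bound 8 makes the ball contain the cone of all \<open>(x, y)\<close> with \<open>\<bar>x\<bar> < y \<le> 8\<close>.\<close>

definition offsets :: "site set" where
  "offsets = {(i, j). 8 \<le> j \<and> \<bar>i\<bar> + j = 16}"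

definition fat :: "site set \<Rightarrow> site set" where
  "fat X = {v. \<exists>a\<in>X. v \<in> l1_ball a 15}"

text \<open>The particles of the plan, in local coordinates and in the order of their attachment: a stem of three,
an arm that bends around \<open>(1, 4)\<close> from the right, the rest of the stem, and the lid. The order keeps
the site above each new cell accessible from above. The last cell encloses \<open>(1, 4)\<close>.\<close>

definition cells :: "site list" where
  "cells = [(0, 1), (0, 2), (0, 3), (1, 3), (2, 3), (2, 4), (0, 4), (0, 5), (1, 5)]"

text \<open>The site from which a walker steps onto the corresponding cell.\<close>

definition landings :: "site list" where
  "landings = [(0, 2), (0, 3), (0, 4), (1, 4), (2, 4), (2, 5), (0, 5), (0, 6), (1, 6)]"

type_synonym place = "site \<times> site \<times> site"

text \<open>The centre of the free ball.\<close>

definition ref :: "place \<Rightarrow> site" where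
  "ref = (\<lambda>(a, d, w). frame a d w)"

definition target :: "nat \<Rightarrow> place \<Rightarrow> site" where
  "target k = (\<lambda>(a, d, w). frame a d (cells ! k))"

definition laid :: "nat \<Rightarrow> place \<Rightarrow> site set" where
  "laid k = (\<lambda>(a, d, w). frame a d ` set (take k cells))"

text \<open>The last condition says that the centre is at distance exactly 16 from the cluster without the laid
cells. So the ball of radius 15 around it contains no particle except for laid ones.\<close>

definition places :: "nat \<Rightarrow> site set \<Rightarrow> place set" where
  "places k A = {(a, d, w). a \<in> A \<and> d \<in> dirs \<and> w \<in> offsets \<and> laid k (a, d, w) \<subseteq> A \<and>
     ref (a, d, w) \<in> boundary (fat (A - laid k (a, d, w)))}"

text \<open>The weight of a place. Removing the laid cells has two effects: the weight stays the same when the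
next cell is laid, and it counts only walkers that come to the centre while keeping away from the
rest of the cluster, so that no cell of the plan can block them.\<close>

definition place_hm :: "nat \<Rightarrow> site set \<Rightarrow> place \<Rightarrow> real" where
  "place_hm k A P = harmonic_measure (boundary (fat (A - laid k P))) (ref P)"

text \<open>The Harnack constant of a walk of 40 steps, longer than any of the walks below from the centre of a
place to the next cell, or from the edge of a neighbourhood to the cluster.\<close>

definition harnack :: real where "harnack = 4 ^ 40"

lemma harnack_pos [simp]: "0 < harnack"
  by (simp add: harnack_def)

lemma length_cells [simp]: "length cells = 9" by (simp add: cells_def)

lemma finite_fat: "finite X \<Longrightarrow> finite (fat X)"
  by (rule finite_subset[of _ "\<Union>a\<in>X. l1_ball a 15"]) (auto simp: fat_def)

lemma subset_fat: "X \<subseteq> fat X"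
proof
  fix x assume "x \<in> X"
  moreover have "x \<in> l1_ball x 15" by (simp add: l1_ball_def)
  ultimately show "x \<in> fat X" unfolding fat_def by blast
qed

lemma cells_bounds: "c \<in> set cells \<Longrightarrow> 0 \<le> fst c \<and> fst c \<le> 2 \<and> fst c < snd c \<and> snd c \<le> 5"
  by (auto simp: cells_def)

lemma cell_not_laid: "k < 9 \<Longrightarrow> cells ! k \<notin> set (take k cells)"
  unfolding cells_def by (simp add: less_Suc_eq numeral_eq_Suc) (elim disjE; simp)

lemma cell_attached: "k < 9 \<Longrightarrow> nbrs (cells ! k) \<inter> insert (0, 0) (set (take k cells)) \<noteq> {}"
  unfolding cells_def by (simp add: less_Suc_eq numeral_eq_Suc) (elim disjE; simp add: nbrs_def zero_prod_def)

lemma landing: "k < 9 \<Longrightarrow> cells ! k \<in> nbrs (landings ! k)"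
  "k < 9 \<Longrightarrow> 0 \<le> fst (landings ! k) \<and> fst (landings ! k) \<le> 2 \<and> fst (landings ! k) + 2 \<le> snd (landings ! k) \<and> snd (landings ! k) \<le> 6"
  unfolding cells_def landings_def
  by (simp_all add: less_Suc_eq numeral_eq_Suc) (elim disjE; simp add: nbrs_def)+

lemma column_clear:
  assumes "k < 9" "snd (landings ! k) \<le> y" "u \<in> insert (fst (landings ! k), y) (nbrs (fst (landings ! k), y))"
  shows "u \<notin> set (take k cells)"
  using assms unfolding cells_def landings_def
  by (simp add: less_Suc_eq numeral_eq_Suc) (elim disjE; auto simp add: nbrs_def)

lemma finite_offsets: "finite offsets" and card_offsets: "card offsets \<le> 17"
proof -
  have eq: "offsets = (\<lambda>i. (i, 16 - \<bar>i\<bar>)) ` {- 8..8}" by (auto simp: offsets_def image_iff)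
  show "finite offsets" unfolding eq by simp
  show "card offsets \<le> 17"
    unfolding eq using card_image_le[of "{- 8..8 :: int}" "\<lambda>i. (i, 16 - \<bar>i\<bar>)"] by simp
qed

lemma finite_dirs: "finite dirs" and card_dirs: "card dirs = 4"
  by (simp_all add: dirs_def)

lemma nbrs_steps: "(t + 1, j) \<in> nbrs (t, j)" "(j, t + 1) \<in> nbrs (j, t)"
  by (simp_all add: nbrs_def)

text \<open>A place with its coordinates spelled out.\<close>

locale placed =
  fixes A :: "site set" and k :: nat and a d w :: site and P :: place
  assumes fin: "finite A" and k: "k < 9" and place: "P \<in> places k A"
    and P: "P = (a, d, w)"
begin

lemma facts:
  "a \<in> A" "d \<in> dirs" "w \<in> offsets" "laid k P \<subseteq> A" "ref P \<in> boundary (fat (A - laid k P))"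
  using place by (auto simp: places_def P)

lemma nonempty: "A \<noteq> {}" using facts by auto

lemma fin_fat: "finite (fat (A - laid k P))"
  using fin by (intro finite_fat) auto

lemma laid_eq: "laid k P = frame a d ` set (take k cells)" by (simp add: laid_def P)
lemma ref_eq: "ref P = frame a d w" by (simp add: ref_def P)
lemma target_eq: "target k P = frame a d (cells ! k)" by (simp add: target_def P)

lemma in_core: "a \<in> A - laid k P"
proof -
  have "(0, 0) \<notin> set (take k cells)" using cells_bounds in_set_takeD by fastforce
  then have "frame a d (0, 0) \<notin> laid k P" using facts(2) by (auto simp: laid_eq)
  then show ?thesis using facts(1) by (simp add: frame_0)
qed

text \<open>A particle in the ball would make the centre a site of the neighbourhood whose boundary it is on.\<close>

lemma free:
  assumes "l1 u w \<le> 15" "u \<notin> set (take k cells)" shows "frame a d u \<notin> A"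
proof
  assume "frame a d u \<in> A"
  then have "frame a d u \<in> A - laid k P" using assms facts(2) by (auto simp: laid_eq)
  moreover have "ref P \<in> l1_ball (frame a d u) 15" using assms facts(2) by (simp add: ref_eq l1_ball_def l1_commute)
  ultimately have "ref P \<in> fat (A - laid k P)" by (auto simp: fat_def)
  then show False using facts(5) by (simp add: boundary_eq)
qed

lemma free_exterior:
  assumes "\<And>v. v \<in> insert u (nbrs u) \<Longrightarrow> l1 v w \<le> 15 \<and> v \<notin> set (take k cells)"
  shows "frame a d u \<in> exterior A"
  using assms free unfolding exterior_iff nbrs_frame[OF facts(2)] by auto

lemma subset_fat_core: "A \<subseteq> fat (A - laid k P)"
proof
  fix x assume x: "x \<in> A"
  show "x \<in> fat (A - laid k P)"
  proof (cases "x \<in> laid k P")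
    case True
    then obtain c where c: "c \<in> set cells" "x = frame a d c" by (auto simp: laid_eq dest: in_set_takeD)
    have "l1 (frame a d c) (frame a d (0, 0)) \<le> 15"
      using cells_bounds[OF c(1)] facts(2) unfolding l1_frame[OF facts(2)] by (simp add: l1_def)
    then show ?thesis using in_core c by (auto simp: fat_def l1_ball_def frame_0)
  next
    case False
    then show ?thesis using x subset_fat by blast
  qed
qed

text \<open>From the centre the walker goes along its row to the column of the landing site, then down.\<close>

lemma target_boundary: "target k P \<in> boundary A" and landing_linked:
  "linked (exterior A) (nat \<bar>fst (landings ! k) - fst w\<bar> + nat \<bar>snd (landings ! k) - snd w\<bar>)
     (ref P) (frame a d (landings ! k))"
proof -
  obtain i j where w: "w = (i, j)" by fastforce
  have ij: "8 \<le> j" "\<bar>i\<bar> + j = 16" using facts(3) by (auto simp: w offsets_def)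
  obtain x y where l: "landings ! k = (x, y)" by fastforce
  have xy: "0 \<le> x" "x \<le> 2" "x + 2 \<le> y" "y \<le> 6" using landing(2)[OF k] by (auto simp: l)
  have c: "cells ! k \<in> set cells" using k by simp
  have "l1 (cells ! k) w \<le> 15" using cells_bounds[OF c] ij by (auto simp: l1_def w)
  then have "target k P \<notin> A" using free cell_not_laid[OF k] by (simp add: target_eq)
  moreover have "nbrs (target k P) \<inter> A \<noteq> {}"
  proof -
    obtain v where "v \<in> nbrs (cells ! k)" "v \<in> insert (0, 0) (set (take k cells))"
      using cell_attached[OF k] by blast
    then have "frame a d v \<in> nbrs (target k P)" "frame a d v \<in> A"
      using facts by (auto simp: target_eq laid_eq frame_0)
    then show ?thesis by blast
  qed
  ultimately show "target k P \<in> boundary A" by (simp add: boundary_eq)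
  have row: "frame a d (t, j) \<in> exterior A" if "min i x \<le> t" "t \<le> max i x" for t
  proof (rule free_exterior)
    fix v assume v: "v \<in> insert (t, j) (nbrs (t, j))"
    then have "snd v > 5" using ij by (auto simp: nbrs_def)
    then have "v \<notin> set (take k cells)" using cells_bounds in_set_takeD by fastforce
    moreover have "l1 v w \<le> 15" using v that ij xy by (auto simp: nbrs_def w l1_def)
    ultimately show "l1 v w \<le> 15 \<and> v \<notin> set (take k cells)" by blast
  qed
  have column: "frame a d (x, t) \<in> exterior A" if "y \<le> t" "t \<le> j" for t
  proof (rule free_exterior)
    fix v assume v: "v \<in> insert (x, t) (nbrs (x, t))"
    then have "v \<notin> set (take k cells)" using column_clear[OF k, of t v] that by (simp add: l)
    moreover have "l1 v w \<le> 15" using v that ij xy by (auto simp: nbrs_def w l1_def)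
    ultimately show "l1 v w \<le> 15 \<and> v \<notin> set (take k cells)" by blast
  qed
  have "linked (exterior A) (nat \<bar>x - i\<bar>) (frame a d (i, j)) (frame a d (x, j))"
    using row facts(2) by (intro linked_segment'[where p = "\<lambda>t. frame a d (t, j)"]) (auto simp: nbrs_steps)
  moreover have "linked (exterior A) (nat \<bar>y - j\<bar>) (frame a d (x, j)) (frame a d (x, y))"
    using column xy ij facts(2) by (intro linked_segment'[where p = "\<lambda>t. frame a d (x, t)"]) (auto simp: nbrs_steps)
  ultimately show "linked (exterior A) (nat \<bar>fst (landings ! k) - fst w\<bar> + nat \<bar>snd (landings ! k) - snd w\<bar>)
     (ref P) (frame a d (landings ! k))"
    using linked_trans by (simp add: ref_eq w l)
qed

lemma hit_target: "1 / harnack \<le> hit_prob (boundary A) (ref P) (target k P)"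
  unfolding harnack_def
proof (rule linked_hit_prob[OF landing_linked])
  show "target k P \<in> nbrs (frame a d (landings ! k))"
    using landing(1)[OF k] facts(2) by (simp add: target_eq)
  have "\<bar>fst w\<bar> \<le> 8" "8 \<le> snd w" "snd w \<le> 16" using facts(3) by (auto simp: offsets_def)
  then show "Suc (nat \<bar>fst (landings ! k) - fst w\<bar> + nat \<bar>snd (landings ! k) - snd w\<bar>) \<le> 40"
    using landing(2)[OF k] by auto
qed (rule target_boundary)

text \<open>A walker that arrives at the centre has not met the boundary of \<open>A\<close>, and it steps onto the next cell
with probability at least \<open>1 / harnack\<close>.\<close>

lemma place_hm_le: "place_hm k A P \<le> harnack * harmonic_measure (boundary A) (target k P)"
proof -
  have nn: "0 \<le> place_hm k A P" unfolding place_hm_def using fin_fat by (intro harmonic_measure_nonneg) auto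
  have "place_hm k A P * (1 / harnack) \<le> place_hm k A P * hit_prob (boundary A) (ref P) (target k P)"
    by (intro mult_left_mono hit_target nn)
  also have "\<dots> \<le> harmonic_measure (boundary A) (target k P)"
    unfolding place_hm_def by (intro harmonic_measure_ge_via subset_fat_core fin_fat nonempty facts)
  finally show ?thesis by (simp add: field_simps)
qed

lemma hit_ref_le:
  assumes "u \<in> exterior (fat (A - laid k P))"
  shows "hit_prob (boundary (fat (A - laid k P))) u (ref P) \<le> harnack * hit_prob (boundary A) u (target k P)"
proof -
  let ?h = "hit_prob (boundary (fat (A - laid k P))) u (ref P)"
  have "?h * (1 / harnack) \<le> ?h * hit_prob (boundary A) (ref P) (target k P)"
    by (intro mult_left_mono hit_target hit_prob_nonneg)
  also have "\<dots> \<le> hit_prob (boundary A) u (target k P)"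
    using assms by (intro hit_prob_ge_via subset_fat_core fin_fat nonempty facts)
  finally show ?thesis by (simp add: field_simps)
qed

lemma core_advance: "insert (target k P) A - laid (Suc k) P = A - laid k P"
  and laid_Suc: "laid (Suc k) P = insert (target k P) (laid k P)"
proof -
  have "set (take (Suc k) cells) = insert (cells ! k) (set (take k cells))"
    using k by (simp add: take_Suc_conv_app_nth)
  then show *: "laid (Suc k) P = insert (target k P) (laid k P)"
    by (auto simp: laid_def target_def P)
  have "target k P \<notin> A" using target_boundary by (simp add: boundary_eq)
  then show "insert (target k P) A - laid (Suc k) P = A - laid k P" unfolding * by auto
qed

lemma advance: "P \<in> places (Suc k) (insert (target k P) A)"
  "place_hm (Suc k) (insert (target k P) A) P = place_hm k A P"
proof -
  show "P \<in> places (Suc k) (insert (target k P) A)"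
    using facts core_advance laid_Suc unfolding places_def P by auto
qed (simp add: place_hm_def core_advance)

lemma enclosed:
  assumes "k = 8"
  obtains h where "h \<notin> insert (target k P) A" "nbrs h \<subseteq> insert (target k P) A" "target k P \<in> nbrs h"
proof
  let ?h = "frame a d (1, 4)"
  have ij: "8 \<le> snd w" "\<bar>fst w\<bar> + snd w = 16" using facts(3) by (auto simp: offsets_def)
  have "nbrs (1, 4) \<subseteq> set cells" by (auto simp: nbrs_def cells_def)
  moreover have "laid (Suc k) P = frame a d ` set cells"
    using assms by (simp add: laid_def P cells_def)
  ultimately have "nbrs ?h \<subseteq> laid (Suc k) P" using facts(2) by (auto simp: nbrs_frame)
  then show "nbrs ?h \<subseteq> insert (target k P) A" using laid_Suc facts(4) by blast
  have "?h \<notin> A"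
  proof (rule free)
    show "l1 (1, 4) w \<le> 15" using ij by (auto simp: l1_def)
    show "(1, 4) \<notin> set (take k cells)" by (auto simp: cells_def dest: in_set_takeD)
  qed
  moreover have "?h \<noteq> target k P" unfolding target_eq frame_eq_iff[OF facts(2)] by (simp add: assms cells_def)
  ultimately show "?h \<notin> insert (target k P) A" by auto
  show "target k P \<in> nbrs ?h" unfolding target_eq frame_nbrs_iff[OF facts(2)] by (simp add: assms cells_def nbrs_def)
qed

context
  fixes z assumes z: "z \<in> boundary A" and far: "ref P \<notin> l1_ball z 15"
begin

lemma core_insert: "insert z A - laid k P = insert z (A - laid k P)"
  using z facts(4) by (auto simp: boundary_eq)

lemma fat_insert: "fat (insert z (A - laid k P)) = fat (A - laid k P) \<union> l1_ball z 15"
  by (auto simp: fat_def)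

lemma persists: "P \<in> places k (insert z A)"
proof -
  have "ref P \<in> boundary (fat (insert z A - laid k P))"
    using facts(5) far unfolding core_insert fat_insert by (auto simp: boundary_eq)
  then show ?thesis using facts unfolding places_def P by auto
qed

text \<open>A walker that the new particle \<open>z\<close> diverts from the centre first comes to the boundary of the
neighbourhood of \<open>z\<close>. From there it meets the boundary of \<open>A\<close> near \<open>z\<close> with probability at least
\<open>1 / harnack\<close>, which bounds the probability of coming there by the harmonic measure near \<open>z\<close>. Without
\<open>z\<close> it would have gone on to the centre and, up to a factor \<open>harnack\<close>, to the next cell.\<close>

lemma place_hm_loss:
  "place_hm k A P \<le> place_hm k (insert z A) P +
     harnack\<^sup>2 * (\<Sum>b\<in>boundary A \<inter> l1_ball z 16. harmonic_measure (boundary A) b) *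
     (\<Sum>u\<in>exterior A \<inter> l1_ball z 16. hit_prob (boundary A) u (target k P))"
proof -
  define Y where "Y = fat (A - laid k P)"
  define Y' where "Y' = fat (insert z A - laid k P)"
  let ?m = "harmonic_measure (boundary Y')"
  let ?M = "\<Sum>b\<in>boundary A \<inter> l1_ball z 16. harmonic_measure (boundary A) b"
  have Y': "Y' = Y \<union> l1_ball z 15" by (simp add: Y'_def Y_def core_insert fat_insert)
  have AY: "A \<subseteq> Y" using subset_fat_core by (simp add: Y_def)
  have fY: "finite Y" "finite Y'" using fin_fat by (auto simp: Y' Y_def)
  have Yne: "Y \<noteq> {}" using AY nonempty by blast
  have rY: "ref P \<in> boundary Y" "ref P \<in> boundary Y'"
    using facts(5) far by (auto simp: Y_def[symmetric] Y' boundary_eq)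
  have new_boundary: "u \<in> l1_ball z 16" if u: "u \<in> boundary Y' - boundary Y" for u
  proof -
    obtain v where v: "v \<in> nbrs u" "v \<in> Y'" using u by (auto simp: boundary_eq)
    then have "v \<in> l1_ball z 15" using u by (auto simp: Y' boundary_eq)
    then have "l1 v z \<le> 15" "l1 u v = 1" using v by (auto simp: l1_ball_def nbrs_iff_l1)
    then show ?thesis using l1_triangle[of u z v] by (simp add: l1_ball_def)
  qed
  have pull_out: "(\<Sum>u\<in>S. (harnack * c) * (harnack * f u)) = harnack\<^sup>2 * c * sum f S"
    for c :: real and f :: "site \<Rightarrow> real" and S
    by (simp add: sum_distrib_left power2_eq_square mult_ac)
  have m_nn: "0 \<le> ?m u" for u using fY by (intro harmonic_measure_nonneg) auto
  have "place_hm k A P = (\<Sum>u\<in>boundary Y'. ?m u * hit_prob (boundary Y) u (ref P))"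
    unfolding place_hm_def Y_def[symmetric] by (rule harmonic_measure_via) (use Y' fY Yne in auto)
  also have "\<dots> = (\<Sum>u\<in>boundary Y' \<inter> boundary Y. ?m u * hit_prob (boundary Y) u (ref P))
      + (\<Sum>u\<in>boundary Y' - boundary Y. ?m u * hit_prob (boundary Y) u (ref P))"
    using fY by (subst sum.Int_Diff[of _ _ "boundary Y"]) auto
  \<comment> \<open>on the common boundary the hitting kernel is the identity, so only new boundary sites matter\<close>
  also have "(\<Sum>u\<in>boundary Y' \<inter> boundary Y. ?m u * hit_prob (boundary Y) u (ref P)) =
      (\<Sum>u\<in>boundary Y' \<inter> boundary Y. if u = ref P then ?m u else 0)"
    by (intro sum.cong refl) (auto simp: hit_prob_on)
  also have "\<dots> = place_hm k (insert z A) P"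
    using rY fY by (simp add: place_hm_def Y'_def[symmetric])
  also have "(\<Sum>u\<in>boundary Y' - boundary Y. ?m u * hit_prob (boundary Y) u (ref P)) \<le>
      (\<Sum>u\<in>boundary Y' - boundary Y. (harnack * ?M) * (harnack * hit_prob (boundary A) u (target k P)))"
  proof (intro sum_mono mult_mono)
    fix u assume u: "u \<in> boundary Y' - boundary Y"
    then have ext: "u \<in> exterior Y" by (auto simp: Y' boundary_eq exterior_iff)
    then show "hit_prob (boundary Y) u (ref P) \<le> harnack * hit_prob (boundary A) u (target k P)"
      unfolding Y_def by (rule hit_ref_le)
    have uA: "u \<in> exterior A" using ext exterior_antimono[OF AY] by blast
    have "u \<in> l1_ball z 16" using u by (rule new_boundary)
    have "z \<notin> exterior A" using z by (simp add: exterior_def)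
    from approach[OF uA this \<open>u \<in> l1_ball z 16\<close>] obtain m v b where
      m: "m \<le> 16" "linked (exterior A) m u v" "b \<in> nbrs v" "b \<in> boundary A" "b \<in> l1_ball z 16" by blast
    have "1 / harnack \<le> hit_prob (boundary A) u b"
      unfolding harnack_def by (rule linked_hit_prob[OF m(2-4)]) (use m(1) in simp)
    then have "?m u * (1 / harnack) \<le> ?m u * hit_prob (boundary A) u b"
      by (intro mult_left_mono m_nn)
    also have "\<dots> \<le> harmonic_measure (boundary A) b"
      using u AY Y' fY nonempty by (intro harmonic_measure_ge_via) auto
    also have "\<dots> \<le> ?M"
      using m fin by (intro member_le_sum harmonic_measure_nonneg) auto
    finally show "?m u \<le> harnack * ?M" by (simp add: field_simps)
  qed (use fin in \<open>auto intro!: mult_nonneg_nonneg sum_nonneg harmonic_measure_nonneg hit_prob_nonneg less_imp_le[OF harnack_pos]\<close>)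
  also have "\<dots> = harnack\<^sup>2 * ?M * (\<Sum>u\<in>boundary Y' - boundary Y. hit_prob (boundary A) u (target k P))"
    by (rule pull_out)
  also have "\<dots> \<le> harnack\<^sup>2 * ?M * (\<Sum>u\<in>exterior A \<inter> l1_ball z 16. hit_prob (boundary A) u (target k P))"
  proof (intro mult_left_mono sum_mono2)
    show "boundary Y' - boundary Y \<subseteq> exterior A \<inter> l1_ball z 16"
    proof
      fix u assume u: "u \<in> boundary Y' - boundary Y"
      then have "u \<in> exterior Y" by (auto simp: Y' boundary_eq exterior_iff)
      then show "u \<in> exterior A \<inter> l1_ball z 16"
        using new_boundary[OF u] exterior_antimono[OF AY] by blast
    qed
  qed (use fin in \<open>auto intro!: mult_nonneg_nonneg sum_nonneg harmonic_measure_nonneg hit_prob_nonneg less_imp_le[OF harnack_pos]\<close>)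
  finally show ?thesis by simp
qed

end

end

section \<open>Square and cube sums over places\<close>

lemma frame_inj_base: "frame a d c = frame a' d c \<Longrightarrow> a = a'"
  by (auto simp: frame_def prod_eq_iff)

lemma places_subset: "places k A \<subseteq> A \<times> dirs \<times> offsets"
  by (auto simp: places_def)

lemma finite_places: "finite A \<Longrightarrow> finite (places k A)"
  by (rule finite_subset[OF places_subset]) (simp add: finite_dirs finite_offsets)

lemma card_dirs_offsets: "card (dirs \<times> offsets) \<le> 68"
  using card_offsets by (simp add: card_cartesian_product card_dirs)

lemma card_places:
  assumes "finite A" shows "card (places k A) \<le> 68 * card A"
proof -
  have "card (places k A) \<le> card (A \<times> dirs \<times> offsets)"
    using assms by (intro card_mono places_subset) (simp add: finite_dirs finite_offsets)
  also have "\<dots> = card A * card (dirs \<times> offsets)" by (rule card_cartesian_product)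
  also have "\<dots> \<le> card A * 68" by (intro mult_left_mono card_dirs_offsets) simp
  finally show ?thesis by simp
qed

lemma card_places_target: "card {P \<in> places k A. target k P = z} \<le> 68"
proof -
  have "card {P \<in> places k A. target k P = z} \<le> card (dirs \<times> offsets)"
    by (rule card_inj_on_le[where f = snd])
      (auto simp: inj_on_def target_def places_def finite_dirs finite_offsets dest: frame_inj_base)
  then show ?thesis using card_dirs_offsets by simp
qed

lemma card_places_ref: "card {P \<in> places k A. ref P \<in> l1_ball z 15} \<le> 68 * 33\<^sup>2"
proof -
  have "card {P \<in> places k A. ref P \<in> l1_ball z 15} \<le> card (l1_ball z 15 \<times> (dirs \<times> offsets))"
    by (rule card_inj_on_le[where f = "\<lambda>P. (ref P, snd P)"])
      (auto simp: inj_on_def ref_def places_def finite_dirs finite_offsets dest: frame_inj_base)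
  also have "\<dots> = card (l1_ball z 15) * card (dirs \<times> offsets)" by (rule card_cartesian_product)
  also have "\<dots> \<le> 33\<^sup>2 * 68"
    using card_l1_ball[of z 15] by (intro mult_mono card_dirs_offsets) auto
  finally show ?thesis by simp
qed

text \<open>A companion of \<open>sum_fibers_le\<close> for double sums over a relation.\<close>

lemma sum_related_le:
  fixes f :: "'a \<Rightarrow> real"
  assumes "finite S" and "\<And>s. s \<in> S \<Longrightarrow> 0 \<le> f s" "\<And>s. s \<in> S \<Longrightarrow> real (card (R s)) \<le> m"
  shows "(\<Sum>s\<in>S. \<Sum>t\<in>R s. f s) \<le> m * (\<Sum>s\<in>S. f s)"
  using assms by (auto simp: sum_distrib_left intro!: sum_mono mult_right_mono)

text \<open>Two applications of Cauchy and Schwarz, with \<open>\<Sum> m\<^sup>2 h\<close> in the middle.\<close>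

lemma weighted_power_mean:
  fixes h m :: "'a \<Rightarrow> real"
  assumes "\<And>g. g \<in> G \<Longrightarrow> 0 \<le> h g" "\<And>g. g \<in> G \<Longrightarrow> 0 \<le> m g"
  shows "(\<Sum>g\<in>G. m g * h g) ^ 3 \<le> (\<Sum>g\<in>G. h g)\<^sup>2 * (\<Sum>g\<in>G. (m g) ^ 3 * h g)"
proof -
  let ?W = "\<Sum>g\<in>G. h g" and ?S1 = "\<Sum>g\<in>G. m g * h g" and ?S2 = "\<Sum>g\<in>G. (m g)\<^sup>2 * h g"
    and ?S3 = "\<Sum>g\<in>G. (m g) ^ 3 * h g"
  have nn: "0 \<le> ?W" "0 \<le> ?S1" "0 \<le> ?S2" "0 \<le> ?S3" using assms by (auto intro!: sum_nonneg)
  have "(\<Sum>g\<in>G. sqrt (h g) * (m g * sqrt (h g)))\<^sup>2 \<le> (\<Sum>g\<in>G. (sqrt (h g))\<^sup>2) * (\<Sum>g\<in>G. (m g * sqrt (h g))\<^sup>2)"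
    by (rule Cauchy_Schwarz_ineq_sum)
  also have "(\<Sum>g\<in>G. sqrt (h g) * (m g * sqrt (h g))) = ?S1"
    using assms by (intro sum.cong) (auto simp: mult_ac)
  also have "(\<Sum>g\<in>G. (sqrt (h g))\<^sup>2) = ?W" using assms by (intro sum.cong) auto
  also have "(\<Sum>g\<in>G. (m g * sqrt (h g))\<^sup>2) = ?S2" using assms by (intro sum.cong) (auto simp: power_mult_distrib)
  finally have 1: "?S1\<^sup>2 \<le> ?W * ?S2" .
  have "(\<Sum>g\<in>G. sqrt (m g * h g) * (m g * sqrt (m g * h g)))\<^sup>2 \<le> (\<Sum>g\<in>G. (sqrt (m g * h g))\<^sup>2) * (\<Sum>g\<in>G. (m g * sqrt (m g * h g))\<^sup>2)"
    by (rule Cauchy_Schwarz_ineq_sum)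
  also have "(\<Sum>g\<in>G. sqrt (m g * h g) * (m g * sqrt (m g * h g))) = ?S2"
    using assms by (intro sum.cong refl) (simp add: mult.left_commute[of "sqrt _" "m _"] power2_eq_square)
  also have "(\<Sum>g\<in>G. (sqrt (m g * h g))\<^sup>2) = ?S1" using assms by (intro sum.cong) auto
  also have "(\<Sum>g\<in>G. (m g * sqrt (m g * h g))\<^sup>2) = ?S3"
    using assms by (intro sum.cong) (auto simp: power_mult_distrib power2_eq_square power3_eq_cube)
  finally have 2: "?S2\<^sup>2 \<le> ?S1 * ?S3" .
  show ?thesis
  proof (cases "?S1 = 0")
    case True
    then show ?thesis using nn by simp
  next
    case False
    then have pos: "0 < ?S1" using nn by simp
    have "?S1 * ?S1 ^ 3 = (?S1\<^sup>2)\<^sup>2" by (simp add: power2_eq_square power3_eq_cube)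
    also have "\<dots> \<le> (?W * ?S2)\<^sup>2" using 1 by (intro power_mono) auto
    also have "\<dots> = ?W\<^sup>2 * ?S2\<^sup>2" by (simp add: power_mult_distrib)
    also have "\<dots> \<le> ?W\<^sup>2 * (?S1 * ?S3)" using 2 by (intro mult_left_mono) auto
    finally have "?S1 * ?S1 ^ 3 \<le> ?S1 * (?W\<^sup>2 * ?S3)" by (simp add: mult_ac)
    then show ?thesis using pos by (rule mult_left_le_imp_le)
  qed
qed

lemma young_21:
  fixes a b \<epsilon> :: real
  assumes "0 \<le> a" "0 \<le> b" "0 < \<epsilon>"
  shows "a\<^sup>2 * b \<le> \<epsilon> * a ^ 3 + b ^ 3 / \<epsilon>\<^sup>2"
proof (cases "b \<le> \<epsilon> * a")
  case True
  then have "a\<^sup>2 * b \<le> a\<^sup>2 * (\<epsilon> * a)" by (rule mult_left_mono) simp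
  moreover have "0 \<le> b ^ 3 / \<epsilon>\<^sup>2" using assms by simp
  ultimately show ?thesis by (simp add: power2_eq_square power3_eq_cube mult_ac)
next
  case False
  then have "a \<le> b / \<epsilon>" using assms by (simp add: field_simps)
  then have "a\<^sup>2 * b \<le> (b / \<epsilon>)\<^sup>2 * b" using assms by (intro mult_right_mono power_mono) auto
  moreover have "0 \<le> \<epsilon> * a ^ 3" using assms by simp
  ultimately show ?thesis by (simp add: power2_eq_square power3_eq_cube)
qed

lemma young_12:
  fixes a b \<epsilon> :: real
  assumes "0 \<le> a" "0 \<le> b" "0 < \<epsilon>" "\<epsilon> \<le> 1"
  shows "a * b\<^sup>2 \<le> \<epsilon> * a ^ 3 + b ^ 3 / \<epsilon>\<^sup>2"
proof (cases "b \<le> \<epsilon> * a")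
  case True
  then have "b\<^sup>2 \<le> (\<epsilon> * a)\<^sup>2" using assms by (intro power_mono) auto
  also have "\<dots> \<le> \<epsilon> * a\<^sup>2"
  proof -
    have "\<epsilon>\<^sup>2 \<le> \<epsilon>" using assms mult_left_mono[of \<epsilon> 1 \<epsilon>] by (simp add: power2_eq_square)
    then show ?thesis unfolding power_mult_distrib by (rule mult_right_mono) simp
  qed
  finally have "a * b\<^sup>2 \<le> a * (\<epsilon> * a\<^sup>2)" using assms by (intro mult_left_mono) auto
  moreover have "0 \<le> b ^ 3 / \<epsilon>\<^sup>2" using assms by simp
  ultimately show ?thesis by (simp add: power2_eq_square power3_eq_cube mult_ac)
next
  case False
  then have "a \<le> b / \<epsilon>" using assms by (simp add: field_simps)
  also have "\<dots> \<le> b / \<epsilon>\<^sup>2"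
    using assms mult_left_mono[of \<epsilon> 1 \<epsilon>] by (intro divide_left_mono) (auto simp: power2_eq_square)
  finally have "a * b\<^sup>2 \<le> b / \<epsilon>\<^sup>2 * b\<^sup>2" using assms by (intro mult_right_mono) auto
  moreover have "0 \<le> \<epsilon> * a ^ 3" using assms by simp
  ultimately show ?thesis by (simp add: power2_eq_square power3_eq_cube)
qed

definition mu :: "site set \<Rightarrow> site \<Rightarrow> real" where
  "mu A z = harmonic_measure (boundary A) z"

text \<open>The radius is that of \<open>place_hm_loss\<close>, here and in the next definition.\<close>

definition mu_near :: "site set \<Rightarrow> site \<Rightarrow> real" where
  "mu_near A z = (\<Sum>b\<in>boundary A \<inter> l1_ball z 16. mu A b)"

definition reach :: "site set \<Rightarrow> site \<Rightarrow> site \<Rightarrow> real" where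
  "reach A z v = (\<Sum>u\<in>exterior A \<inter> l1_ball z 16. hit_prob (boundary A) u v)"

definition sq_sum :: "nat \<Rightarrow> site set \<Rightarrow> real" where
  "sq_sum k A = (\<Sum>P\<in>places k A. (place_hm k A P)\<^sup>2)"

definition cube_sum :: "nat \<Rightarrow> site set \<Rightarrow> real" where
  "cube_sum k A = (\<Sum>P\<in>places k A. (place_hm k A P) ^ 3)"

text \<open>The part of \<open>sq_sum k A\<close> that the particle \<open>z\<close> destroys. A place is given up if \<open>z\<close> is attached in its ball.\<close>

definition loss :: "nat \<Rightarrow> site set \<Rightarrow> site \<Rightarrow> real" where
  "loss k A z = (\<Sum>P\<in>places k A. if ref P \<in> l1_ball z 15 then (place_hm k A P)\<^sup>2
      else max 0 ((place_hm k A P)\<^sup>2 - (place_hm k (insert z A) P)\<^sup>2))"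

text \<open>The places that \<open>z\<close> advances by one stage.\<close>

definition gain :: "nat \<Rightarrow> site set \<Rightarrow> site \<Rightarrow> real" where
  "gain k A z = (\<Sum>P\<in>{P \<in> places k A. target k P = z}. (place_hm k A P)\<^sup>2)"

lemma placed_intro:
  assumes "finite A" "k < 9" "P \<in> places k A"
  shows "placed A k (fst P) (fst (snd P)) (snd (snd P)) P"
  using assms by unfold_locales auto

lemma sum_target_le:
  fixes f :: "site \<Rightarrow> real"
  assumes "finite A" "k < 9" "\<And>v. 0 \<le> f v"
  shows "(\<Sum>P\<in>places k A. f (target k P)) \<le> 68 * (\<Sum>v\<in>boundary A. f v)"
proof (rule sum_fibers_le)
  show "target k P \<in> boundary A" if "P \<in> places k A" for P
    by (rule placed.target_boundary[OF placed_intro[OF assms(1,2) that]])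
  show "real (card {P \<in> places k A. target k P = v}) \<le> 68" for v
    using card_places_target[of k A v] by simp
qed (use assms in \<open>auto simp: finite_places\<close>)

lemma place_hm_nonneg: "finite A \<Longrightarrow> 0 \<le> place_hm k A P"
  unfolding place_hm_def by (intro harmonic_measure_nonneg finite_boundary finite_fat) auto

lemma place_hm_le_1: "finite A \<Longrightarrow> place_hm k A P \<le> 1"
  unfolding place_hm_def by (intro harmonic_measure_le_1 finite_boundary finite_fat) auto

lemma mu_nonneg: "finite A \<Longrightarrow> 0 \<le> mu A z"
  unfolding mu_def by (intro harmonic_measure_nonneg finite_boundary)

lemma reach_nonneg: "0 \<le> reach A z v"
  unfolding reach_def by (intro sum_nonneg hit_prob_nonneg)

lemma mu_near_nonneg: "finite A \<Longrightarrow> 0 \<le> mu_near A z"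
  unfolding mu_near_def by (intro sum_nonneg mu_nonneg)

lemma sq_sum_nonneg: "0 \<le> sq_sum k A" unfolding sq_sum_def by (intro sum_nonneg) auto
lemma gain_nonneg: "0 \<le> gain k A z" unfolding gain_def by (intro sum_nonneg) auto
lemma loss_nonneg: "0 \<le> loss k A z" unfolding loss_def by (intro sum_nonneg) auto
lemma cube_sum_nonneg: "finite A \<Longrightarrow> 0 \<le> cube_sum k A"
  unfolding cube_sum_def by (intro sum_nonneg zero_le_power place_hm_nonneg)

lemma loss_le_sq_sum: "loss k A z \<le> sq_sum k A"
  unfolding loss_def sq_sum_def by (intro sum_mono) auto

lemma retained:
  assumes "finite A" "k < 9" "z \<in> boundary A"
  shows "sq_sum k A - loss k A z \<le> (\<Sum>P\<in>{P\<in>places k A. ref P \<notin> l1_ball z 15}. (place_hm k (insert z A) P)\<^sup>2)"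
proof -
  have "sq_sum k A - loss k A z = (\<Sum>P\<in>places k A. if ref P \<in> l1_ball z 15 then 0
      else min ((place_hm k A P)\<^sup>2) ((place_hm k (insert z A) P)\<^sup>2))"
    unfolding sq_sum_def loss_def sum_subtractf[symmetric] by (intro sum.cong) auto
  also have "\<dots> = (\<Sum>P\<in>{P\<in>places k A. ref P \<notin> l1_ball z 15}. min ((place_hm k A P)\<^sup>2) ((place_hm k (insert z A) P)\<^sup>2))"
    by (simp add: sum.If_cases finite_places[OF assms(1)] Int_def)
  also have "\<dots> \<le> (\<Sum>P\<in>{P\<in>places k A. ref P \<notin> l1_ball z 15}. (place_hm k (insert z A) P)\<^sup>2)"
    by (intro sum_mono) auto
  finally show ?thesis .
qed

lemma persists_insert:
  assumes "finite A" "k < 9" "z \<in> boundary A" "P \<in> places k A" "ref P \<notin> l1_ball z 15"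
  shows "P \<in> places k (insert z A)"
  using placed.persists[OF placed_intro] assms by blast

lemma sq_sum_step_0:
  assumes "finite A" "k < 9" "z \<in> boundary A"
  shows "sq_sum k A - loss k A z \<le> sq_sum k (insert z A)"
proof -
  have "(\<Sum>P\<in>{P\<in>places k A. ref P \<notin> l1_ball z 15}. (place_hm k (insert z A) P)\<^sup>2) \<le> sq_sum k (insert z A)"
    unfolding sq_sum_def
  proof (intro sum_mono2)
    show "finite (places k (insert z A))" using assms by (simp add: finite_places)
    show "{P\<in>places k A. ref P \<notin> l1_ball z 15} \<subseteq> places k (insert z A)"
      using persists_insert[OF assms] by blast
  qed simp
  then show ?thesis using retained[OF assms] by linarith
qed

text \<open>Places that \<open>z\<close> advances have \<open>z\<close> in their ball, so they are not among those that persist at their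
stage: nothing is counted twice.\<close>

lemma sq_sum_step_Suc:
  assumes "finite A" "Suc k < 9" "z \<in> boundary A"
  shows "sq_sum (Suc k) A - loss (Suc k) A z + gain k A z \<le> sq_sum (Suc k) (insert z A)"
proof -
  let ?S = "{P\<in>places (Suc k) A. ref P \<notin> l1_ball z 15}" and ?T = "{P \<in> places k A. target k P = z}"
  have near: "ref P \<in> l1_ball z 15" if "P \<in> ?T" for P
  proof -
    interpret placed A k "fst P" "fst (snd P)" "snd (snd P)" P
      using that assms by (intro placed_intro) auto
    have "cells ! k \<in> set cells" using k by simp
    then have "l1 (cells ! k) (snd (snd P)) \<le> 15"
      using cells_bounds[of "cells ! k"] facts(3) by (auto simp: l1_def offsets_def)
    then have "l1 (target k P) (ref P) \<le> 15" using facts(2) by (simp add: target_eq ref_eq)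
    then show ?thesis using that by (simp add: l1_ball_def l1_commute)
  qed
  have "gain k A z = (\<Sum>P\<in>?T. (place_hm (Suc k) (insert z A) P)\<^sup>2)"
    unfolding gain_def using assms by (intro sum.cong refl) (auto simp flip: placed.advance(2)[OF placed_intro])
  then have "sq_sum (Suc k) A - loss (Suc k) A z + gain k A z \<le>
      (\<Sum>P\<in>?S. (place_hm (Suc k) (insert z A) P)\<^sup>2) + (\<Sum>P\<in>?T. (place_hm (Suc k) (insert z A) P)\<^sup>2)"
    using retained[OF assms] by linarith
  also have "\<dots> = (\<Sum>P\<in>?S \<union> ?T. (place_hm (Suc k) (insert z A) P)\<^sup>2)"
    using near assms by (intro sum.union_disjoint[symmetric]) (auto simp: finite_places)
  also have "\<dots> \<le> sq_sum (Suc k) (insert z A)"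
    unfolding sq_sum_def
  proof (intro sum_mono2)
    show "finite (places (Suc k) (insert z A))" using assms by (simp add: finite_places)
    show "?S \<union> ?T \<subseteq> places (Suc k) (insert z A)"
      using persists_insert[OF assms] placed.advance(1)[OF placed_intro[of A k]] assms(1,2) Suc_lessD by blast
  qed auto
  finally show ?thesis .
qed

text \<open>By \<open>place_hm_loss\<close> the weight drops from \<open>e\<close> to no less than \<open>e - \<delta>\<close>, and \<open>e\<^sup>2\<close> by at most \<open>2 e \<delta>\<close>.\<close>

lemma loss_le:
  assumes "finite A" "k < 9" "z \<in> boundary A"
  shows "loss k A z \<le> (\<Sum>P\<in>{P\<in>places k A. ref P \<in> l1_ball z 15}. (place_hm k A P)\<^sup>2)
     + (\<Sum>P\<in>places k A. 2 * harnack\<^sup>2 * (place_hm k A P * mu_near A z * reach A z (target k P)))"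
proof -
  have far: "max 0 ((place_hm k A P)\<^sup>2 - (place_hm k (insert z A) P)\<^sup>2)
      \<le> 2 * harnack\<^sup>2 * (place_hm k A P * mu_near A z * reach A z (target k P))"
    if P: "P \<in> places k A" "ref P \<notin> l1_ball z 15" for P
  proof -
    let ?e = "place_hm k A P" and ?e' = "place_hm k (insert z A) P"
    define \<delta> where "\<delta> = harnack\<^sup>2 * mu_near A z * reach A z (target k P)"
    have nn: "0 \<le> ?e" "0 \<le> ?e'" "0 \<le> \<delta>"
      using assms by (auto simp: \<delta>_def intro!: place_hm_nonneg mult_nonneg_nonneg mu_near_nonneg reach_nonneg)
    have "?e \<le> ?e' + \<delta>"
      using placed.place_hm_loss[OF placed_intro[OF assms(1,2) P(1)] assms(3) P(2)]
      by (simp add: \<delta>_def mu_near_def mu_def reach_def)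
    then have "?e\<^sup>2 \<le> ?e * (?e' + \<delta>)" using nn by (simp add: power2_eq_square mult_left_mono)
    also have "\<dots> \<le> ?e * \<delta> + (?e' + \<delta>) * ?e'"
      using nn \<open>?e \<le> ?e' + \<delta>\<close> mult_right_mono[of ?e "?e' + \<delta>" ?e'] by (simp add: algebra_simps)
    finally have *: "?e\<^sup>2 - ?e'\<^sup>2 \<le> ?e * \<delta> + \<delta> * ?e'" by (simp add: power2_eq_square algebra_simps)
    have "?e\<^sup>2 - ?e'\<^sup>2 \<le> 2 * (?e * \<delta>)"
    proof (cases "?e' \<le> ?e")
      case True
      then have "\<delta> * ?e' \<le> \<delta> * ?e" using nn by (intro mult_left_mono) auto
      then show ?thesis using * by (simp add: mult.commute)
    next
      case False
      then have "?e\<^sup>2 \<le> ?e'\<^sup>2" using nn by (intro power_mono) auto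
      moreover have "0 \<le> ?e * \<delta>" using nn by simp
      ultimately show ?thesis by linarith
    qed
    moreover have "0 \<le> ?e * \<delta>" using nn by simp
    ultimately show ?thesis by (simp add: \<delta>_def mult_ac)
  qed
  have nn: "0 \<le> 2 * harnack\<^sup>2 * (place_hm k A P * mu_near A z * reach A z (target k P))" for P
    using assms by (auto intro!: place_hm_nonneg mult_nonneg_nonneg mu_near_nonneg reach_nonneg)
  have "loss k A z \<le> (\<Sum>P\<in>places k A. (if ref P \<in> l1_ball z 15 then (place_hm k A P)\<^sup>2 else 0)
      + 2 * harnack\<^sup>2 * (place_hm k A P * mu_near A z * reach A z (target k P)))"
    unfolding loss_def using far nn by (intro sum_mono) auto
  also have "\<dots> = (\<Sum>P\<in>{P\<in>places k A. ref P \<in> l1_ball z 15}. (place_hm k A P)\<^sup>2)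
     + (\<Sum>P\<in>places k A. 2 * harnack\<^sup>2 * (place_hm k A P * mu_near A z * reach A z (target k P)))"
    by (simp add: sum.distrib sum.If_cases finite_places[OF assms(1)] Int_def)
  finally show ?thesis .
qed

section \<open>Transport of mass between boundary sites and places\<close>

abbreviation collar_bd :: real where "collar_bd \<equiv> collar_const 16"

lemma collar_const_ge_1: "1 \<le> collar_const n"
proof -
  have "1 * 1 * 1 \<le> 4 ^ n * (2 * real n + 1)\<^sup>2 * (4::real)" by (intro mult_mono) auto
  then show ?thesis by (simp add: collar_const_def)
qed

lemma card_l1_ball_le: "n \<le> 16 \<Longrightarrow> S \<subseteq> l1_ball z n \<Longrightarrow> real (card S) \<le> 33\<^sup>2"
proof -
  assume n: "n \<le> 16" "S \<subseteq> l1_ball z n"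
  have "card S \<le> card (l1_ball z n)" using n by (intro card_mono) auto
  also have "\<dots> \<le> (2 * n + 1)\<^sup>2" by (rule card_l1_ball)
  also have "\<dots> \<le> 33\<^sup>2" using n by (intro power_mono) auto
  finally have "real (card S) \<le> real (33\<^sup>2)" by (rule of_nat_mono)
  then show ?thesis by simp
qed

lemma mu_le_near: "finite A \<Longrightarrow> z \<in> boundary A \<Longrightarrow> mu A z \<le> mu_near A z"
  unfolding mu_near_def by (intro member_le_sum mu_nonneg) (auto simp: l1_ball_def)

lemma fat_boundary_collar:
  assumes "A \<subseteq> A'" "A' \<subseteq> A \<union> boundary A"
  shows "boundary (fat A') \<subseteq> collar A 16"
proof
  fix g assume g: "g \<in> boundary (fat A')"
  obtain x where x: "x \<in> nbrs g" "x \<in> fat A'" using g by (auto simp: boundary_eq)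
  then obtain a where a: "a \<in> A'" "l1 x a \<le> 15" by (auto simp: fat_def l1_ball_def)
  have "l1 g a \<le> 16" using l1_triangle[of g a x] x a by (simp add: nbrs_iff_l1)
  have "y \<notin> insert g (nbrs g)" if "y \<in> A" for y
  proof
    assume "y \<in> insert g (nbrs g)"
    then have "l1 g y \<le> 15" by (auto simp: nbrs_iff_l1)
    then have "g \<in> fat A'" using that assms by (auto simp: fat_def l1_ball_def)
    then show False using g by (simp add: boundary_eq)
  qed
  then have "g \<in> exterior A" unfolding exterior_iff by blast
  then show "g \<in> collar A 16" using a \<open>l1 g a \<le> 16\<close> assms by (auto simp: collar_def l1_ball_def)
qed

lemma hit_prob_fat_boundary_sum:
  assumes "finite A" "A \<subseteq> A'" "A' \<subseteq> A \<union> boundary A" "v \<in> boundary A"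
  shows "(\<Sum>g\<in>boundary (fat A'). hit_prob (boundary A) g v) \<le> collar_bd"
proof -
  have "(\<Sum>g\<in>boundary (fat A'). hit_prob (boundary A) g v) \<le> (\<Sum>g\<in>collar A 16. hit_prob (boundary A) g v)"
    using assms by (intro sum_mono2 finite_collar fat_boundary_collar hit_prob_nonneg)
  also have "\<dots> \<le> collar_bd" using assms by (intro hit_prob_collar_sum)
  finally show ?thesis .
qed

text \<open>A site on the boundary of the neighbourhood is at distance exactly 16 from some \<open>a\<close>; the frame is
chosen according to the coordinate that is large.\<close>

lemma ex_place:
  assumes "g \<in> boundary (fat A)"
  shows "\<exists>P\<in>places 0 A. ref P = g"
proof -
  obtain x where x: "x \<in> nbrs g" "x \<in> fat A" using assms by (auto simp: boundary_eq)
  then obtain a where a: "a \<in> A" "l1 x a \<le> 15" by (auto simp: fat_def l1_ball_def)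
  have "l1 g a \<le> 16" using l1_triangle[of g a x] x a by (simp add: nbrs_iff_l1)
  moreover have "\<not> l1 g a \<le> 15" using assms a by (auto simp: fat_def l1_ball_def boundary_eq)
  ultimately have d: "l1 g a = 16" by simp
  define p q where "p = fst g - fst a" and "q = snd g - snd a"
  have pq: "\<bar>p\<bar> + \<bar>q\<bar> = 16" using d by (simp add: l1_def p_def q_def)
  have g: "g = (fst a + p, snd a + q)" by (simp add: p_def q_def)
  consider "8 \<le> q" | "q \<le> - 8" | "8 \<le> p" | "p \<le> - 8" using pq by linarith
  then have "\<exists>d w. d \<in> dirs \<and> w \<in> offsets \<and> frame a d w = g"
  proof cases
    case 1
    then show ?thesis using pq by (intro exI[of _ "(0, 1)"] exI[of _ "(p, q)"]) (auto simp: g frame_def dirs_def offsets_def)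
  next
    case 2
    then show ?thesis using pq by (intro exI[of _ "(0, -1)"] exI[of _ "(-p, -q)"]) (auto simp: g frame_def dirs_def offsets_def)
  next
    case 3
    then show ?thesis using pq by (intro exI[of _ "(1, 0)"] exI[of _ "(-q, p)"]) (auto simp: g frame_def dirs_def offsets_def)
  next
    case 4
    then show ?thesis using pq by (intro exI[of _ "(-1, 0)"] exI[of _ "(q, -p)"]) (auto simp: g frame_def dirs_def offsets_def)
  qed
  then obtain d w where dw: "d \<in> dirs" "w \<in> offsets" "frame a d w = g" by blast
  then have "(a, d, w) \<in> places 0 A" unfolding places_def using a assms by (simp add: laid_def ref_def)
  moreover have "ref (a, d, w) = g" by (simp add: ref_def dw)
  ultimately show ?thesis by blast
qed

lemma place_hm_0: "place_hm 0 A P = harmonic_measure (boundary (fat A)) (ref P)"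
  by (cases P) (simp add: place_hm_def laid_def)

lemma fat_power_sum_le:
  assumes "finite A"
  shows "(\<Sum>g\<in>boundary (fat A). (harmonic_measure (boundary (fat A)) g) ^ n) \<le> (\<Sum>P\<in>places 0 A. (place_hm 0 A P) ^ n)"
proof -
  have "\<forall>g\<in>boundary (fat A). \<exists>P. P \<in> places 0 A \<and> ref P = g" using ex_place by blast
  from bchoice[OF this] obtain \<psi> where
    \<psi>: "\<And>g. g \<in> boundary (fat A) \<Longrightarrow> \<psi> g \<in> places 0 A \<and> ref (\<psi> g) = g" by blast
  have inj: "inj_on \<psi> (boundary (fat A))" by (rule inj_on_inverseI[of _ ref]) (use \<psi> in blast)
  have "(\<Sum>g\<in>boundary (fat A). (harmonic_measure (boundary (fat A)) g) ^ n) = (\<Sum>g\<in>boundary (fat A). (place_hm 0 A (\<psi> g)) ^ n)"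
    using \<psi> by (intro sum.cong) (auto simp: place_hm_0)
  also have "\<dots> = (\<Sum>P\<in>\<psi> ` boundary (fat A). (place_hm 0 A P) ^ n)" using inj by (simp add: sum.reindex)
  also have "\<dots> \<le> (\<Sum>P\<in>places 0 A. (place_hm 0 A P) ^ n)"
    using \<psi> assms by (intro sum_mono2 finite_places zero_le_power place_hm_nonneg) auto
  finally show ?thesis .
qed

lemma place_sum_ge_1:
  assumes "finite A" "A \<noteq> {}"
  shows "1 \<le> (\<Sum>P\<in>places 0 A. place_hm 0 A P)"
proof -
  have "fat A \<noteq> {}" using subset_fat[of A] assms(2) by auto
  then have "(\<Sum>g\<in>boundary (fat A). harmonic_measure (boundary (fat A)) g) = 1"
    using assms by (intro harmonic_measure_sum_1 boundary_nonempty finite_boundary finite_fat)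
  then show ?thesis using fat_power_sum_le[OF assms(1), of 1] by simp
qed

lemma mu_via_fat:
  assumes "finite A" "A \<noteq> {}" "A \<subseteq> A'" "finite A'"
  shows "mu A v = (\<Sum>g\<in>boundary (fat A'). harmonic_measure (boundary (fat A')) g * hit_prob (boundary A) g v)"
  unfolding mu_def using assms subset_fat[of A'] by (intro harmonic_measure_via finite_fat) auto

text \<open>A walker comes to \<open>z\<close> through the boundary of the neighbourhood of \<open>A\<close>. The kernel that takes harmonic
measure there to \<open>\<mu>\<close> has bounded row and column sums, and so it is bounded for sums of cubes
(Schur test).\<close>

lemma schur:
  assumes "finite A" "A \<noteq> {}"
  shows "(\<Sum>z\<in>boundary A. mu A z ^ 3) \<le> collar_bd\<^sup>2 * cube_sum 0 A"
proof -
  let ?G = "boundary (fat A)" and ?m = "harmonic_measure (boundary (fat A))" and ?h = "hit_prob (boundary A)"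
  have fin: "finite ?G" using assms by (intro finite_boundary finite_fat)
  have "mu A z ^ 3 \<le> collar_bd\<^sup>2 * (\<Sum>g\<in>?G. ?m g ^ 3 * ?h g z)" if z: "z \<in> boundary A" for z
  proof -
    have "mu A z ^ 3 \<le> (\<Sum>g\<in>?G. ?h g z)\<^sup>2 * (\<Sum>g\<in>?G. ?m g ^ 3 * ?h g z)"
      using assms unfolding mu_via_fat[OF assms order_refl assms(1)]
      by (intro weighted_power_mean hit_prob_nonneg harmonic_measure_nonneg fin)
    also have "\<dots> \<le> collar_bd\<^sup>2 * (\<Sum>g\<in>?G. ?m g ^ 3 * ?h g z)"
      using assms z fin by (intro mult_right_mono power_mono hit_prob_fat_boundary_sum sum_nonneg
        mult_nonneg_nonneg zero_le_power hit_prob_nonneg harmonic_measure_nonneg) auto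
    finally show ?thesis .
  qed
  then have "(\<Sum>z\<in>boundary A. mu A z ^ 3) \<le> (\<Sum>z\<in>boundary A. collar_bd\<^sup>2 * (\<Sum>g\<in>?G. ?m g ^ 3 * ?h g z))"
    by (rule sum_mono)
  also have "\<dots> = collar_bd\<^sup>2 * (\<Sum>g\<in>?G. ?m g ^ 3 * (\<Sum>z\<in>boundary A. ?h g z))"
    unfolding sum_distrib_left by (subst sum.swap) simp
  also have "\<dots> = collar_bd\<^sup>2 * (\<Sum>g\<in>?G. ?m g ^ 3)"
    using assms by (simp add: hit_prob_sum_1 boundary_nonempty)
  also have "\<dots> \<le> collar_bd\<^sup>2 * cube_sum 0 A"
    unfolding cube_sum_def using assms by (intro mult_left_mono fat_power_sum_le) auto
  finally show ?thesis .
qed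

text \<open>A lower bound for the potential after the step: in the mixture of \<open>mu_via_fat\<close> for the larger cluster
the column sums are bounded, so some weight at stage 0 is comparable to \<open>\<mu>\<close>.\<close>

lemma mu_sq_le_sq_sum:
  assumes "finite A" "A \<noteq> {}" "v \<in> boundary A" "z \<in> boundary A"
  shows "(mu A v)\<^sup>2 \<le> collar_bd\<^sup>2 * sq_sum 0 (insert z A)"
proof -
  let ?A = "insert z A"
  let ?G = "boundary (fat ?A)" and ?m = "harmonic_measure (boundary (fat ?A))" and ?h = "hit_prob (boundary A)"
  have fin: "finite ?G" using assms by (intro finite_boundary finite_fat) auto
  have "?m g \<le> sqrt (sq_sum 0 ?A)" if g: "g \<in> ?G" for g
  proof -
    have "(?m g)\<^sup>2 \<le> (\<Sum>g\<in>?G. (?m g)\<^sup>2)" using g fin by (intro member_le_sum) auto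
    also have "\<dots> \<le> sq_sum 0 ?A" unfolding sq_sum_def using assms by (intro fat_power_sum_le) auto
    finally show ?thesis by (rule real_le_rsqrt)
  qed
  then have "mu A v \<le> (\<Sum>g\<in>?G. sqrt (sq_sum 0 ?A) * ?h g v)"
    unfolding mu_via_fat[OF assms(1,2) subset_insertI[of A z] finite.insertI[OF assms(1)]]
    by (intro sum_mono mult_right_mono hit_prob_nonneg)
  also have "\<dots> = sqrt (sq_sum 0 ?A) * (\<Sum>g\<in>?G. ?h g v)" by (simp add: sum_distrib_left)
  also have "\<dots> \<le> sqrt (sq_sum 0 ?A) * collar_bd"
    using assms by (intro mult_left_mono hit_prob_fat_boundary_sum) (auto simp: sq_sum_nonneg)
  finally have "(mu A v)\<^sup>2 \<le> (sqrt (sq_sum 0 ?A) * collar_bd)\<^sup>2" using mu_nonneg[OF assms(1)] by (intro power_mono)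
  then show ?thesis by (simp add: power_mult_distrib sq_sum_nonneg mult.commute)
qed

lemma reach_row:
  assumes "finite A" "A \<noteq> {}"
  shows "(\<Sum>v\<in>boundary A. reach A z v) \<le> 33\<^sup>2"
proof -
  have "(\<Sum>v\<in>boundary A. reach A z v) = (\<Sum>u\<in>exterior A \<inter> l1_ball z 16. \<Sum>v\<in>boundary A. hit_prob (boundary A) u v)"
    unfolding reach_def by (rule sum.swap)
  also have "\<dots> = real (card (exterior A \<inter> l1_ball z 16))"
    using assms by (simp add: hit_prob_sum_1 boundary_nonempty)
  also have "\<dots> \<le> 33\<^sup>2" by (rule card_l1_ball_le[of 16]) auto
  finally show ?thesis .
qed

lemma reach_row_places:
  assumes "finite A" "A \<noteq> {}" "k < 9"
  shows "(\<Sum>P\<in>places k A. reach A z (target k P)) \<le> 68 * 33\<^sup>2"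
proof -
  have "(\<Sum>P\<in>places k A. reach A z (target k P)) \<le> 68 * (\<Sum>v\<in>boundary A. reach A z v)"
    using assms by (intro sum_target_le reach_nonneg)
  also have "\<dots> \<le> 68 * 33\<^sup>2" using reach_row[OF assms(1,2), of z] by simp
  finally show ?thesis .
qed

lemma reach_column:
  assumes "finite A" "v \<in> boundary A"
  shows "(\<Sum>z\<in>boundary A. reach A z v) \<le> 33\<^sup>2 * collar_bd"
proof -
  let ?h = "\<lambda>u. hit_prob (boundary A) u v"
  have "(\<Sum>z\<in>boundary A. reach A z v) = (\<Sum>z\<in>boundary A. \<Sum>u\<in>{u \<in> collar A 16. u \<in> l1_ball z 16}. ?h u)"
    unfolding reach_def by (intro sum.cong) (auto simp: collar_def)
  also have "\<dots> = (\<Sum>u\<in>collar A 16. \<Sum>z\<in>{z \<in> boundary A. u \<in> l1_ball z 16}. ?h u)"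
    using assms by (intro sum.swap_restrict finite_collar) auto
  also have "\<dots> \<le> 33\<^sup>2 * (\<Sum>u\<in>collar A 16. ?h u)"
  proof (rule sum_related_le)
    show "real (card {z \<in> boundary A. u \<in> l1_ball z 16}) \<le> 33\<^sup>2" for u
      by (rule card_l1_ball_le[of 16 _ u]) (auto simp: l1_ball_sym)
  qed (use assms in \<open>auto simp: finite_collar hit_prob_nonneg\<close>)
  also have "\<dots> \<le> 33\<^sup>2 * collar_bd" using hit_prob_collar_sum[OF assms] by simp
  finally show ?thesis .
qed

lemma mu_near_cube_sum:
  assumes "finite A"
  shows "(\<Sum>z\<in>boundary A. mu_near A z ^ 3) \<le> (33\<^sup>2) ^ 3 * (\<Sum>z\<in>boundary A. mu A z ^ 3)"
proof -
  have "mu_near A z ^ 3 \<le> (33\<^sup>2)\<^sup>2 * (\<Sum>b\<in>{b \<in> boundary A. b \<in> l1_ball z 16}. mu A b ^ 3)" for z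
  proof -
    let ?S = "{b \<in> boundary A. b \<in> l1_ball z 16}"
    have S: "boundary A \<inter> l1_ball z 16 = ?S" by auto
    have "(\<Sum>b\<in>?S. mu A b * 1) ^ 3 \<le> (\<Sum>b\<in>?S. 1)\<^sup>2 * (\<Sum>b\<in>?S. mu A b ^ 3 * 1)"
      using assms by (intro weighted_power_mean) (auto simp: mu_nonneg)
    then have "mu_near A z ^ 3 \<le> (real (card ?S))\<^sup>2 * (\<Sum>b\<in>?S. mu A b ^ 3)" by (simp add: mu_near_def S)
    also have "\<dots> \<le> (33\<^sup>2)\<^sup>2 * (\<Sum>b\<in>?S. mu A b ^ 3)"
      using assms by (intro mult_right_mono power_mono card_l1_ball_le[of 16 _ z] sum_nonneg) (auto simp: mu_nonneg)
    finally show ?thesis .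
  qed
  then have "(\<Sum>z\<in>boundary A. mu_near A z ^ 3) \<le> (\<Sum>z\<in>boundary A. (33\<^sup>2)\<^sup>2 * (\<Sum>b\<in>{b \<in> boundary A. b \<in> l1_ball z 16}. mu A b ^ 3))"
    by (rule sum_mono)
  also have "\<dots> = (33\<^sup>2)\<^sup>2 * (\<Sum>b\<in>boundary A. \<Sum>z\<in>{z \<in> boundary A. b \<in> l1_ball z 16}. mu A b ^ 3)"
    unfolding sum_distrib_left[symmetric] using assms by (subst sum.swap_restrict) auto
  also have "\<dots> \<le> (33\<^sup>2)\<^sup>2 * (33\<^sup>2 * (\<Sum>b\<in>boundary A. mu A b ^ 3))"
  proof (intro mult_left_mono sum_related_le)
    show "real (card {z \<in> boundary A. u \<in> l1_ball z 16}) \<le> 33\<^sup>2" for u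
      by (rule card_l1_ball_le[of 16 _ u]) (auto simp: l1_ball_sym)
  qed (use assms in \<open>auto simp: mu_nonneg\<close>)
  finally show ?thesis by (simp add: mult_ac)
qed

section \<open>Expected losses\<close>

text \<open>Particles attached in the ball of a place. For a given particle there are boundedly many such places
and vice versa, so \<open>\<mu> e\<^sup>2 \<le> \<epsilon> \<mu>\<^sup>3 + e\<^sup>3 / \<epsilon>\<^sup>2\<close> can be summed.\<close>

lemma expected_near_loss:
  assumes "finite A" "k < 9" "0 < \<epsilon>" "\<epsilon> \<le> 1"
  shows "(\<Sum>z\<in>boundary A. mu A z * (\<Sum>P\<in>{P\<in>places k A. ref P \<in> l1_ball z 15}. (place_hm k A P)\<^sup>2))
     \<le> 68 * 33\<^sup>2 * (\<epsilon> * (\<Sum>z\<in>boundary A. mu A z ^ 3)) + 33\<^sup>2 * (cube_sum k A / \<epsilon>\<^sup>2)"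
proof -
  let ?e = "place_hm k A"
  let ?R = "\<lambda>z. {P\<in>places k A. ref P \<in> l1_ball z 15}"
  have fin: "finite (boundary A)" "finite (places k A)" using assms by (auto simp: finite_places)
  have "(\<Sum>z\<in>boundary A. mu A z * (\<Sum>P\<in>?R z. (?e P)\<^sup>2)) = (\<Sum>z\<in>boundary A. \<Sum>P\<in>?R z. mu A z * (?e P)\<^sup>2)"
    by (simp add: sum_distrib_left)
  also have "\<dots> \<le> (\<Sum>z\<in>boundary A. \<Sum>P\<in>?R z. \<epsilon> * mu A z ^ 3 + ?e P ^ 3 / \<epsilon>\<^sup>2)"
    using assms by (intro sum_mono young_12 mu_nonneg place_hm_nonneg)
  also have "\<dots> = (\<Sum>z\<in>boundary A. \<Sum>P\<in>?R z. \<epsilon> * mu A z ^ 3) + (\<Sum>z\<in>boundary A. \<Sum>P\<in>?R z. ?e P ^ 3 / \<epsilon>\<^sup>2)"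
    by (simp only: sum.distrib)
  also have "(\<Sum>z\<in>boundary A. \<Sum>P\<in>?R z. ?e P ^ 3 / \<epsilon>\<^sup>2) = (\<Sum>P\<in>places k A. \<Sum>z\<in>{z\<in>boundary A. ref P \<in> l1_ball z 15}. ?e P ^ 3 / \<epsilon>\<^sup>2)"
    using fin by (rule sum.swap_restrict)
  also have "(\<Sum>z\<in>boundary A. \<Sum>P\<in>?R z. \<epsilon> * mu A z ^ 3) \<le> 68 * 33\<^sup>2 * (\<Sum>z\<in>boundary A. \<epsilon> * mu A z ^ 3)"
  proof (rule sum_related_le)
    show "real (card (?R z)) \<le> 68 * 33\<^sup>2" for z
      using of_nat_mono[OF card_places_ref[of k A z], where 'a = real] by simp
  qed (use assms fin in \<open>auto simp: mu_nonneg\<close>)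
  also have "(\<Sum>P\<in>places k A. \<Sum>z\<in>{z\<in>boundary A. ref P \<in> l1_ball z 15}. ?e P ^ 3 / \<epsilon>\<^sup>2) \<le> 33\<^sup>2 * (\<Sum>P\<in>places k A. ?e P ^ 3 / \<epsilon>\<^sup>2)"
  proof (rule sum_related_le)
    show "real (card {z\<in>boundary A. ref P \<in> l1_ball z 15}) \<le> 33\<^sup>2" for P
      by (rule card_l1_ball_le[of 15 _ "ref P"]) (auto simp: l1_ball_sym)
  qed (use assms fin in \<open>auto simp: place_hm_nonneg\<close>)
  finally show ?thesis by (simp add: cube_sum_def sum_distrib_left sum_divide_distrib)
qed

text \<open>Screening. Young's inequality for \<open>\<mu>\<^sup>2 e\<close> is summed against the kernel \<open>reach\<close>, by its row sums for the
term with \<open>\<mu>\<^sup>3\<close> and by its column sums for the one with \<open>e\<^sup>3\<close>.\<close>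

lemma expected_far_loss:
  assumes "finite A" "A \<noteq> {}" "k < 9" "0 < \<epsilon>"
  shows "(\<Sum>z\<in>boundary A. mu A z * (\<Sum>P\<in>places k A. place_hm k A P * mu_near A z * reach A z (target k P)))
     \<le> 68 * 33\<^sup>2 * (\<epsilon> * (\<Sum>z\<in>boundary A. mu_near A z ^ 3)) + 33\<^sup>2 * collar_bd * (cube_sum k A / \<epsilon>\<^sup>2)"
proof -
  let ?e = "place_hm k A" and ?h = "\<lambda>z P. reach A z (target k P)"
  have fin: "finite (boundary A)" "finite (places k A)" using assms by (auto simp: finite_places)
  have summand: "mu A z * (?e P * mu_near A z * ?h z P) \<le> \<epsilon> * mu_near A z ^ 3 * ?h z P + ?e P ^ 3 / \<epsilon>\<^sup>2 * ?h z P"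
    if "z \<in> boundary A" for z P
  proof -
    have nn: "0 \<le> ?e P" "0 \<le> mu_near A z" "0 \<le> ?h z P"
      using assms by (auto simp: place_hm_nonneg mu_near_nonneg reach_nonneg)
    have "mu A z * (?e P * mu_near A z * ?h z P) \<le> mu_near A z * (?e P * mu_near A z * ?h z P)"
      using nn that assms by (intro mult_right_mono mu_le_near mult_nonneg_nonneg) auto
    also have "\<dots> = ((mu_near A z)\<^sup>2 * ?e P) * ?h z P" by (simp add: power2_eq_square mult_ac)
    also have "\<dots> \<le> (\<epsilon> * mu_near A z ^ 3 + ?e P ^ 3 / \<epsilon>\<^sup>2) * ?h z P"
      using nn assms by (intro mult_right_mono young_21) auto
    finally show ?thesis by (simp add: distrib_right)
  qed
  have "(\<Sum>z\<in>boundary A. mu A z * (\<Sum>P\<in>places k A. ?e P * mu_near A z * ?h z P))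
      = (\<Sum>z\<in>boundary A. \<Sum>P\<in>places k A. mu A z * (?e P * mu_near A z * ?h z P))"
    by (simp add: sum_distrib_left)
  also have "\<dots> \<le> (\<Sum>z\<in>boundary A. \<Sum>P\<in>places k A. \<epsilon> * mu_near A z ^ 3 * ?h z P + ?e P ^ 3 / \<epsilon>\<^sup>2 * ?h z P)"
    by (intro sum_mono summand)
  also have "\<dots> = (\<Sum>z\<in>boundary A. \<Sum>P\<in>places k A. \<epsilon> * mu_near A z ^ 3 * ?h z P)
      + (\<Sum>z\<in>boundary A. \<Sum>P\<in>places k A. ?e P ^ 3 / \<epsilon>\<^sup>2 * ?h z P)"
    by (simp only: sum.distrib)
  also have "(\<Sum>z\<in>boundary A. \<Sum>P\<in>places k A. ?e P ^ 3 / \<epsilon>\<^sup>2 * ?h z P) = (\<Sum>P\<in>places k A. ?e P ^ 3 / \<epsilon>\<^sup>2 * (\<Sum>z\<in>boundary A. ?h z P))"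
    unfolding sum_distrib_left by (rule sum.swap)
  also have "\<dots> \<le> (\<Sum>P\<in>places k A. ?e P ^ 3 / \<epsilon>\<^sup>2 * (33\<^sup>2 * collar_bd))"
  proof (intro sum_mono mult_left_mono)
    fix P assume "P \<in> places k A"
    then show "(\<Sum>z\<in>boundary A. ?h z P) \<le> 33\<^sup>2 * collar_bd"
      using assms by (intro reach_column placed.target_boundary[OF placed_intro])
  qed (use assms in \<open>auto simp: place_hm_nonneg\<close>)
  also have "\<dots> = 33\<^sup>2 * collar_bd * (cube_sum k A / \<epsilon>\<^sup>2)"
    by (simp add: cube_sum_def sum_distrib_left sum_divide_distrib mult_ac)
  also have "(\<Sum>z\<in>boundary A. \<Sum>P\<in>places k A. \<epsilon> * mu_near A z ^ 3 * ?h z P) = (\<Sum>z\<in>boundary A. \<epsilon> * mu_near A z ^ 3 * (\<Sum>P\<in>places k A. ?h z P))"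
    by (simp add: sum_distrib_left)
  also have "\<dots> \<le> (\<Sum>z\<in>boundary A. \<epsilon> * mu_near A z ^ 3 * (68 * 33\<^sup>2))"
    using assms by (intro sum_mono mult_left_mono reach_row_places) (auto simp: mu_near_nonneg)
  also have "\<dots> = 68 * 33\<^sup>2 * (\<epsilon> * (\<Sum>z\<in>boundary A. mu_near A z ^ 3))"
    unfolding sum_distrib_right[symmetric] by (simp add: sum_distrib_left[symmetric] mult_ac)
  finally show ?thesis by simp
qed

text \<open>At every stage the small factor \<open>\<epsilon>\<close> goes with the cubes of \<open>\<mu>\<close>, which \<open>schur\<close> converts into stage 0.\<close>

lemma expected_loss:
  "\<exists>C\<ge>1. \<forall>A k \<epsilon>. finite A \<longrightarrow> A \<noteq> {} \<longrightarrow> k < 9 \<longrightarrow> 0 < \<epsilon> \<longrightarrow> \<epsilon> \<le> 1 \<longrightarrow>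
     (\<Sum>z\<in>boundary A. mu A z * loss k A z) \<le> C * (\<epsilon> * cube_sum 0 A + cube_sum k A / \<epsilon>\<^sup>2)"
proof -
  define h where "h = harnack\<^sup>2"
  define N where "N = (68 * 33\<^sup>2 :: real)"
  have h: "0 \<le> h" "0 \<le> N" by (simp_all add: h_def N_def)
  have col: "1 \<le> collar_bd" by (rule collar_const_ge_1)
  define C1 where "C1 = N * collar_bd\<^sup>2 + 2 * h * (N * ((33\<^sup>2) ^ 3 * collar_bd\<^sup>2))"
  define C2 where "C2 = 33\<^sup>2 + 2 * h * (33\<^sup>2 * collar_bd)"
  have C: "0 \<le> C1" "1 \<le> C2"
  proof -
    show "0 \<le> C1" using h col unfolding C1_def by (intro add_nonneg_nonneg mult_nonneg_nonneg) auto
    have "0 \<le> 2 * h * (33\<^sup>2 * collar_bd)" using h col by (intro mult_nonneg_nonneg) auto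
    moreover have "(1::real) \<le> 33\<^sup>2" by simp
    ultimately show "1 \<le> C2" unfolding C2_def by linarith
  qed
  have main: "(\<Sum>z\<in>boundary A. mu A z * loss k A z) \<le> (C1 + C2) * (\<epsilon> * cube_sum 0 A + cube_sum k A / \<epsilon>\<^sup>2)"
    if A: "finite A" "A \<noteq> {}" and k: "k < 9" and \<epsilon>: "0 < \<epsilon>" "\<epsilon> \<le> 1" for A k \<epsilon>
  proof -
    define near where "near z = (\<Sum>P\<in>{P\<in>places k A. ref P \<in> l1_ball z 15}. (place_hm k A P)\<^sup>2)" for z
    define far where "far z = (\<Sum>P\<in>places k A. place_hm k A P * mu_near A z * reach A z (target k P))" for z
    define S where "S = (\<Sum>z\<in>boundary A. mu A z ^ 3)"
    have S: "S \<le> collar_bd\<^sup>2 * cube_sum 0 A" unfolding S_def by (rule schur[OF A])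
    have l: "loss k A z \<le> near z + 2 * h * far z" if "z \<in> boundary A" for z
      using loss_le[OF A(1) k that] by (simp add: near_def far_def h_def sum_distrib_left)
    have "(\<Sum>z\<in>boundary A. mu A z * loss k A z) \<le> (\<Sum>z\<in>boundary A. mu A z * (near z + 2 * h * far z))"
      using A l by (intro sum_mono mult_left_mono mu_nonneg)
    also have "\<dots> = (\<Sum>z\<in>boundary A. mu A z * near z) + 2 * h * (\<Sum>z\<in>boundary A. mu A z * far z)"
      by (simp add: distrib_left sum.distrib sum_distrib_left mult_ac)
    finally have start: "(\<Sum>z\<in>boundary A. mu A z * loss k A z)
        \<le> (\<Sum>z\<in>boundary A. mu A z * near z) + 2 * h * (\<Sum>z\<in>boundary A. mu A z * far z)" .
    have near: "(\<Sum>z\<in>boundary A. mu A z * near z) \<le> N * (\<epsilon> * S) + 33\<^sup>2 * (cube_sum k A / \<epsilon>\<^sup>2)"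
      unfolding near_def N_def S_def by (rule expected_near_loss[OF A(1) k \<epsilon>])
    have far: "(\<Sum>z\<in>boundary A. mu A z * far z) \<le> N * (\<epsilon> * (\<Sum>z\<in>boundary A. mu_near A z ^ 3)) + 33\<^sup>2 * collar_bd * (cube_sum k A / \<epsilon>\<^sup>2)"
      unfolding far_def N_def by (rule expected_far_loss[OF A k \<epsilon>(1)])
    have "(\<Sum>z\<in>boundary A. mu_near A z ^ 3) \<le> (33\<^sup>2) ^ 3 * S"
      unfolding S_def by (rule mu_near_cube_sum[OF A(1)])
    also have "\<dots> \<le> (33\<^sup>2) ^ 3 * (collar_bd\<^sup>2 * cube_sum 0 A)" by (intro mult_left_mono S) simp
    finally have "N * (\<epsilon> * (\<Sum>z\<in>boundary A. mu_near A z ^ 3)) \<le> N * (\<epsilon> * ((33\<^sup>2) ^ 3 * (collar_bd\<^sup>2 * cube_sum 0 A)))"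
      using h \<epsilon> by (intro mult_left_mono) auto
    with far have "(\<Sum>z\<in>boundary A. mu A z * far z) \<le> N * (\<epsilon> * ((33\<^sup>2) ^ 3 * (collar_bd\<^sup>2 * cube_sum 0 A))) + 33\<^sup>2 * collar_bd * (cube_sum k A / \<epsilon>\<^sup>2)"
      by linarith
    then have far': "2 * h * (\<Sum>z\<in>boundary A. mu A z * far z)
        \<le> 2 * h * (N * (\<epsilon> * ((33\<^sup>2) ^ 3 * (collar_bd\<^sup>2 * cube_sum 0 A))) + 33\<^sup>2 * collar_bd * (cube_sum k A / \<epsilon>\<^sup>2))"
      using h by (intro mult_left_mono) auto
    have "N * (\<epsilon> * S) \<le> N * (\<epsilon> * (collar_bd\<^sup>2 * cube_sum 0 A))"
      using h \<epsilon> S by (intro mult_left_mono) auto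
    then have "(\<Sum>z\<in>boundary A. mu A z * loss k A z) \<le>
       N * (\<epsilon> * (collar_bd\<^sup>2 * cube_sum 0 A)) + 33\<^sup>2 * (cube_sum k A / \<epsilon>\<^sup>2)
       + 2 * h * (N * (\<epsilon> * ((33\<^sup>2) ^ 3 * (collar_bd\<^sup>2 * cube_sum 0 A))) + 33\<^sup>2 * collar_bd * (cube_sum k A / \<epsilon>\<^sup>2))"
      using start near far' by linarith
    also have "\<dots> = C1 * (\<epsilon> * cube_sum 0 A) + C2 * (cube_sum k A / \<epsilon>\<^sup>2)"
      unfolding C1_def C2_def by (simp only: distrib_left distrib_right mult_ac)
    also have "\<dots> \<le> (C1 + C2) * (\<epsilon> * cube_sum 0 A) + (C1 + C2) * (cube_sum k A / \<epsilon>\<^sup>2)"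
      using C \<epsilon> A by (intro add_mono mult_right_mono) (auto simp: cube_sum_nonneg)
    finally show ?thesis by (simp add: distrib_left)
  qed
  show ?thesis using C main by (intro exI[of _ "C1 + C2"]) auto
qed

lemma place_hm_sq_le:
  assumes "finite A" "A \<noteq> {}" "k < 9" "z \<in> boundary A" "P \<in> places k A"
  shows "(place_hm k A P)\<^sup>2 \<le> harnack\<^sup>2 * (collar_bd\<^sup>2 * sq_sum 0 (insert z A))"
proof -
  have "(place_hm k A P)\<^sup>2 \<le> (harnack * mu A (target k P))\<^sup>2"
    using placed.place_hm_le[OF placed_intro[OF assms(1,3,5)]] assms
    by (intro power_mono place_hm_nonneg) (auto simp: mu_def)
  also have "\<dots> \<le> harnack\<^sup>2 * (collar_bd\<^sup>2 * sq_sum 0 (insert z A))"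
    unfolding power_mult_distrib using assms
    by (intro mult_left_mono mu_sq_le_sq_sum placed.target_boundary[OF placed_intro]) auto
  finally show ?thesis .
qed

lemma mu_near_sq_le:
  assumes "finite A" "A \<noteq> {}" "z \<in> boundary A"
  shows "(mu_near A z)\<^sup>2 \<le> (33\<^sup>2)\<^sup>2 * (collar_bd\<^sup>2 * sq_sum 0 (insert z A))"
proof -
  let ?s = "sqrt (collar_bd\<^sup>2 * sq_sum 0 (insert z A))"
  have nn: "0 \<le> collar_bd\<^sup>2 * sq_sum 0 (insert z A)" by (simp add: sq_sum_nonneg)
  have "mu A b \<le> ?s" if "b \<in> boundary A" for b
    using mu_sq_le_sq_sum[OF assms(1,2) that assms(3)] by (rule real_le_rsqrt)
  then have "mu_near A z \<le> (\<Sum>b\<in>boundary A \<inter> l1_ball z 16. ?s)" unfolding mu_near_def by (intro sum_mono) auto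
  also have "\<dots> = real (card (boundary A \<inter> l1_ball z 16)) * ?s" by simp
  also have "\<dots> \<le> 33\<^sup>2 * ?s" using nn by (intro mult_right_mono card_l1_ball_le[of 16 _ z]) auto
  finally have "(mu_near A z)\<^sup>2 \<le> (33\<^sup>2 * ?s)\<^sup>2" using assms by (intro power_mono mu_near_nonneg)
  then show ?thesis using nn by (simp only: power_mult_distrib real_sqrt_pow2)
qed

lemma reach_le:
  assumes "finite A" "A \<noteq> {}"
  shows "reach A z v \<le> 33\<^sup>2"
proof -
  have "reach A z v \<le> (\<Sum>u\<in>exterior A \<inter> l1_ball z 16. 1)"
    unfolding reach_def by (intro sum_mono hit_prob_le_1)
  also have "\<dots> \<le> 33\<^sup>2" using card_l1_ball_le[of 16 "exterior A \<inter> l1_ball z 16" z] by simp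
  finally show ?thesis .
qed

text \<open>For a single particle: it can destroy more than half of \<open>sq_sum k\<close> only if its surroundings carry so much
harmonic measure that stage 0 is large afterwards. This keeps \<open>ln Z\<close> from dropping too far.\<close>

lemma loss_half:
  "\<exists>C\<ge>1. \<forall>A k z. finite A \<longrightarrow> A \<noteq> {} \<longrightarrow> k < 9 \<longrightarrow> z \<in> boundary A \<longrightarrow>
     loss k A z \<le> sq_sum k A / 2 + C * sq_sum 0 (insert z A)"
proof -
  define h where "h = harnack\<^sup>2"
  define n where "n = (33\<^sup>2 :: real)"
  have h: "0 \<le> h" "0 < n" by (simp_all add: h_def n_def)
  define C where "C = 1 + (68 * n * (h * collar_bd\<^sup>2) + 68 * n * (2 * n * h\<^sup>2 * (n\<^sup>2 * collar_bd\<^sup>2)))"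
  have C: "1 \<le> C" unfolding C_def using h by simp
  have "loss k A z \<le> sq_sum k A / 2 + C * sq_sum 0 (insert z A)"
    if A: "finite A" "A \<noteq> {}" and k: "k < 9" and z: "z \<in> boundary A" for A k z
  proof -
    let ?W = "sq_sum 0 (insert z A)" and ?e = "place_hm k A" and ?r = "\<lambda>P. reach A z (target k P)" and ?M = "mu_near A z"
    have fin: "finite (places k A)" by (rule finite_places[OF A(1)])
    have W: "0 \<le> ?W" by (rule sq_sum_nonneg)
    have "(\<Sum>P\<in>{P\<in>places k A. ref P \<in> l1_ball z 15}. (?e P)\<^sup>2) \<le> (\<Sum>P\<in>{P\<in>places k A. ref P \<in> l1_ball z 15}. h * (collar_bd\<^sup>2 * ?W))"
      unfolding h_def using A k z by (intro sum_mono place_hm_sq_le) auto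
    also have "\<dots> = real (card {P\<in>places k A. ref P \<in> l1_ball z 15}) * (h * (collar_bd\<^sup>2 * ?W))" by simp
    also have "\<dots> \<le> 68 * n * (h * (collar_bd\<^sup>2 * ?W))"
      using of_nat_mono[OF card_places_ref[of k A z], where 'a = real] h W
      by (intro mult_right_mono mult_nonneg_nonneg) (auto simp: n_def)
    finally have near: "(\<Sum>P\<in>{P\<in>places k A. ref P \<in> l1_ball z 15}. (?e P)\<^sup>2) \<le> 68 * n * (h * (collar_bd\<^sup>2 * ?W))" .
    have summand: "2 * h * (?e P * ?M * ?r P) \<le> (?e P)\<^sup>2 / 2 + ?r P * (2 * n * h\<^sup>2 * ?M\<^sup>2)" for P
    proof -
      have r: "0 \<le> ?r P" "?r P \<le> n" using reach_nonneg reach_le[OF A] by (auto simp: n_def)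
      \<comment> \<open>the factor \<open>2 n\<close> leaves half of \<open>e\<^sup>2\<close> after multiplication by \<open>reach \<le> n\<close>\<close>
      have "0 \<le> (?e P - 2 * n * h * ?M)\<^sup>2" by simp
      then have "2 * h * ?e P * ?M * (2 * n) \<le> (?e P)\<^sup>2 + (2 * n * h * ?M)\<^sup>2"
        by (simp add: power2_diff algebra_simps)
      then have "2 * h * ?e P * ?M \<le> ((?e P)\<^sup>2 + (2 * n * h * ?M)\<^sup>2) / (2 * n)"
        using h by (simp add: pos_le_divide_eq)
      also have "\<dots> = (?e P)\<^sup>2 / (2 * n) + 2 * n * h\<^sup>2 * ?M\<^sup>2"
        using h by (simp add: add_divide_distrib power2_eq_square)
      finally have "?r P * (2 * h * ?e P * ?M) \<le> ?r P * ((?e P)\<^sup>2 / (2 * n) + 2 * n * h\<^sup>2 * ?M\<^sup>2)"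
        using r by (intro mult_left_mono)
      also have "\<dots> = ?r P * ((?e P)\<^sup>2 / (2 * n)) + ?r P * (2 * n * h\<^sup>2 * ?M\<^sup>2)" by (rule distrib_left)
      also have "?r P * ((?e P)\<^sup>2 / (2 * n)) \<le> n * ((?e P)\<^sup>2 / (2 * n))"
        using r h by (intro mult_right_mono) auto
      also have "\<dots> = (?e P)\<^sup>2 / 2" using h by simp
      finally show ?thesis by (simp add: mult_ac)
    qed
    have "(\<Sum>P\<in>places k A. 2 * h * (?e P * ?M * ?r P)) \<le> (\<Sum>P\<in>places k A. (?e P)\<^sup>2 / 2 + ?r P * (2 * n * h\<^sup>2 * ?M\<^sup>2))"
      by (intro sum_mono summand)
    also have "\<dots> = sq_sum k A / 2 + (\<Sum>P\<in>places k A. ?r P) * (2 * n * h\<^sup>2 * ?M\<^sup>2)"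
      by (simp add: sum.distrib sq_sum_def sum_divide_distrib sum_distrib_right)
    also have "\<dots> \<le> sq_sum k A / 2 + 68 * n * (2 * n * h\<^sup>2 * (n\<^sup>2 * (collar_bd\<^sup>2 * ?W)))"
      using h reach_row_places[OF A k, of z] mu_near_sq_le[OF A z]
      by (intro add_left_mono mult_mono mult_left_mono mult_nonneg_nonneg) (auto simp: n_def)
    finally have far: "(\<Sum>P\<in>places k A. 2 * h * (?e P * ?M * ?r P)) \<le> sq_sum k A / 2 + 68 * n * (2 * n * h\<^sup>2 * (n\<^sup>2 * (collar_bd\<^sup>2 * ?W)))" .
    have "loss k A z \<le> 68 * n * (h * (collar_bd\<^sup>2 * ?W)) + (sq_sum k A / 2 + 68 * n * (2 * n * h\<^sup>2 * (n\<^sup>2 * (collar_bd\<^sup>2 * ?W))))"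
      using loss_le[OF A(1) k z] near far unfolding h_def by linarith
    also have "\<dots> = sq_sum k A / 2 + (C - 1) * ?W"
      unfolding C_def by (simp add: distrib_left distrib_right mult_ac)
    also have "\<dots> \<le> sq_sum k A / 2 + C * ?W" using W by (intro add_left_mono mult_right_mono) auto
    finally show ?thesis .
  qed
  then show ?thesis using C by (intro exI[of _ C]) auto
qed

lemma sq_sum_le:
  assumes "finite A" "A \<noteq> {}" "k < 9"
  shows "sq_sum k A \<le> 68 * harnack"
proof -
  have "sq_sum k A \<le> (\<Sum>P\<in>places k A. harnack * mu A (target k P))"
    unfolding sq_sum_def
  proof (intro sum_mono)
    fix P assume P: "P \<in> places k A"
    have "(place_hm k A P)\<^sup>2 \<le> place_hm k A P * 1" unfolding power2_eq_square
      using assms by (intro mult_left_mono place_hm_le_1 place_hm_nonneg)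
    also have "\<dots> \<le> harnack * mu A (target k P)"
      using placed.place_hm_le[OF placed_intro[OF assms(1,3) P]] by (simp add: mu_def)
    finally show "(place_hm k A P)\<^sup>2 \<le> harnack * mu A (target k P)" .
  qed
  also have "\<dots> \<le> 68 * (\<Sum>z\<in>boundary A. harnack * mu A z)"
    using assms by (intro sum_target_le mult_nonneg_nonneg mu_nonneg less_imp_le[OF harnack_pos])
  also have "(\<Sum>z\<in>boundary A. harnack * mu A z) = harnack"
    unfolding sum_distrib_left[symmetric] mu_def using assms
    by (simp add: harmonic_measure_sum_1 boundary_nonempty)
  finally show ?thesis by simp
qed

text \<open>The sum on the right is the probability that this step completes the plan at some place.\<close>

lemma closing_hazard:
  assumes "finite A"
  shows "(\<Sum>P\<in>places 8 A. place_hm 8 A P) \<le> 68 * harnack * (\<Sum>z\<in>target 8 ` places 8 A. mu A z)"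
proof -
  have "(\<Sum>P\<in>places 8 A. place_hm 8 A P) \<le> (\<Sum>P\<in>places 8 A. harnack * mu A (target 8 P))"
    using placed.place_hm_le[OF placed_intro[OF assms, of 8]] by (intro sum_mono) (auto simp: mu_def)
  also have "\<dots> \<le> 68 * (\<Sum>z\<in>target 8 ` places 8 A. harnack * mu A z)"
  proof (rule sum_fibers_le)
    show "real (card {P \<in> places 8 A. target 8 P = v}) \<le> 68" for v
      using card_places_target[of 8 A v] by simp
  qed (use assms in \<open>auto simp: finite_places mu_nonneg less_imp_le\<close>)
  finally show ?thesis by (simp add: sum_distrib_left mult_ac)
qed

section \<open>The Lyapunov function\<close>

lemma ln_concave_step:
  assumes "0 \<le> x" "x \<le> 1" "0 \<le> (G::real)"
  shows "x * ln (1 + G) \<le> ln (1 + G * x)"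
proof -
  have "(1 - x) * ln 1 + x * ln (1 + G) \<le> ln ((1 - x) * 1 + x * (1 + G))"
    using concave_onD[OF ln_concave, of x 1 "1 + G"] assms by (simp add: scaleR_conv_of_real)
  also have "(1 - x) * 1 + x * (1 + G) = 1 + G * x" by (simp add: algebra_simps)
  finally show ?thesis by simp
qed

text \<open>One step of the chain, seen from \<open>Z = \<Sum> \<kappa> k v k\<close>; primes mark the values after the step. If the losses
make up less than half of \<open>Z\<close>, then \<open>Z' / Z \<ge> (1 + G / Z) (1 - L / Z)\<close>. Otherwise a single stage \<open>k\<close> accounts
for a fixed share of \<open>Z\<close> as loss, and \<open>half\<close> shows that \<open>Z'\<close> is still at least \<open>Z / (72 C \<kappa> k)\<close>. The cost of this
is charged to the loss at stage \<open>k\<close>; it matters later that it depends on \<open>\<kappa> k\<close> and not on the larger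
weights of later stages.\<close>

lemma ln_potential_step:
  fixes \<kappa> v v' l g :: "nat \<Rightarrow> real"
  assumes \<kappa>: "\<kappa> 0 = 1" "\<And>k. 1 \<le> \<kappa> k" and C: "1 \<le> C"
    and nn: "\<And>k. 0 \<le> v k" "\<And>k. 0 \<le> v' k" "\<And>k. 0 \<le> l k" "\<And>k. 0 \<le> g k"
    and l_le: "\<And>k. l k \<le> v k"
    and half: "\<And>k. k < 9 \<Longrightarrow> l k \<le> v k / 2 + C * v' 0"
    and step0: "v 0 - l 0 \<le> v' 0"
    and step: "\<And>k. k < 8 \<Longrightarrow> v (Suc k) - l (Suc k) + g k \<le> v' (Suc k)"
    and Z: "Z = (\<Sum>k<9. \<kappa> k * v k)" "0 < Z" and Z': "Z' = (\<Sum>k<9. \<kappa> k * v' k)"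
    and G: "G = (\<Sum>k<8. \<kappa> (Suc k) * g k)"
  shows "0 < Z'" "ln (1 + G / Z) - (\<Sum>k<9. 36 * ln (72 * C * \<kappa> k) * \<kappa> k * l k) / Z \<le> ln Z' - ln Z"
proof -
  define L where "L = (\<Sum>k<9. \<kappa> k * l k)"
  define \<Lambda> where "\<Lambda> k = ln (72 * C * \<kappa> k)" for k
  define B where "B = (\<Sum>k<9. 36 * \<Lambda> k * \<kappa> k * l k) / Z"
  have \<kappa>0: "0 \<le> \<kappa> k" for k using \<kappa>(2)[of k] by linarith
  have big: "72 \<le> 72 * C * \<kappa> k" for k
    using mult_mono[OF C \<kappa>(2)[of k]] C \<kappa>0[of k] by simp
  have \<Lambda>: "1 \<le> \<Lambda> k" "ln 2 \<le> \<Lambda> k" for k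
  proof -
    have "exp 1 \<le> 72 * C * \<kappa> k" using big[of k] exp_le by linarith
    then show "1 \<le> \<Lambda> k" unfolding \<Lambda>_def using big[of k] by (subst ln_ge_iff) auto
    show "ln 2 \<le> \<Lambda> k" unfolding \<Lambda>_def using big[of k] by (intro ln_mono) auto
  qed
  have nn': "0 \<le> 36 * \<Lambda> k * \<kappa> k * l k" for k
    using \<Lambda>(1)[of k] \<kappa>0[of k] nn(3)[of k] by simp
  have G0: "0 \<le> G" unfolding G using \<kappa>0 nn by (intro sum_nonneg mult_nonneg_nonneg)
  have L0: "0 \<le> L" unfolding L_def using \<kappa>0 nn by (intro sum_nonneg mult_nonneg_nonneg)
  have LZ: "L \<le> Z" unfolding L_def Z using l_le \<kappa>0 by (intro sum_mono mult_left_mono)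
  have low: "Z - L + G \<le> Z'"
  proof -
    have split: "(\<Sum>k<9. f k) = f 0 + (\<Sum>k<8. f (Suc k))" for f :: "nat \<Rightarrow> real"
      using sum.lessThan_Suc_shift[of f 8] by simp
    have "Z - L + G = \<kappa> 0 * (v 0 - l 0) + (\<Sum>k<8. \<kappa> (Suc k) * (v (Suc k) - l (Suc k) + g k))"
      unfolding Z L_def G split by (simp add: algebra_simps sum.distrib sum_subtractf)
    also have "\<dots> \<le> \<kappa> 0 * v' 0 + (\<Sum>k<8. \<kappa> (Suc k) * v' (Suc k))"
      using step0 step \<kappa>0 by (intro add_mono mult_left_mono sum_mono) auto
    finally show ?thesis unfolding Z' split .
  qed
  have member: "\<kappa> k * v' k \<le> Z'" if "k < 9" for k
    unfolding Z' using that \<kappa>0 nn by (intro member_le_sum) auto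
  have B_ge: "36 * \<Lambda> k * (\<kappa> k * l k) / Z \<le> B" if "k < 9" for k
  proof -
    have "36 * \<Lambda> k * \<kappa> k * l k \<le> (\<Sum>k<9. 36 * \<Lambda> k * \<kappa> k * l k)"
      using that nn' by (intro member_le_sum) auto
    then show ?thesis unfolding B_def using Z(2) by (intro divide_right_mono) (auto simp: mult.assoc)
  qed
  have "0 < Z' \<and> ln (1 + G / Z) - B \<le> ln Z' - ln Z"
  proof (cases "L \<le> Z / 2")
    case True
    define x where "x = L / Z"
    have x: "0 \<le> x" "x \<le> 1 / 2" using True L0 Z(2) by (auto simp: x_def field_simps)
    have pos: "0 < Z'" using low True G0 Z(2) by linarith
    have "(1 + G / Z) * (1 - x) * Z \<le> Z'"
    proof -
      have "(1 + G / Z) * (1 - x) \<le> 1 - x + G / Z"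
      proof -
        define q where "q = G / Z"
        have "0 \<le> q * x" using x G0 Z(2) by (auto simp: q_def)
        then have "(1 + q) * (1 - x) \<le> 1 - x + q" by (simp add: algebra_simps)
        then show ?thesis by (simp add: q_def)
      qed
      then have "(1 + G / Z) * (1 - x) * Z \<le> (1 - x + G / Z) * Z" using Z(2) by (intro mult_right_mono) auto
      also have "\<dots> = Z - L + G" using Z(2) by (simp add: x_def field_simps)
      finally show ?thesis using low by linarith
    qed
    moreover have pos1: "0 < 1 + G / Z" using G0 Z(2) by (simp add: add_pos_nonneg)
    moreover have pos2: "0 < 1 - x" using x by simp
    ultimately have "ln ((1 + G / Z) * (1 - x) * Z) \<le> ln Z'" using Z(2) pos by (intro ln_mono) auto
    then have *: "ln (1 + G / Z) + ln (1 - x) + ln Z \<le> ln Z'"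
      using pos1 pos2 Z(2) by (simp add: ln_mult)
    have "- x - 2 * x\<^sup>2 \<le> ln (1 - x)" using x by (rule ln_one_minus_pos_lower_bound)
    moreover have "2 * x\<^sup>2 \<le> x" using x mult_left_mono[of x "1/2" x] by (simp add: power2_eq_square)
    moreover have "2 * x \<le> B"
    proof -
      have "2 * L \<le> (\<Sum>k<9. 36 * \<Lambda> k * \<kappa> k * l k)"
        unfolding L_def sum_distrib_left
      proof (intro sum_mono)
        fix k
        have "2 * (\<kappa> k * l k) \<le> (36 * \<Lambda> k) * (\<kappa> k * l k)"
          using \<Lambda>(1)[of k] \<kappa>0[of k] nn(3)[of k] by (intro mult_right_mono) auto
        then show "2 * (\<kappa> k * l k) \<le> 36 * \<Lambda> k * \<kappa> k * l k" by (simp add: mult.assoc)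
      qed
      then have "2 * L / Z \<le> B" unfolding B_def using Z(2) by (intro divide_right_mono) auto
      then show ?thesis by (simp add: x_def)
    qed
    ultimately show ?thesis using * pos by linarith
  next
    case False
    \<comment> \<open>nine stages share a loss of more than half of \<open>Z\<close>\<close>
    have "\<exists>k<9. Z / 18 < \<kappa> k * l k"
    proof (rule ccontr)
      assume "\<not> ?thesis"
      then have "\<kappa> k * l k \<le> Z / 18" if "k < 9" for k using that by (meson not_less)
      then have "L \<le> (\<Sum>k<9::nat. Z / 18)" unfolding L_def by (intro sum_mono) simp
      then show False using False by simp
    qed
    then obtain k where k: "k < 9" "Z / 18 < \<kappa> k * l k" by blast
    define b where "b = 72 * C * \<kappa> k"
    have b: "72 \<le> b" "\<Lambda> k = ln b" using big[of k] by (auto simp: b_def \<Lambda>_def)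
    have vk: "Z / 18 < \<kappa> k * v k" using k(2) mult_left_mono[OF l_le \<kappa>0, of k k] by linarith
    have lower: "Z / b \<le> Z'"
    proof (cases "C * v' 0 \<le> v k / 4")
      case True
      then have "v k / 4 \<le> v' k"
        using half[OF k(1)] step0 step[of "k - 1"] nn(4)[of "k - 1"] k(1) by (cases k) auto
      then have "\<kappa> k * (v k / 4) \<le> \<kappa> k * v' k" using \<kappa>0 by (intro mult_left_mono)
      then have "Z / 72 \<le> Z'" using member[OF k(1)] vk by simp
      moreover have "Z / b \<le> Z / 72" using b(1) Z(2) by (intro divide_left_mono) auto
      ultimately show ?thesis by linarith
    next
      case False
      then have "v k \<le> 4 * C * v' 0" by simp
      also have "\<dots> \<le> 4 * C * Z'" using member[of 0] \<kappa>(1) C by (intro mult_left_mono) auto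
      finally have "\<kappa> k * v k \<le> \<kappa> k * (4 * C * Z')" using \<kappa>0 by (intro mult_left_mono)
      then have "Z / 18 \<le> \<kappa> k * (4 * C * Z')" using vk by linarith
      then have "Z \<le> b * Z'" by (simp add: b_def mult_ac)
      then show ?thesis using b(1) by (simp add: pos_divide_le_eq mult.commute)
    qed
    have pos: "0 < Z'" using lower b(1) Z(2) divide_pos_pos[of Z b] by linarith
    have Bb: "2 * ln b \<le> B"
    proof -
      have "36 * ln b * (Z / 18) \<le> 36 * ln b * (\<kappa> k * l k)"
        using k(2) b(1) by (intro mult_left_mono) auto
      then have "36 * ln b * (Z / 18) / Z \<le> 36 * ln b * (\<kappa> k * l k) / Z"
        using Z(2) by (intro divide_right_mono) auto
      moreover have "36 * ln b * (Z / 18) / Z = 2 * ln b" using Z(2) by simp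
      ultimately show ?thesis using B_ge[OF k(1)] b(2) by simp
    qed
    have "ln (1 + G / Z) - 2 * ln b \<le> ln Z' - ln Z"
    proof (cases "G \<le> Z")
      case True
      have "ln (1 + G / Z) \<le> ln 2" using True G0 Z(2) by (intro ln_mono) (auto simp: add_pos_nonneg)
      moreover have "ln (Z / b) \<le> ln Z'" using lower b(1) Z(2) pos by (intro ln_mono) auto
      moreover have "ln (Z / b) = ln Z - ln b" using b(1) Z(2) by (simp add: ln_div)
      ultimately show ?thesis using \<Lambda>(2)[of k] b(2) by linarith
    next
      case False
      have "1 + G / Z \<le> 2 * (G / Z)" using False Z(2) by (simp add: field_simps)
      then have "ln (1 + G / Z) \<le> ln (2 * (G / Z))" using G0 Z(2) False by (intro ln_mono) (auto simp: add_pos_nonneg)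
      also have "\<dots> = ln 2 + (ln G - ln Z)" using False Z(2) G0 by (simp add: ln_mult ln_div)
      also have "ln G \<le> ln Z'" using low LZ False Z(2) pos by (intro ln_mono) auto
      finally show ?thesis using \<Lambda>(2)[of k] b(2) \<Lambda>(1)[of k] by linarith
    qed
    then show ?thesis using Bb pos by linarith
  qed
  then show "0 < Z'" "ln (1 + G / Z) - (\<Sum>k<9. 36 * ln (72 * C * \<kappa> k) * \<kappa> k * l k) / Z \<le> ln Z' - ln Z"
    unfolding B_def \<Lambda>_def by auto
qed

lemma weighted_cs:
  fixes w f g :: "'a \<Rightarrow> real"
  assumes "\<And>i. i \<in> I \<Longrightarrow> 0 \<le> w i"
  shows "(\<Sum>i\<in>I. w i * (f i * g i))\<^sup>2 \<le> (\<Sum>i\<in>I. w i * (f i)\<^sup>2) * (\<Sum>i\<in>I. w i * (g i)\<^sup>2)"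
proof -
  have "(\<Sum>i\<in>I. (sqrt (w i) * f i) * (sqrt (w i) * g i))\<^sup>2
      \<le> (\<Sum>i\<in>I. (sqrt (w i) * f i)\<^sup>2) * (\<Sum>i\<in>I. (sqrt (w i) * g i)\<^sup>2)"
    by (rule Cauchy_Schwarz_ineq_sum)
  moreover have "(\<Sum>i\<in>I. (sqrt (w i) * f i) * (sqrt (w i) * g i)) = (\<Sum>i\<in>I. w i * (f i * g i))"
  proof (intro sum.cong refl)
    fix i assume "i \<in> I"
    have "(sqrt (w i) * f i) * (sqrt (w i) * g i) = (sqrt (w i) * sqrt (w i)) * (f i * g i)" by (simp only: mult_ac)
    then show "(sqrt (w i) * f i) * (sqrt (w i) * g i) = w i * (f i * g i)" using assms[OF \<open>i \<in> I\<close>] by simp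
  qed
  moreover have "(\<Sum>i\<in>I. (sqrt (w i) * h i)\<^sup>2) = (\<Sum>i\<in>I. w i * (h i)\<^sup>2)" for h
    using assms by (intro sum.cong) (auto simp: power_mult_distrib)
  ultimately show ?thesis by simp
qed

definition potential :: "(nat \<Rightarrow> real) \<Rightarrow> site set \<Rightarrow> real" where
  "potential \<kappa> A = (\<Sum>k<9. \<kappa> k * sq_sum k A)"

text \<open>Write \<open>X i\<close> for the weighted sum of the \<open>i\<close>-th powers of all place weights. Then \<open>X 2\<^sup>2 \<le> X 3 X 1\<close> and
\<open>X 1\<^sup>2 \<le> X 2 X 0\<close>, so \<open>X 3 / X 2 \<ge> X 1 / X 0\<close>. Here \<open>X 1 \<ge> 1\<close>, and \<open>X 0\<close> is at most a multiple of \<open>card A\<close>.\<close>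

lemma potential_rate:
  assumes A: "finite A" "A \<noteq> {}" and \<kappa>: "\<And>k. 1 \<le> \<kappa> k"
  shows "0 < potential \<kappa> A"
    "1 / (68 * (\<Sum>k<9. \<kappa> k) * real (card A)) \<le> (\<Sum>k<9. \<kappa> k * cube_sum k A) / potential \<kappa> A"
proof -
  let ?I = "SIGMA k:{..<9}. places k A"
  define e where "e = (\<lambda>(k, P). place_hm k A P)"
  define w where "w = (\<lambda>(k::nat, P::place). \<kappa> k)"
  have \<kappa>0: "0 \<le> \<kappa> k" for k using \<kappa>[of k] by linarith
  have fin: "finite (places k A)" for k using A by (simp add: finite_places)
  have sums: "(\<Sum>i\<in>?I. w i * f (e i)) = (\<Sum>k<9. \<kappa> k * (\<Sum>P\<in>places k A. f (place_hm k A P)))" for f :: "real \<Rightarrow> real"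
    using fin by (subst sum_distrib_left, subst sum.Sigma) (auto simp: e_def w_def intro!: sum.cong)
  define X0 X1 X2 X3 where "X0 = (\<Sum>i\<in>?I. w i * 1\<^sup>2)" and "X1 = (\<Sum>i\<in>?I. w i * e i)"
    and "X2 = (\<Sum>i\<in>?I. w i * (e i)\<^sup>2)" and "X3 = (\<Sum>i\<in>?I. w i * (e i) ^ 3)"
  have w0: "0 \<le> w i" for i using \<kappa>0 by (cases i) (simp add: w_def)
  have e0: "0 \<le> e i" for i using A by (cases i) (simp add: e_def place_hm_nonneg)
  have X2: "X2 = potential \<kappa> A" unfolding X2_def potential_def sq_sum_def by (rule sums)
  have X3: "X3 = (\<Sum>k<9. \<kappa> k * cube_sum k A)" unfolding X3_def cube_sum_def by (rule sums)
  have "1 \<le> (\<Sum>P\<in>places 0 A. place_hm 0 A P)" by (rule place_sum_ge_1[OF A])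
  also have "\<dots> \<le> \<kappa> 0 * (\<Sum>P\<in>places 0 A. place_hm 0 A P)"
    using mult_right_mono[OF \<kappa>[of 0], of "\<Sum>P\<in>places 0 A. place_hm 0 A P"] A by (simp add: sum_nonneg place_hm_nonneg)
  also have "\<dots> \<le> (\<Sum>k<9. \<kappa> k * (\<Sum>P\<in>places k A. place_hm k A P))"
    using \<kappa>0 A by (intro member_le_sum mult_nonneg_nonneg sum_nonneg place_hm_nonneg) auto
  also have "\<dots> = X1" unfolding X1_def using sums[of "\<lambda>x. x"] by simp
  finally have X1: "1 \<le> X1" .
  have X0: "X0 \<le> 68 * (\<Sum>k<9. \<kappa> k) * real (card A)"
  proof -
    have "X0 = (\<Sum>k<9. \<kappa> k * real (card (places k A)))" unfolding X0_def using sums[of "\<lambda>x. 1"] by simp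
    also have "\<dots> \<le> (\<Sum>k<9. \<kappa> k * (68 * real (card A)))"
    proof (intro sum_mono mult_left_mono \<kappa>0)
      fix k show "real (card (places k A)) \<le> 68 * real (card A)"
        using of_nat_mono[OF card_places[OF A(1), of k], where 'a = real] by simp
    qed
    finally show ?thesis by (simp add: sum_distrib_right[symmetric] sum_distrib_left mult_ac)
  qed
  have cs1: "X1\<^sup>2 \<le> X2 * X0"
    using weighted_cs[of ?I w e "\<lambda>_. 1"] w0 by (simp add: X0_def X1_def X2_def)
  have cs2: "X2\<^sup>2 \<le> X3 * X1"
  proof -
    have "(\<Sum>i\<in>?I. (w i * e i) * (e i * 1))\<^sup>2 \<le> (\<Sum>i\<in>?I. (w i * e i) * (e i)\<^sup>2) * (\<Sum>i\<in>?I. (w i * e i) * 1\<^sup>2)"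
      using w0 e0 by (intro weighted_cs) auto
    then show ?thesis by (simp add: X1_def X2_def X3_def power2_eq_square power3_eq_cube mult_ac)
  qed
  have "0 \<le> X2" unfolding X2 potential_def using \<kappa>0 by (intro sum_nonneg mult_nonneg_nonneg sq_sum_nonneg)
  moreover have "X2 \<noteq> 0" using cs1 X1 by auto
  ultimately have pos: "0 < X2" by simp
  then show "0 < potential \<kappa> A" by (simp add: X2)
  have X0pos: "0 < X0"
  proof (rule ccontr)
    assume "\<not> 0 < X0"
    then have "X2 * X0 \<le> 0" using pos by (simp add: mult_nonneg_nonpos)
    then show False using cs1 X1 zero_less_power[of X1 2] by linarith
  qed
  have "X2 * X2 \<le> X3 * X1" using cs2 by (simp add: power2_eq_square)
  then have "X2 / X1 \<le> X3 / X2" using pos X1 by (simp add: field_simps)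
  moreover have "X1 * X1 \<le> X2 * X0" using cs1 by (simp add: power2_eq_square)
  then have "X1 / X0 \<le> X2 / X1" using X0pos X1 by (simp add: field_simps)
  moreover have "1 / X0 \<le> X1 / X0" using X1 X0pos by (intro divide_right_mono) auto
  moreover have "1 / (68 * (\<Sum>k<9. \<kappa> k) * real (card A)) \<le> 1 / X0"
    using X0 X0pos by (intro frac_le) auto
  ultimately show "1 / (68 * (\<Sum>k<9. \<kappa> k) * real (card A)) \<le> (\<Sum>k<9. \<kappa> k * cube_sum k A) / potential \<kappa> A"
    unfolding X2 X3 by linarith
qed

text \<open>The logarithm flattens large gains. By concavity, advancing a place with share \<open>x = \<kappa> k e\<^sup>2 / Z \<le> 1\<close> of the
potential still contributes at least \<open>x ln (1 + \<Gamma> k)\<close>, a factor that can be made as large as desired by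
the choice of \<open>\<Gamma> k\<close>. The number 544 is \<open>8 \<cdot> 68\<close>: a site is the next cell of at most 68 places at each of
eight stages.\<close>

lemma expected_log_gain:
  assumes A: "finite A" "A \<noteq> {}" and \<kappa>: "\<And>k. 1 \<le> \<kappa> k" and \<Gamma>: "\<And>k. \<kappa> (Suc k) = \<kappa> k * \<Gamma> k" "\<And>k. 0 \<le> \<Gamma> k"
    and Z: "Z = potential \<kappa> A"
  shows "(\<Sum>k<8. ln (1 + \<Gamma> k) / (544 * harnack) * (\<kappa> k * cube_sum k A)) / Z
    \<le> (\<Sum>z\<in>boundary A. mu A z * ln (1 + (\<Sum>k<8. \<kappa> (Suc k) * gain k A z) / Z))"
proof -
  have \<kappa>0: "0 \<le> \<kappa> k" for k using \<kappa>[of k] by linarith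
  have Zpos: "0 < Z" unfolding Z by (rule potential_rate(1)[OF A \<kappa>])
  have fin: "finite (places k A)" for k using A by (simp add: finite_places)
  let ?e = "\<lambda>k. place_hm k A"
  define G where "G z = (\<Sum>k<8. \<kappa> (Suc k) * gain k A z)" for z
  have G0: "0 \<le> G z" for z unfolding G_def using \<kappa>0 by (intro sum_nonneg mult_nonneg_nonneg gain_nonneg)
  define t where "t k P = ln (1 + \<Gamma> k) * (\<kappa> k * (?e k P)\<^sup>2 / Z)" for k P
  have t0: "0 \<le> t k P" for k P unfolding t_def using \<kappa>0 Zpos \<Gamma>(2) by (intro mult_nonneg_nonneg divide_nonneg_nonneg) auto
  have t_le: "t k P \<le> ln (1 + G z / Z)" if "k < 8" "P \<in> places k A" "target k P = z" for k P z
  proof -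
    define x where "x = \<kappa> k * (?e k P)\<^sup>2 / Z"
    have "\<kappa> k * (?e k P)\<^sup>2 \<le> \<kappa> k * sq_sum k A"
      unfolding sq_sum_def using that \<kappa>0 fin by (intro mult_left_mono member_le_sum) auto
    also have "\<dots> \<le> Z"
      unfolding Z potential_def using that \<kappa>0 by (intro member_le_sum mult_nonneg_nonneg sq_sum_nonneg) auto
    finally have x: "0 \<le> x" "x \<le> 1" using Zpos \<kappa>0 by (auto simp: x_def)
    have "t k P = x * ln (1 + \<Gamma> k)" by (simp add: t_def x_def)
    also have "\<dots> \<le> ln (1 + \<Gamma> k * x)" using x \<Gamma>(2) by (rule ln_concave_step)
    also have "\<dots> \<le> ln (1 + G z / Z)"
    proof (intro ln_mono add_left_mono)
      have "\<kappa> (Suc k) * (?e k P)\<^sup>2 \<le> \<kappa> (Suc k) * gain k A z"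
        unfolding gain_def using that \<kappa>0 fin by (intro mult_left_mono member_le_sum) auto
      also have "\<dots> \<le> G z"
        unfolding G_def using that \<kappa>0 by (intro member_le_sum[where f = "\<lambda>k. \<kappa> (Suc k) * gain k A z"] mult_nonneg_nonneg gain_nonneg) auto
      finally have "\<kappa> (Suc k) * (?e k P)\<^sup>2 / Z \<le> G z / Z" using Zpos by (intro divide_right_mono) auto
      then show "\<Gamma> k * x \<le> G z / Z" by (simp add: x_def \<Gamma>(1) mult_ac)
      show "0 < 1 + \<Gamma> k * x" using x \<Gamma>(2)[of k] by (simp add: add_pos_nonneg)
    qed
    finally show ?thesis .
  qed
  have per_z: "(\<Sum>k<8. \<Sum>P\<in>{P \<in> places k A. target k P = z}. t k P) \<le> 544 * ln (1 + G z / Z)" for z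
  proof -
    have ln0: "0 \<le> ln (1 + G z / Z)" using G0[of z] Zpos by simp
    have "(\<Sum>k<8. \<Sum>P\<in>{P \<in> places k A. target k P = z}. t k P) \<le> (\<Sum>k<8::nat. \<Sum>P\<in>{P \<in> places k A. target k P = z}. ln (1 + G z / Z))"
      by (intro sum_mono t_le) auto
    also have "\<dots> = (\<Sum>k<8::nat. real (card {P \<in> places k A. target k P = z}) * ln (1 + G z / Z))" by simp
    also have "\<dots> \<le> (\<Sum>k<8::nat. 68 * ln (1 + G z / Z))"
      using card_places_target[of _ A z] ln0 by (intro sum_mono mult_right_mono) auto
    finally show ?thesis by simp
  qed
  have "(\<Sum>k<8. ln (1 + \<Gamma> k) / (544 * harnack) * (\<kappa> k * cube_sum k A)) / Z
      = (\<Sum>k<8. \<Sum>P\<in>places k A. ?e k P / harnack * t k P) / 544"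
    by (simp add: cube_sum_def t_def sum_distrib_left sum_distrib_right sum_divide_distrib power2_eq_square power3_eq_cube mult_ac)
  also have "(\<Sum>k<8. \<Sum>P\<in>places k A. ?e k P / harnack * t k P) \<le> (\<Sum>k<8. \<Sum>P\<in>places k A. mu A (target k P) * t k P)"
  proof (intro sum_mono mult_right_mono t0)
    fix k P assume "k \<in> {..<8::nat}" "P \<in> places k A"
    then show "?e k P / harnack \<le> mu A (target k P)"
      using placed.place_hm_le[OF placed_intro[OF A(1), of k P]] by (simp add: mu_def field_simps)
  qed
  also have "\<dots> = (\<Sum>k<8. \<Sum>z\<in>boundary A. \<Sum>P\<in>{P \<in> places k A. target k P = z}. mu A (target k P) * t k P)"
  proof (intro sum.cong refl sum.group[symmetric] fin)
    fix k assume "k \<in> {..<8::nat}"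
    then show "target k ` places k A \<subseteq> boundary A"
      using placed.target_boundary[OF placed_intro[OF A(1), of k]] by auto
  qed (use A in auto)
  also have "\<dots> = (\<Sum>k<8. \<Sum>z\<in>boundary A. mu A z * (\<Sum>P\<in>{P \<in> places k A. target k P = z}. t k P))"
    by (intro sum.cong refl) (auto simp: sum_distrib_left intro!: sum.cong)
  also have "\<dots> = (\<Sum>z\<in>boundary A. mu A z * (\<Sum>k<8. \<Sum>P\<in>{P \<in> places k A. target k P = z}. t k P))"
    unfolding sum_distrib_left[of "mu A _" _ "{..<8}"] by (rule sum.swap)
  also have "\<dots> \<le> (\<Sum>z\<in>boundary A. mu A z * (544 * ln (1 + G z / Z)))"
    using A by (intro sum_mono mult_left_mono per_z mu_nonneg)
  also have "\<dots> = 544 * (\<Sum>z\<in>boundary A. mu A z * ln (1 + G z / Z))" by (simp add: sum_distrib_left mult_ac)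
  finally show ?thesis unfolding G_def by simp
qed

text \<open>The weights are chosen from stage 0 upwards. The loss at stage \<open>k\<close> costs \<open>\<Lambda> (\<kappa> k) \<kappa> k\<close> times the loss of \<open>sq_sum k\<close> by
\<open>ln_potential_step\<close>; with \<open>\<epsilon> = 1 / (\<Lambda> (\<kappa> k) \<kappa> k)\<close> in \<open>expected_loss\<close> the coefficient of \<open>cube_sum 0\<close> is bounded, and \<open>D (\<kappa> k)\<close> is a bound
for all that has to be compensated at stage \<open>k\<close>. The ratio \<open>\<Gamma> k\<close> is large enough for the gain from
stage \<open>k\<close> to stage \<open>k + 1\<close> to do so. The last stage has no gain; its loss is paid by the probability
of closing a hole.\<close>

theorem lyapunov_drift:
  "\<exists>Y c C. 0 < c \<and> 0 \<le> C \<and> (\<forall>A. finite A \<longrightarrow> A \<noteq> {} \<longrightarrow> Y A \<le> (0::real) \<and>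
     c / real (card A) - C * (\<Sum>z\<in>target 8 ` places 8 A. mu A z)
       \<le> (\<Sum>z\<in>boundary A. mu A z * (Y (insert z A) - Y A)))"
proof -
  obtain C1 where C1: "1 \<le> C1" and exp_loss: "\<And>A k \<epsilon>. finite A \<Longrightarrow> A \<noteq> {} \<Longrightarrow> k < 9 \<Longrightarrow> 0 < \<epsilon> \<Longrightarrow> \<epsilon> \<le> 1 \<Longrightarrow>
     (\<Sum>z\<in>boundary A. mu A z * loss k A z) \<le> C1 * (\<epsilon> * cube_sum 0 A + cube_sum k A / \<epsilon>\<^sup>2)"
    using expected_loss by blast
  obtain C2 where C2: "1 \<le> C2" and half: "\<And>A k z. finite A \<Longrightarrow> A \<noteq> {} \<Longrightarrow> k < 9 \<Longrightarrow> z \<in> boundary A \<Longrightarrow>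
     loss k A z \<le> sq_sum k A / 2 + C2 * sq_sum 0 (insert z A)"
    using loss_half by blast
  define \<Lambda> where "\<Lambda> x = 36 * ln (72 * C2 * x)" for x
  \<comment> \<open>the loss at a stage, nine times the share of stage 0 in a loss, and a surplus for \<open>potential_rate\<close>\<close>
  define D where "D x = C1 * (\<Lambda> x * x) ^ 3 + 9 * C1 + x" for x
  define \<kappa> where "\<kappa> = rec_nat 1 (\<lambda>_ x. x * exp (544 * harnack * D x))"
  define \<Gamma> where "\<Gamma> k = exp (544 * harnack * D (\<kappa> k))" for k
  have \<kappa>_Suc: "\<kappa> 0 = 1" "\<kappa> (Suc k) = \<kappa> k * \<Gamma> k" for k by (simp_all add: \<kappa>_def \<Gamma>_def)
  have \<Lambda>1: "1 \<le> \<Lambda> x" if "1 \<le> x" for x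
  proof -
    have "3 \<le> 72 * C2 * x" using mult_mono[OF C2 that] C2 that by simp
    then have "1 \<le> ln (72 * C2 * x)" using exp_le by (subst ln_ge_iff) auto
    then show ?thesis by (simp add: \<Lambda>_def)
  qed
  have D1: "0 \<le> D x" if "1 \<le> x" for x
    using \<Lambda>1[OF that] that C1 unfolding D_def by (intro add_nonneg_nonneg mult_nonneg_nonneg) auto
  have \<kappa>: "1 \<le> \<kappa> k" for k
  proof (induction k)
    case (Suc k)
    have "1 \<le> \<Gamma> k" unfolding \<Gamma>_def using D1[OF Suc] by (simp add: less_imp_le)
    then show ?case using mult_mono[OF Suc, of 1 "\<Gamma> k"] Suc unfolding \<kappa>_Suc by simp
  qed (simp add: \<kappa>_Suc)
  have \<kappa>0: "0 \<le> \<kappa> k" for k using \<kappa>[of k] by linarith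
  define S where "S = (\<Sum>k<9. \<kappa> k)"
  have S: "9 \<le> S" unfolding S_def using sum_mono[of "{..<9::nat}" "\<lambda>_. 1" \<kappa>] \<kappa> by simp
  define Zmax where "Zmax = S * (68 * harnack)"
  define Y where "Y A = ln (potential \<kappa> A) - ln Zmax" for A
  define C4 where "C4 = D (\<kappa> 8)"
  have C4: "0 \<le> C4" unfolding C4_def using D1 \<kappa> by blast
  have main: "Y A \<le> 0 \<and> (1 / (68 * S)) / real (card A) - (C4 * (68 * harnack)) * (\<Sum>z\<in>target 8 ` places 8 A. mu A z)
       \<le> (\<Sum>z\<in>boundary A. mu A z * (Y (insert z A) - Y A))" if A: "finite A" "A \<noteq> {}" for A
  proof -
    let ?Z = "potential \<kappa> A"
    have Zpos: "0 < ?Z" by (rule potential_rate(1)[OF A \<kappa>])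
    have Phi0: "0 \<le> cube_sum k A" for k using A by (simp add: cube_sum_nonneg)
    have "?Z \<le> Zmax" unfolding potential_def Zmax_def S_def sum_distrib_right
      using \<kappa>0 A by (intro sum_mono mult_left_mono sq_sum_le) auto
    then have Y: "Y A \<le> 0" unfolding Y_def using Zpos by (simp add: ln_mono)
    define G where "G z = (\<Sum>k<8. \<kappa> (Suc k) * gain k A z)" for z
    have step: "ln (1 + G z / ?Z) - (\<Sum>k<9. \<Lambda> (\<kappa> k) * \<kappa> k * loss k A z) / ?Z
        \<le> Y (insert z A) - Y A" if z: "z \<in> boundary A" for z
    proof -
      have "ln (1 + G z / ?Z) - (\<Sum>k<9. 36 * ln (72 * C2 * \<kappa> k) * \<kappa> k * loss k A z) / ?Z
          \<le> ln (potential \<kappa> (insert z A)) - ln ?Z"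
      proof (rule ln_potential_step(2)[where v = "\<lambda>k. sq_sum k A" and v' = "\<lambda>k. sq_sum k (insert z A)" and g = "\<lambda>k. gain k A z"])
        show "sq_sum 0 A - loss 0 A z \<le> sq_sum 0 (insert z A)" using A z by (intro sq_sum_step_0) auto
        show "sq_sum (Suc k) A - loss (Suc k) A z + gain k A z \<le> sq_sum (Suc k) (insert z A)" if "k < 8" for k
          using A z that by (intro sq_sum_step_Suc) auto
      qed (use A z \<kappa>_Suc \<kappa> C2 half Zpos in \<open>auto simp: sq_sum_nonneg loss_nonneg gain_nonneg loss_le_sq_sum potential_def G_def\<close>)
      then show ?thesis by (simp add: Y_def \<Lambda>_def)
    qed
    have losses: "(\<Sum>z\<in>boundary A. mu A z * ((\<Sum>k<9. \<Lambda> (\<kappa> k) * \<kappa> k * loss k A z) / ?Z))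
        \<le> (\<Sum>k<9. C1 * cube_sum 0 A + C1 * (\<Lambda> (\<kappa> k) * \<kappa> k) ^ 3 * cube_sum k A) / ?Z"
    proof -
      have "(\<Sum>z\<in>boundary A. mu A z * ((\<Sum>k<9. \<Lambda> (\<kappa> k) * \<kappa> k * loss k A z) / ?Z))
          = (\<Sum>z\<in>boundary A. \<Sum>k<9. \<Lambda> (\<kappa> k) * \<kappa> k * (mu A z * loss k A z)) / ?Z"
        by (simp add: sum_distrib_left sum_divide_distrib mult_ac)
      also have "\<dots> = (\<Sum>k<9. \<Lambda> (\<kappa> k) * \<kappa> k * (\<Sum>z\<in>boundary A. mu A z * loss k A z)) / ?Z"
        by (subst sum.swap) (simp add: sum_distrib_left)
      also have "\<dots> \<le> (\<Sum>k<9. C1 * cube_sum 0 A + C1 * (\<Lambda> (\<kappa> k) * \<kappa> k) ^ 3 * cube_sum k A) / ?Z"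
      proof (intro divide_right_mono sum_mono)
        fix k assume k: "k \<in> {..<9::nat}"
        define a where "a = \<Lambda> (\<kappa> k) * \<kappa> k"
        have a: "1 \<le> a" unfolding a_def using mult_mono[OF \<Lambda>1[OF \<kappa>] \<kappa>, of k k] \<Lambda>1[OF \<kappa>, of k] by simp
        have "a * (\<Sum>z\<in>boundary A. mu A z * loss k A z) \<le> a * (C1 * (1 / a * cube_sum 0 A + cube_sum k A / (1 / a)\<^sup>2))"
          using a A k by (intro mult_left_mono exp_loss) auto
        also have "\<dots> = C1 * cube_sum 0 A + C1 * a ^ 3 * cube_sum k A"
          using a by (simp add: power2_eq_square power3_eq_cube field_simps)
        finally show "\<Lambda> (\<kappa> k) * \<kappa> k * (\<Sum>z\<in>boundary A. mu A z * loss k A z)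
            \<le> C1 * cube_sum 0 A + C1 * (\<Lambda> (\<kappa> k) * \<kappa> k) ^ 3 * cube_sum k A" by (simp add: a_def)
      qed (use Zpos in simp)
      finally show ?thesis .
    qed
    have gains: "(\<Sum>k<8. D (\<kappa> k) * (\<kappa> k * cube_sum k A)) / ?Z \<le> (\<Sum>z\<in>boundary A. mu A z * ln (1 + G z / ?Z))"
    proof -
      have "(\<Sum>k<8. D (\<kappa> k) * (\<kappa> k * cube_sum k A)) \<le> (\<Sum>k<8. ln (1 + \<Gamma> k) / (544 * harnack) * (\<kappa> k * cube_sum k A))"
      proof (intro sum_mono mult_right_mono mult_nonneg_nonneg \<kappa>0 Phi0)
        fix k
        have "544 * harnack * D (\<kappa> k) = ln (\<Gamma> k)" by (simp add: \<Gamma>_def)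
        also have "\<dots> \<le> ln (1 + \<Gamma> k)" by (intro ln_mono) (auto simp: \<Gamma>_def add_pos_pos)
        finally show "D (\<kappa> k) \<le> ln (1 + \<Gamma> k) / (544 * harnack)" by (simp add: field_simps)
      qed
      then have "(\<Sum>k<8. D (\<kappa> k) * (\<kappa> k * cube_sum k A)) / ?Z \<le> (\<Sum>k<8. ln (1 + \<Gamma> k) / (544 * harnack) * (\<kappa> k * cube_sum k A)) / ?Z"
        using Zpos by (intro divide_right_mono) auto
      also have "\<dots> \<le> (\<Sum>z\<in>boundary A. mu A z * ln (1 + G z / ?Z))"
        unfolding G_def using A \<kappa> \<kappa>_Suc by (intro expected_log_gain) (auto simp: \<Gamma>_def)
      finally show ?thesis .
    qed
    have balance: "(\<Sum>k<9. \<kappa> k * cube_sum k A) - C4 * cube_sum 8 A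
        \<le> (\<Sum>k<8. D (\<kappa> k) * (\<kappa> k * cube_sum k A)) - (\<Sum>k<9. C1 * cube_sum 0 A + C1 * (\<Lambda> (\<kappa> k) * \<kappa> k) ^ 3 * cube_sum k A)"
    proof -
      have D_ge: "(C1 * (\<Lambda> (\<kappa> k) * \<kappa> k) ^ 3 + \<kappa> k) * cube_sum k A + (if k = 0 then 9 * C1 * cube_sum 0 A else 0)
          \<le> D (\<kappa> k) * (\<kappa> k * cube_sum k A)" for k
      proof -
        have "D (\<kappa> k) * 1 \<le> D (\<kappa> k) * \<kappa> k" using D1[OF \<kappa>] \<kappa> by (intro mult_left_mono)
        then have "D (\<kappa> k) * cube_sum k A \<le> D (\<kappa> k) * \<kappa> k * cube_sum k A" using Phi0 by (intro mult_right_mono) auto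
        moreover have "(C1 * (\<Lambda> (\<kappa> k) * \<kappa> k) ^ 3 + \<kappa> k) * cube_sum k A + (if k = 0 then 9 * C1 * cube_sum 0 A else 0) \<le> D (\<kappa> k) * cube_sum k A"
          unfolding D_def using C1 Phi0[of k] by (simp add: algebra_simps)
        ultimately show ?thesis by (simp add: mult.assoc)
      qed
      have split9: "(\<Sum>k<9. f k) = (\<Sum>k<8. f k) + f 8" for f :: "nat \<Rightarrow> real"
        using sum.lessThan_Suc[of f 8] by simp
      have "(\<Sum>k<8. (C1 * (\<Lambda> (\<kappa> k) * \<kappa> k) ^ 3 + \<kappa> k) * cube_sum k A + (if k = 0 then 9 * C1 * cube_sum 0 A else 0))
          \<le> (\<Sum>k<8. D (\<kappa> k) * (\<kappa> k * cube_sum k A))" by (intro sum_mono D_ge)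
      moreover have "(\<Sum>k<8::nat. if k = 0 then 9 * C1 * cube_sum 0 A else 0) = 9 * C1 * cube_sum 0 A" by simp
      moreover have "(C1 * (\<Lambda> (\<kappa> 8) * \<kappa> 8) ^ 3 + \<kappa> 8) * cube_sum 8 A \<le> C4 * cube_sum 8 A"
        unfolding C4_def D_def using C1 Phi0 by (intro mult_right_mono) auto
      ultimately show ?thesis
        by (simp add: split9 sum.distrib algebra_simps)
    qed
    have "(1 / (68 * S)) / real (card A) - (C4 * (68 * harnack)) * (\<Sum>z\<in>target 8 ` places 8 A. mu A z)
        \<le> (\<Sum>k<9. \<kappa> k * cube_sum k A) / ?Z - C4 * (cube_sum 8 A / ?Z)"
    proof -
      have "(1 / (68 * S)) / real (card A) \<le> (\<Sum>k<9. \<kappa> k * cube_sum k A) / ?Z"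
        using potential_rate(2)[OF A \<kappa>] by (simp add: S_def)
      moreover have "cube_sum 8 A / ?Z \<le> (68 * harnack) * (\<Sum>z\<in>target 8 ` places 8 A. mu A z)"
      proof -
        have e2: "(place_hm 8 A P)\<^sup>2 \<le> ?Z" if "P \<in> places 8 A" for P
        proof -
          have "(place_hm 8 A P)\<^sup>2 \<le> sq_sum 8 A" unfolding sq_sum_def using that A by (intro member_le_sum finite_places) auto
          also have "\<dots> \<le> \<kappa> 8 * sq_sum 8 A" using mult_right_mono[OF \<kappa>[of 8] sq_sum_nonneg[of 8 A]] by simp
          also have "\<dots> \<le> ?Z" unfolding potential_def using \<kappa>0 by (intro member_le_sum mult_nonneg_nonneg sq_sum_nonneg) auto
          finally show ?thesis .
        qed
        have "cube_sum 8 A \<le> (\<Sum>P\<in>places 8 A. place_hm 8 A P * ?Z)"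
          unfolding cube_sum_def
        proof (intro sum_mono)
          fix P assume "P \<in> places 8 A"
          then have "place_hm 8 A P * (place_hm 8 A P)\<^sup>2 \<le> place_hm 8 A P * ?Z"
            using A by (intro mult_left_mono e2 place_hm_nonneg)
          then show "place_hm 8 A P ^ 3 \<le> place_hm 8 A P * ?Z" by (simp add: power2_eq_square power3_eq_cube)
        qed
        also have "\<dots> = (\<Sum>P\<in>places 8 A. place_hm 8 A P) * ?Z" by (simp add: sum_distrib_right)
        finally have "cube_sum 8 A / ?Z \<le> (\<Sum>P\<in>places 8 A. place_hm 8 A P)" using Zpos by (simp add: pos_divide_le_eq)
        also have "\<dots> \<le> 68 * harnack * (\<Sum>z\<in>target 8 ` places 8 A. mu A z)" by (rule closing_hazard[OF A(1)])
        finally show ?thesis .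
      qed
      then have "C4 * (cube_sum 8 A / ?Z) \<le> C4 * ((68 * harnack) * (\<Sum>z\<in>target 8 ` places 8 A. mu A z))"
        using C4 by (intro mult_left_mono)
      ultimately show ?thesis unfolding mult.assoc by linarith
    qed
    also have "\<dots> = ((\<Sum>k<9. \<kappa> k * cube_sum k A) - C4 * cube_sum 8 A) / ?Z" by (simp add: diff_divide_distrib)
    also have "\<dots> \<le> ((\<Sum>k<8. D (\<kappa> k) * (\<kappa> k * cube_sum k A)) - (\<Sum>k<9. C1 * cube_sum 0 A + C1 * (\<Lambda> (\<kappa> k) * \<kappa> k) ^ 3 * cube_sum k A)) / ?Z"
      using balance Zpos by (intro divide_right_mono) auto
    also have "\<dots> \<le> (\<Sum>z\<in>boundary A. mu A z * ln (1 + G z / ?Z)) - (\<Sum>z\<in>boundary A. mu A z * ((\<Sum>k<9. \<Lambda> (\<kappa> k) * \<kappa> k * loss k A z) / ?Z))"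
      unfolding diff_divide_distrib using gains losses by linarith
    also have "\<dots> = (\<Sum>z\<in>boundary A. mu A z * (ln (1 + G z / ?Z) - (\<Sum>k<9. \<Lambda> (\<kappa> k) * \<kappa> k * loss k A z) / ?Z))"
      by (simp only: sum_subtractf[symmetric] right_diff_distrib)
    also have "\<dots> \<le> (\<Sum>z\<in>boundary A. mu A z * (Y (insert z A) - Y A))"
      using A step by (intro sum_mono mult_left_mono mu_nonneg)
    finally show ?thesis using Y by blast
  qed
  show ?thesis
    by (rule exI[of _ Y], rule exI[of _ "1 / (68 * S)"], rule exI[of _ "C4 * (68 * harnack)"])
      (use main S C4 in \<open>auto simp: less_imp_le\<close>)
qed

section \<open>Holes of a cluster\<close>

definition links :: "site set \<Rightarrow> (site \<times> site) set" where
  "links b = {(u, v). u \<in> b \<and> v \<in> b \<and> v \<in> nbrs u}"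

lemma links_of_path:
  "successively adjacent p \<Longrightarrow> p \<noteq> [] \<Longrightarrow> set p \<subseteq> b \<Longrightarrow> (hd p, last p) \<in> (links b)\<^sup>*"
proof (induction p)
  case (Cons u p)
  show ?case
  proof (cases "p = []")
    case False
    then have "adjacent u (hd p)" "successively adjacent p" using Cons.prems(1) by (simp_all add: successively_Cons)
    moreover have "u \<in> b" "hd p \<in> b" "set p \<subseteq> b" using Cons.prems(3) False by auto
    ultimately have "(u, hd p) \<in> links b" "(hd p, last p) \<in> (links b)\<^sup>*"
      using Cons.IH False by (simp_all add: links_def adjacent_iff)
    then show ?thesis using False by (simp add: converse_rtrancl_into_rtrancl)
  qed simp
qed simp

lemma path_of_links:
  assumes "(x, y) \<in> (links b)\<^sup>*" "x \<in> b"
  shows "\<exists>p. p \<noteq> [] \<and> hd p = x \<and> last p = y \<and> successively adjacent p \<and> set p \<subseteq> b"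
  using assms(1)
proof (induction rule: rtrancl_induct)
  case base
  then show ?case using assms(2) by (intro exI[of _ "[x]"]) simp
next
  case (step y z)
  then obtain p where p: "p \<noteq> []" "hd p = x" "last p = y" "successively adjacent p" "set p \<subseteq> b" by blast
  have "adjacent y z" "z \<in> b" using step(2) by (simp_all add: links_def adjacent_iff)
  then show ?case using p by (intro exI[of _ "p @ [z]"]) (simp add: successively_append_iff)
qed

lemma path_iff_links:
  "(\<exists>p. p \<noteq> [] \<and> hd p = x \<and> last p = y \<and> successively adjacent p \<and> set p \<subseteq> b) \<longleftrightarrow>
     x \<in> b \<and> (x, y) \<in> (links b)\<^sup>*"
proof (intro iffI conjI)
  assume "\<exists>p. p \<noteq> [] \<and> hd p = x \<and> last p = y \<and> successively adjacent p \<and> set p \<subseteq> b"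
  then obtain p where p: "p \<noteq> []" "hd p = x" "last p = y" "successively adjacent p" "set p \<subseteq> b" by blast
  then show "x \<in> b" "(x, y) \<in> (links b)\<^sup>*" using links_of_path[OF p(4,1,5)] hd_in_set[OF p(1)] by auto
qed (use path_of_links in blast)

lemma lattice_connected_iff: "lattice_connected b \<longleftrightarrow> (\<forall>x\<in>b. \<forall>y\<in>b. (x, y) \<in> (links b)\<^sup>*)"
  unfolding lattice_connected_def path_iff_links by blast

lemma sym_links: "sym (links b)"
  unfolding sym_def links_def using nbrs_sym by simp

lemma links_mono: "b \<subseteq> c \<Longrightarrow> links b \<subseteq> links c"
  by (auto simp: links_def)

lemma lattice_connected_Un:
  assumes "lattice_connected b" "lattice_connected c" "x \<in> b" "x \<in> c"
  shows "lattice_connected (b \<union> c)"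
proof -
  have to: "(y, x) \<in> (links (b \<union> c))\<^sup>*" if "y \<in> b \<union> c" for y
  proof -
    have "(y, x) \<in> (links b)\<^sup>* \<or> (y, x) \<in> (links c)\<^sup>*"
      using that assms unfolding lattice_connected_iff by blast
    then show ?thesis
      using rtrancl_mono[OF links_mono[of b "b \<union> c"]] rtrancl_mono[OF links_mono[of c "b \<union> c"]] by auto
  qed
  have "(x, y) \<in> (links (b \<union> c))\<^sup>*" if "y \<in> b \<union> c" for y
    by (rule symD[OF sym_rtrancl[OF sym_links] to[OF that]])
  then show ?thesis unfolding lattice_connected_iff using rtrancl_trans[OF to] by simp
qed

lemma lattice_connected_singleton: "lattice_connected {x}"
  by (simp add: lattice_connected_iff)

lemma lattice_connected_pair: "y \<in> nbrs x \<Longrightarrow> lattice_connected {x, y}"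
proof -
  assume "y \<in> nbrs x"
  then have "(x, y) \<in> links {x, y}" "(y, x) \<in> links {x, y}" using nbrs_sym[of x y] by (simp_all add: links_def)
  then show ?thesis unfolding lattice_connected_iff by (simp add: r_into_rtrancl)
qed

lemma lattice_connected_insert:
  assumes "lattice_connected b" "x \<in> b" "y \<in> nbrs x"
  shows "lattice_connected (insert y b)"
  using lattice_connected_Un[OF assms(1) lattice_connected_pair[OF assms(3)] assms(2)] assms(2)
  by (simp add: insert_absorb)

lemma holes_absorb:
  assumes "c \<in> holes b" "x \<in> c" "y \<in> nbrs x" "y \<notin> b"
  shows "y \<in> c"
proof -
  have "lattice_connected (insert y c)" using assms by (intro lattice_connected_insert) (auto simp: holes_def)
  then have "insert y c = c" using assms by (auto simp: holes_def)
  then show ?thesis by blast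
qed

lemma holes_disjoint:
  assumes "c \<in> holes b" "d \<in> holes b" "x \<in> c" "x \<in> d"
  shows "c = d"
proof -
  have "lattice_connected (c \<union> d)" using assms by (intro lattice_connected_Un) (auto simp: holes_def)
  then have "c \<union> d = c" "c \<union> d = d" using assms by (auto simp: holes_def)
  then show ?thesis by blast
qed

lemma hole_meets_boundary:
  assumes c: "c \<in> holes b" shows "c \<inter> boundary b \<noteq> {}"
proof -
  have fin: "finite c" "c \<noteq> {}" using c by (auto simp: holes_def)
  obtain x where x: "x \<in> c" "x + (1, 0) \<notin> c" using ex_rightmost[OF fin] .
  have "x + (1, 0) \<in> b" using holes_absorb[OF c x(1), of "x + (1, 0)"] x(2) by (auto simp: nbrs_def)
  moreover have "x + (1, 0) \<in> nbrs x" by (simp add: nbrs_def)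
  ultimately have "x \<in> boundary b" using x(1) c by (auto simp: boundary_eq holes_def)
  then show ?thesis using x(1) by blast
qed

lemma finite_holes: assumes "finite b" shows "finite (holes b)"
proof -
  define f where "f c = (SOME x. x \<in> c \<inter> boundary b)" for c
  have f: "f c \<in> c \<and> f c \<in> boundary b" if "c \<in> holes b" for c
  proof -
    have "\<exists>x. x \<in> c \<inter> boundary b" using hole_meets_boundary[OF that] by auto
    then have "f c \<in> c \<inter> boundary b" unfolding f_def by (rule someI_ex)
    then show ?thesis by simp
  qed
  have "inj_on f (holes b)" 
  proof (rule inj_onI)
    fix c d assume "c \<in> holes b" "d \<in> holes b" "f c = f d"
    then show "c = d" using f[of c] f[of d] holes_disjoint[of c b d "f c"] by simp
  qed
  moreover have "f ` holes b \<subseteq> boundary b" using f by blast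
  ultimately show ?thesis using assms finite_boundary inj_on_finite by blast
qed

text \<open>The harmonic function that gives the probability of first hitting the boundary at \<open>z\<close> vanishes off the
hole: the sites next to \<open>z\<close> that are not in the cluster belong to the hole.\<close>

lemma mu_in_hole:
  assumes A: "finite A" "A \<noteq> {}" and c: "c \<in> holes A" "z \<in> c"
  shows "mu A z = 0"
proof -
  let ?f = "\<lambda>y. hit_prob (boundary A) y z" and ?D = "exterior A - c"
  have zero: "?f y = 0" if "y \<in> ?D" for y
  proof (rule harmonic_unique[where D = ?D and M = 1 and x = y and f = ?f])
    show "lap ?f x = 0" if "x \<in> ?D" for x using that by (intro lap_hit_prob) (auto simp: exterior_def)
    show "?f w = 0" if "x \<in> ?D" "w \<in> nbrs x" "w \<notin> ?D" for x w
    proof -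
      have "w \<notin> c"
      proof
        assume "w \<in> c"
        then have "x \<in> c" using holes_absorb[OF c(1), of w x] that nbrs_sym[of w x] by (simp add: exterior_iff)
        then show False using that by blast
      qed
      then have "w \<in> boundary A" "w \<noteq> z" using that nbrs_exterior[of x A w] c(2) by auto
      then show ?thesis by (simp add: hit_prob_on)
    qed
    show "?D \<noteq> UNIV" using exterior_neq_UNIV[OF A(2)] by blast
  qed (use that in \<open>auto simp: abs_hit_prob_le\<close>)
  have "finite c" using c by (simp add: holes_def)
  then have ev: "eventually (\<lambda>y. ?f y = 0) at_inf"
    using eventually_conj[OF eventually_exterior[OF A(1)] eventually_at_inf_notin[of c]]
    by (auto elim!: eventually_mono simp: zero)
  have "(?f \<longlongrightarrow> mu A z) at_inf" unfolding mu_def using A by (intro harmonic_measure_limit) auto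
  moreover have "(?f \<longlongrightarrow> 0) at_inf" by (rule tendsto_eventually[OF ev])
  ultimately show ?thesis by (rule tendsto_unique[OF at_inf_neq_bot])
qed

lemma holes_mono:
  assumes A: "finite A" "A \<noteq> {}" and z: "0 < mu A z"
  shows "holes A \<subseteq> holes (insert z A)"
proof
  fix c assume c: "c \<in> holes A"
  then have "z \<notin> c" using mu_in_hole[OF A c, of z] z by auto
  then show "c \<in> holes (insert z A)" using c by (auto simp: holes_def)
qed

lemma num_holes_mono:
  assumes A: "finite A" "A \<noteq> {}" and z: "0 < mu A z"
  shows "num_holes A \<le> num_holes (insert z A)"
  unfolding num_holes_def using holes_mono[OF assms] finite_holes[of "insert z A"] A by (intro card_mono) auto

text \<open>Laying the ninth cell separates a site \<open>h\<close> from everything. This \<open>{h}\<close> was no hole before, since \<open>h\<close> was next to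
the free site that is now occupied.\<close>

lemma num_holes_target:
  assumes A: "finite A" "A \<noteq> {}" and P: "P \<in> places 8 A" and z: "0 < mu A (target 8 P)"
  shows "num_holes A < num_holes (insert (target 8 P) A)"
proof -
  let ?z = "target 8 P"
  interpret placed A 8 "fst P" "fst (snd P)" "snd (snd P)" P using A P by (intro placed_intro) auto
  obtain h where h: "h \<notin> insert ?z A" "nbrs h \<subseteq> insert ?z A" "?z \<in> nbrs h" by (rule enclosed[OF refl])
  have zA: "?z \<notin> A" using target_boundary by (simp add: boundary_eq)
  have "{h} \<in> holes (insert ?z A)"
  proof -
    have "d = {h}" if d: "{h} \<subseteq> d" "d \<subseteq> - insert ?z A" "lattice_connected d" for d
    proof -
      have "y = h" if "y \<in> d" for y
      proof -
        have "(h, y) \<in> (links d)\<^sup>*" using d(1,3) that unfolding lattice_connected_iff by blast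
        then show ?thesis
        proof (rule converse_rtranclE)
          fix w assume "(h, w) \<in> links d"
          then have "w \<in> nbrs h \<inter> d" by (simp add: links_def)
          then show ?thesis using h(2) d(2) by auto
        qed simp
      qed
      then have "d \<subseteq> {h}" by blast
      then show ?thesis using d(1) by (rule subset_antisym)
    qed
    then have "\<forall>d. {h} \<subseteq> d \<and> d \<subseteq> - insert ?z A \<and> lattice_connected d \<longrightarrow> d = {h}" by simp
    moreover have "{h} \<subseteq> - insert ?z A" using h(1) by simp
    ultimately show ?thesis unfolding holes_def mem_Collect_eq
      using lattice_connected_singleton[of h] by (simp only: finite.emptyI finite.insertI insert_not_empty) simp
  qed
  moreover have "{h} \<notin> holes A"
  proof
    assume "{h} \<in> holes A"
    then have "?z \<in> {h}" by (rule holes_absorb) (use h(3) zA in auto)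
    then show False using h(1) by auto
  qed
  ultimately have "holes A \<subset> holes (insert ?z A)" using holes_mono[OF A z] by blast
  then show ?thesis unfolding num_holes_def using A by (intro psubset_card_mono finite_holes finite.insertI)
qed

lemma cluster_insert:
  assumes "A \<in> clusters" "z \<in> boundary A" shows "insert z A \<in> clusters"
proof -
  obtain y where "y \<in> nbrs z" "y \<in> A" using assms by (auto simp: boundary_eq)
  moreover from this have "lattice_connected (insert z A)"
    using assms(1) nbrs_sym[of y z] by (intro lattice_connected_insert[of A y z]) (simp_all add: clusters_def)
  ultimately show ?thesis using assms(1) by (simp add: clusters_def)
qed

lemma dla_transition_insert:
  assumes "z \<in> boundary A" shows "dla_transition A (insert z A) = mu A z"
proof -
  have "{x \<in> boundary A. insert z A = A \<union> {x}} = {z}" using assms by (auto simp: boundary_eq)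
  then show ?thesis by (simp add: dla_transition_def mu_def)
qed

lemma mu_sum_1:
  assumes "finite A" "A \<noteq> {}" shows "(\<Sum>z\<in>boundary A. mu A z) = 1"
  unfolding mu_def using assms by (intro harmonic_measure_sum_1 boundary_nonempty) auto

text \<open>The clusters that can follow \<open>A\<close>; this excludes particles inside holes.\<close>

definition offspring :: "site set \<Rightarrow> site set set" where
  "offspring A = (\<lambda>z. insert z A) ` {z \<in> boundary A. 0 < mu A z}"

lemma finite_offspring: "finite A \<Longrightarrow> finite (offspring A)"
  by (simp add: offspring_def)

lemma sum_offspring:
  assumes "finite A"
  shows "(\<Sum>c\<in>offspring A. dla_transition A c * f c) = (\<Sum>z\<in>boundary A. mu A z * f (insert z A))"
proof -
  have inj: "inj_on (\<lambda>z. insert z A) {z \<in> boundary A. 0 < mu A z}"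
    by (auto simp: inj_on_def boundary_eq)
  have "(\<Sum>c\<in>offspring A. dla_transition A c * f c) = (\<Sum>z\<in>{z \<in> boundary A. 0 < mu A z}. mu A z * f (insert z A))"
    unfolding offspring_def by (simp add: sum.reindex[OF inj] dla_transition_insert)
  also have "\<dots> = (\<Sum>z\<in>boundary A. mu A z * f (insert z A))"
  proof (rule sum.mono_neutral_left)
    show "\<forall>z\<in>boundary A - {z \<in> boundary A. 0 < mu A z}. mu A z * f (insert z A) = 0"
      using mu_nonneg[OF assms] by (auto simp: not_less intro: antisym)
  qed (use assms in auto)
  finally show ?thesis .
qed

section \<open>The Markov chain\<close>

text \<open>If \<open>q\<close> stayed above \<open>p > 0\<close>, the terms \<open>q m c / (N + m)\<close> would drive \<open>\<Psi>\<close> to infinity, while the total of the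
terms with \<open>C\<close> is at most \<open>C q 0\<close>.\<close>

lemma decay_to_zero:
  fixes q \<Psi> :: "nat \<Rightarrow> real"
  assumes q: "\<And>m. p \<le> q m" and \<Psi>: "\<And>m. \<Psi> m \<le> 0" and "0 < c" "0 \<le> C" "0 < N"
    and step: "\<And>m. \<Psi> m + q m * (c / real (N + m)) - C * (q m - q (Suc m)) \<le> \<Psi> (Suc m)"
  shows "p \<le> 0"
proof (rule ccontr)
  assume "\<not> p \<le> 0"
  then have p: "0 < p" by simp
  have bound: "\<Psi> 0 + p * c * (harm (N + m) - harm N) - C * (q 0 - q m) \<le> \<Psi> m" for m
  proof (induction m)
    case (Suc m)
    have "p * c * (harm (N + Suc m) - harm (N + m)) = p * (c / real (N + Suc m))"
      by (simp add: harm_Suc divide_inverse)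
    also have "\<dots> \<le> q m * (c / real (N + m))"
      using p q[of m] \<open>0 < c\<close> \<open>0 < N\<close> by (intro mult_mono divide_left_mono) auto
    finally show ?case using Suc step[of m] by (simp add: algebra_simps)
  qed simp
  have "p * c * (harm (N + m) - harm N) \<le> C * q 0 - \<Psi> 0" for m
  proof -
    have "0 \<le> C * q m" using \<open>0 \<le> C\<close> p q[of m] by (intro mult_nonneg_nonneg) auto
    then show ?thesis using bound[of m] \<Psi>[of m] by (simp add: algebra_simps)
  qed
  then have le: "harm (N + m) \<le> (C * q 0 - \<Psi> 0) / (p * c) + harm N" for m
  proof -
    have *: "h \<le> R / (p * c) + g" if "p * c * (h - g) \<le> R" for h g R :: real
      using that p \<open>0 < c\<close> by (simp add: field_simps)
    show ?thesis by (rule *) fact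
  qed
  have "eventually (\<lambda>m. (C * q 0 - \<Psi> 0) / (p * c) + harm N < harm m) sequentially"
    using harm_at_top by (simp add: filterlim_at_top_dense)
  then obtain m0 where "\<And>m. m \<ge> m0 \<Longrightarrow> (C * q 0 - \<Psi> 0) / (p * c) + harm N < harm m"
    unfolding eventually_sequentially by blast
  from this[of "N + m0"] le[of m0] show False by simp
qed

text \<open>Histories of the chain, latest cluster first: those that extend a history in \<open>S\<close> by \<open>m\<close> steps, each of
which goes from a cluster \<open>b\<close> to an element of \<open>F b\<close>.\<close>

primrec grow :: "(site set \<Rightarrow> site set set) \<Rightarrow> site set list set \<Rightarrow> nat \<Rightarrow> site set list set" where
  "grow F S 0 = S"
| "grow F S (Suc m) = (\<Union>l\<in>grow F S m. (\<lambda>c. c # l) ` F (hd l))"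

lemma sum_grow:
  fixes f :: "site set list \<Rightarrow> real"
  assumes "finite (grow F S m)" "\<And>l. l \<in> grow F S m \<Longrightarrow> finite (F (hd l))"
  shows "(\<Sum>l\<in>grow F S (Suc m). f l) = (\<Sum>l\<in>grow F S m. \<Sum>c\<in>F (hd l). f (c # l))"
proof -
  have "(\<Sum>l\<in>grow F S (Suc m). f l) = (\<Sum>l\<in>grow F S m. sum f ((\<lambda>c. c # l) ` F (hd l)))"
    unfolding grow.simps using assms by (intro sum.UNION_disjoint) auto
  also have "\<dots> = (\<Sum>l\<in>grow F S m. \<Sum>c\<in>F (hd l). f (c # l))"
    by (intro sum.cong refl) (simp add: sum.reindex inj_on_def)
  finally show ?thesis .
qed

text \<open>The history of the chain up to time \<open>n\<close>, latest cluster first.\<close>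

primrec hist :: "(nat \<Rightarrow> 'w \<Rightarrow> site set) \<Rightarrow> nat \<Rightarrow> 'w \<Rightarrow> site set list" where
  "hist X 0 \<omega> = [X 0 \<omega>]"
| "hist X (Suc n) \<omega> = X (Suc n) \<omega> # hist X n \<omega>"

lemma hd_hist [simp]: "hd (hist X n \<omega>) = X n \<omega>"
  by (cases n) auto

lemma hist_eq_iff: "length l = Suc n \<Longrightarrow> hist X n \<omega> = l \<longleftrightarrow> (\<forall>i\<le>n. X i \<omega> = rev l ! i)"
proof (induction n arbitrary: l)
  case 0
  then show ?case by (cases l) auto
next
  case (Suc n)
  then obtain c l' where l: "l = c # l'" "length l' = Suc n" by (cases l) auto
  have "(\<forall>i\<le>Suc n. X i \<omega> = rev l ! i) \<longleftrightarrow> (\<forall>i\<le>n. X i \<omega> = rev l' ! i) \<and> X (Suc n) \<omega> = c"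
    using l(2) by (auto simp: l(1) nth_append le_Suc_eq)
  then show ?case using Suc.IH[OF l(2)] by (auto simp: l(1))
qed

locale dla_chain =
  fixes M :: "'w measure" and X :: "nat \<Rightarrow> 'w \<Rightarrow> site set" and a :: "site set"
  assumes dla: "is_DLA M X" and a: "a \<in> clusters"
begin

sublocale prob_space M
  using dla by (simp add: is_DLA_def markov_chain_def)

abbreviation wt :: "nat \<Rightarrow> site set list \<Rightarrow> real" where
  "wt n l \<equiv> prob {\<omega> \<in> space M. hist X n \<omega> = l}"

lemma sets_state: "Measurable.pred M (\<lambda>\<omega>. Q (X n \<omega>))"
proof -
  have "X n \<in> measurable M (count_space clusters)" using dla by (simp add: is_DLA_def markov_chain_def)
  from measurable_sets[OF this, of "{s \<in> clusters. Q s}"]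
  have "X n -` {s \<in> clusters. Q s} \<inter> space M \<in> sets M" by simp
  also have "X n -` {s \<in> clusters. Q s} \<inter> space M = {\<omega> \<in> space M. Q (X n \<omega>)}"
    using measurable_space[OF \<open>X n \<in> measurable M (count_space clusters)\<close>] by auto
  finally show ?thesis by (simp add: pred_def)
qed

lemma sets_hist [measurable]: "Measurable.pred M (\<lambda>\<omega>. hist X n \<omega> = l)"
proof (induction n arbitrary: l)
  case 0
  show ?case using sets_state[of "\<lambda>s. [s] = l" 0] by simp
next
  case (Suc n)
  show ?case
  proof (cases l)
    case (Cons c l')
    note Suc.IH [measurable]
    have [measurable]: "Measurable.pred M (\<lambda>\<omega>. X (Suc n) \<omega> = c)" by (rule sets_state)
    have "Measurable.pred M (\<lambda>\<omega>. X (Suc n) \<omega> = c \<and> hist X n \<omega> = l')" by measurable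
    then show ?thesis by (simp add: Cons)
  qed simp
qed

lemma wt_Suc:
  assumes l: "length l = Suc n" and c: "c \<in> clusters"
  shows "wt (Suc n) (c # l) = wt n l * dla_transition (hd l) c"
proof (cases "wt n l = 0")
  case True
  have "wt (Suc n) (c # l) \<le> wt n l" by (intro finite_measure_mono) auto
  then show ?thesis using True by (simp add: measure_le_0_iff)
next
  case False
  define h where "h i = rev l ! i" for i
  have ev: "(\<forall>i\<le>n. X i \<omega> = h i) \<longleftrightarrow> hist X n \<omega> = l" for \<omega> by (simp add: h_def hist_eq_iff[OF l])
  have pos: "0 < wt n l" using False measure_nonneg[of M] by (simp add: less_le)
  have prem: "0 < prob {\<omega> \<in> space M. \<forall>i\<le>n. X i \<omega> = h i}" unfolding ev by (rule pos)
  have markov: "\<forall>n h t. t \<in> clusters \<longrightarrow> 0 < prob {\<omega> \<in> space M. \<forall>i\<le>n. X i \<omega> = h i} \<longrightarrow>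
        cond_prob M (\<lambda>\<omega>. X (Suc n) \<omega> = t) (\<lambda>\<omega>. \<forall>i\<le>n. X i \<omega> = h i) = dla_transition (h n) t"
    using dla unfolding is_DLA_def markov_chain_def by (elim conjE)
  have "wt (Suc n) (c # l) / wt n l = cond_prob M (\<lambda>\<omega>. X (Suc n) \<omega> = c) (\<lambda>\<omega>. \<forall>i\<le>n. X i \<omega> = h i)"
    unfolding cond_prob_def ev by simp
  also have "\<dots> = dla_transition (h n) c" by (rule markov[rule_format, OF c prem])
  also have "h n = hd l" using l by (cases l) (auto simp: h_def rev_nth nth_append)
  finally show ?thesis using False by (simp add: field_simps del: hist.simps)
qed

definition runs :: "nat \<Rightarrow> site set list set" where
  "runs n = grow offspring {[a]} n"

lemma offspring_clusters: "b \<in> clusters \<Longrightarrow> c \<in> offspring b \<Longrightarrow> c \<in> clusters \<and> card c = Suc (card b)"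
proof -
  assume b: "b \<in> clusters" and "c \<in> offspring b"
  then obtain z where z: "z \<in> boundary b" "c = insert z b" by (auto simp: offspring_def)
  have "z \<notin> b" "finite b" using z b by (simp_all add: boundary_eq clusters_def)
  then show ?thesis using cluster_insert[OF b z(1)] z(2) by simp
qed

lemma runs_props: "l \<in> runs n \<Longrightarrow> length l = Suc n \<and> hd l \<in> clusters \<and> card (hd l) = card a + n \<and> last l = a"
proof (induction n arbitrary: l)
  case 0
  then show ?case using a by (simp add: runs_def)
next
  case (Suc n)
  from Suc.prems obtain l' c where l: "l' \<in> runs n" "c \<in> offspring (hd l')" "l = c # l'"
    by (auto simp: runs_def)
  have l': "length l' = Suc n" "hd l' \<in> clusters" "card (hd l') = card a + n" "last l' = a"
    using Suc.IH[OF l(1)] by auto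
  have "c \<in> clusters" "card c = Suc (card (hd l'))" using offspring_clusters[OF l'(2) l(2)] by auto
  moreover have "l' \<noteq> []" using l'(1) by auto
  ultimately show ?case using l' by (simp add: l(3))
qed

lemma runs_finite_hd: "l \<in> runs n \<Longrightarrow> finite (hd l) \<and> hd l \<noteq> {}"
  using runs_props[of l n] by (simp add: clusters_def)

lemma finite_runs: "finite (runs n)"
proof (induction n)
  case (Suc n)
  have "finite (\<Union>l\<in>runs n. (\<lambda>c. c # l) ` offspring (hd l))"
  proof (rule finite_UN_I[OF Suc])
    fix l assume "l \<in> runs n"
    then have "finite (hd l)" using runs_finite_hd by blast
    then show "finite ((\<lambda>c. c # l) ` offspring (hd l))" by (intro finite_imageI finite_offspring)
  qed
  then show ?case by (simp add: runs_def)
qed (simp add: runs_def)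

text \<open>The harmonic measures of a boundary sum to 1, so no probability is lost by restricting to \<open>offspring\<close>.\<close>

lemma total_weight: "(\<Sum>l\<in>runs n. wt n l) = prob {\<omega> \<in> space M. X 0 \<omega> = a}"
proof (induction n)
  case (Suc n)
  have "(\<Sum>l\<in>runs (Suc n). wt (Suc n) l) = (\<Sum>l\<in>runs n. \<Sum>c\<in>offspring (hd l). wt (Suc n) (c # l))"
    unfolding runs_def
  proof (rule sum_grow)
    show "finite (grow offspring {[a]} n)" using finite_runs[of n] by (simp add: runs_def)
    fix l assume "l \<in> grow offspring {[a]} n"
    then have "finite (hd l)" using runs_finite_hd[of l n] by (simp add: runs_def)
    then show "finite (offspring (hd l))" by (rule finite_offspring)
  qed
  also have "\<dots> = (\<Sum>l\<in>runs n. wt n l)"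
  proof (intro sum.cong refl)
    fix l assume l: "l \<in> runs n"
    have fin: "finite (hd l)" "hd l \<noteq> {}" using runs_finite_hd[OF l] by auto
    have "(\<Sum>c\<in>offspring (hd l). wt (Suc n) (c # l)) = (\<Sum>c\<in>offspring (hd l). dla_transition (hd l) c * wt n l)"
    proof (intro sum.cong refl)
      fix c assume "c \<in> offspring (hd l)"
      then have "c \<in> clusters" using offspring_clusters runs_props[OF l] by blast
      then show "wt (Suc n) (c # l) = dla_transition (hd l) c * wt n l"
        using wt_Suc[of l n c] runs_props[OF l] by (simp add: mult.commute del: hist.simps(2))
    qed
    also have "\<dots> = (\<Sum>z\<in>boundary (hd l). mu (hd l) z * wt n l)" by (rule sum_offspring[OF fin(1)])
    also have "\<dots> = (\<Sum>z\<in>boundary (hd l). mu (hd l) z) * wt n l" by (simp only: sum_distrib_right)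
    also have "\<dots> = wt n l" unfolding mu_sum_1[OF fin] by simp
    finally show "(\<Sum>c\<in>offspring (hd l). wt (Suc n) (c # l)) = wt n l" .
  qed
  also note Suc.IH
  finally show ?case .
qed (simp add: runs_def)

lemma sets_hist_in:
  assumes "finite S" shows "{\<omega> \<in> space M. hist X n \<omega> \<in> S} \<in> sets M"
proof -
  have "{\<omega> \<in> space M. hist X n \<omega> \<in> S} = (\<Union>l\<in>S. {\<omega> \<in> space M. hist X n \<omega> = l})" by auto
  moreover have "{\<omega> \<in> space M. hist X n \<omega> = l} \<in> sets M" for l using sets_hist[of n l] unfolding pred_def .
  ultimately show ?thesis using assms by (simp add: sets.finite_UN)
qed

lemma prob_hist_in:
  assumes "finite S" shows "prob {\<omega> \<in> space M. hist X n \<omega> \<in> S} = (\<Sum>l\<in>S. wt n l)"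
proof -
  have "{\<omega> \<in> space M. hist X n \<omega> \<in> S} = (\<Union>l\<in>S. {\<omega> \<in> space M. hist X n \<omega> = l})" by auto
  also have "prob \<dots> = (\<Sum>l\<in>S. wt n l)"
  proof (rule finite_measure_finite_Union[OF assms])
    show "(\<lambda>l. {\<omega> \<in> space M. hist X n \<omega> = l}) ` S \<subseteq> sets M"
      using sets_hist[of n] unfolding pred_def by blast
    show "disjoint_family_on (\<lambda>l. {\<omega> \<in> space M. hist X n \<omega> = l}) S"
      unfolding disjoint_family_on_def by blast
  qed
  finally show ?thesis .
qed

lemma AE_runs: "AE \<omega> in M. X 0 \<omega> = a \<longrightarrow> (\<forall>n. hist X n \<omega> \<in> runs n)"
proof -
  have "AE \<omega> in M. X 0 \<omega> = a \<longrightarrow> hist X n \<omega> \<in> runs n" for n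
  proof -
    have last: "last (hist X n \<omega>) = X 0 \<omega>" for \<omega>
    proof (induction n)
      case (Suc n)
      have "hist X n \<omega> \<noteq> []" by (cases n) simp_all
      then show ?case using Suc by simp
    qed simp
    have fin: "finite (runs n)" by (rule finite_runs)
    have sub: "{\<omega> \<in> space M. hist X n \<omega> \<in> runs n} \<subseteq> {\<omega> \<in> space M. X 0 \<omega> = a}"
    proof
      fix \<omega> assume \<omega>: "\<omega> \<in> {\<omega> \<in> space M. hist X n \<omega> \<in> runs n}"
      then have "last (hist X n \<omega>) = a" using runs_props[of "hist X n \<omega>" n] by blast
      then show "\<omega> \<in> {\<omega> \<in> space M. X 0 \<omega> = a}" using \<omega> by (simp add: last)
    qed
    let ?H = "{\<omega> \<in> space M. hist X n \<omega> \<in> runs n}" and ?A = "{\<omega> \<in> space M. X 0 \<omega> = a}"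
    have sets: "?H \<in> sets M" "?A \<in> sets M"
      using sets_hist_in[OF fin] sets_state[of "\<lambda>s. s = a" 0] unfolding pred_def by simp_all
    have "prob (?A - ?H) = prob ?A - prob ?H" by (rule finite_measure_Diff[OF sets(2,1) sub])
    also have "\<dots> = 0" unfolding prob_hist_in[OF fin] total_weight by simp
    finally have "prob (?A - ?H) = 0" .
    then have "AE \<omega> in M. \<omega> \<notin> ?A - ?H" by (rule prob_eq_0[OF sets.Diff[OF sets(2,1)], THEN iffD1])
    then have "AE \<omega> in M. \<omega> \<in> space M \<longrightarrow> X 0 \<omega> = a \<longrightarrow> hist X n \<omega> \<in> runs n" by eventually_elim simp
    then show ?thesis using AE_space by eventually_elim simp
  qed
  then have "AE \<omega> in M. \<forall>n. X 0 \<omega> = a \<longrightarrow> hist X n \<omega> \<in> runs n" unfolding AE_all_countable by (rule allI)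
  then show ?thesis by eventually_elim simp
qed

text \<open>Steps that create no hole.\<close>

definition steady :: "site set \<Rightarrow> site set set" where
  "steady b = {c \<in> offspring b. num_holes c \<le> num_holes b}"

definition steady_runs :: "nat \<Rightarrow> nat \<Rightarrow> site set list set" where
  "steady_runs n m = grow steady (runs n) m"

lemma steady_runs_subset: "steady_runs n m \<subseteq> runs (n + m)"
proof (induction m)
  case (Suc m)
  have "steady b \<subseteq> offspring b" for b by (auto simp: steady_def)
  then have "steady_runs n (Suc m) \<subseteq> (\<Union>l\<in>runs (n + m). (\<lambda>c. c # l) ` offspring (hd l))"
    using Suc.IH unfolding steady_runs_def grow.simps by blast
  then show ?case by (simp add: runs_def)
qed (simp add: steady_runs_def)

lemma finite_steady_runs: "finite (steady_runs n m)"
  using finite_subset[OF steady_runs_subset finite_runs] .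

lemma steady_weight_sum:
  "(\<Sum>l\<in>steady_runs n (Suc m). wt (n + Suc m) l * f (hd l)) =
   (\<Sum>l\<in>steady_runs n m. wt (n + m) l *
      (\<Sum>z\<in>{z \<in> boundary (hd l). num_holes (insert z (hd l)) \<le> num_holes (hd l)}. mu (hd l) z * f (insert z (hd l))))"
proof -
  have "(\<Sum>l\<in>steady_runs n (Suc m). wt (n + Suc m) l * f (hd l)) =
     (\<Sum>l\<in>steady_runs n m. \<Sum>c\<in>steady (hd l). wt (n + Suc m) (c # l) * f (hd (c # l)))"
    unfolding steady_runs_def
  proof (rule sum_grow)
    show "finite (grow steady (runs n) m)" using finite_steady_runs by (simp add: steady_runs_def)
    fix l assume "l \<in> grow steady (runs n) m"
    then have "finite (hd l)" using steady_runs_subset[of n m] runs_finite_hd[of l "n + m"] by (auto simp: steady_runs_def)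
    then show "finite (steady (hd l))" by (simp add: steady_def finite_offspring)
  qed
  also have "\<dots> = (\<Sum>l\<in>steady_runs n m. wt (n + m) l *
      (\<Sum>z\<in>{z \<in> boundary (hd l). num_holes (insert z (hd l)) \<le> num_holes (hd l)}. mu (hd l) z * f (insert z (hd l))))"
  proof (intro sum.cong refl)
    fix l assume "l \<in> steady_runs n m"
    then have l: "l \<in> runs (n + m)" using steady_runs_subset by blast
    let ?b = "hd l"
    let ?f = "\<lambda>c. if num_holes c \<le> num_holes ?b then f c else 0"
    have fin: "finite ?b" using runs_finite_hd[OF l] by auto
    have "(\<Sum>c\<in>steady ?b. wt (n + Suc m) (c # l) * f (hd (c # l))) = (\<Sum>c\<in>steady ?b. wt (n + m) l * (dla_transition ?b c * f c))"
    proof (intro sum.cong refl)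
      fix c assume "c \<in> steady ?b"
      then have "c \<in> offspring ?b" by (simp add: steady_def)
      then have "c \<in> clusters" using offspring_clusters[of ?b c] runs_props[OF l] by simp
      then show "wt (n + Suc m) (c # l) * f (hd (c # l)) = wt (n + m) l * (dla_transition ?b c * f c)"
        using wt_Suc[of l "n + m" c] runs_props[OF l] by (simp add: mult.assoc del: hist.simps(2))
    qed
    also have "\<dots> = wt (n + m) l * (\<Sum>c\<in>steady ?b. dla_transition ?b c * f c)" by (simp add: sum_distrib_left)
    also have "(\<Sum>c\<in>steady ?b. dla_transition ?b c * f c) = (\<Sum>c\<in>offspring ?b. dla_transition ?b c * ?f c)"
      unfolding steady_def using finite_offspring[OF fin] by (intro sum.mono_neutral_cong_left) auto
    also have "\<dots> = (\<Sum>z\<in>boundary ?b. mu ?b z * ?f (insert z ?b))" by (rule sum_offspring[OF fin])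
    also have "\<dots> = (\<Sum>z\<in>{z \<in> boundary ?b. num_holes (insert z ?b) \<le> num_holes ?b}. mu ?b z * f (insert z ?b))"
      using fin by (intro sum.mono_neutral_cong_right) auto
    finally show "(\<Sum>c\<in>steady ?b. wt (n + Suc m) (c # l) * f (hd (c # l))) = wt (n + m) l *
      (\<Sum>z\<in>{z \<in> boundary ?b. num_holes (insert z ?b) \<le> num_holes ?b}. mu ?b z * f (insert z ?b))" .
  qed
  finally show ?thesis .
qed

text \<open>Let \<open>q m\<close> be the probability of the histories that have created no hole in the \<open>m\<close> steps after time \<open>n\<close>,
and \<open>\<Psi> m\<close> the sum of the Lyapunov function \<open>Y\<close> over these histories. As \<open>Y \<le> 0\<close>, dropping the histories
that create a hole can only increase \<open>\<Psi>\<close>, and the probability that is dropped bounds the last term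
of the drift.\<close>

lemma steady_forever_null:
  assumes p: "\<And>m. p \<le> (\<Sum>l\<in>steady_runs n m. wt (n + m) l)"
  shows "p \<le> 0"
proof -
  obtain Y :: "site set \<Rightarrow> real" and c C where c: "0 < c" "0 \<le> C"
    and Y: "\<And>A. finite A \<Longrightarrow> A \<noteq> {} \<Longrightarrow> Y A \<le> 0"
    and drift: "\<And>A. finite A \<Longrightarrow> A \<noteq> {} \<Longrightarrow> c / real (card A) - C * (\<Sum>z\<in>target 8 ` places 8 A. mu A z)
       \<le> (\<Sum>z\<in>boundary A. mu A z * (Y (insert z A) - Y A))"
    using lyapunov_drift by blast
  let ?N = "\<lambda>A. {z \<in> boundary A. num_holes (insert z A) \<le> num_holes A}"
  define q where "q m = (\<Sum>l\<in>steady_runs n m. wt (n + m) l)" for m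
  define \<Psi> where "\<Psi> m = (\<Sum>l\<in>steady_runs n m. wt (n + m) l * Y (hd l))" for m
  define N where "N = card a + n"
  have fin: "finite (hd l)" "hd l \<noteq> {}" "card (hd l) = N + m" if "l \<in> steady_runs n m" for l m
    using that steady_runs_subset[of n m] runs_finite_hd[of l "n + m"] runs_props[of l "n + m"] by (auto simp: N_def)
  have one_step: "Y A + c / real (card A) - C * (1 - (\<Sum>z\<in>?N A. mu A z)) \<le> (\<Sum>z\<in>?N A. mu A z * Y (insert z A))"
    if A: "finite A" "A \<noteq> {}" for A
  proof -
    have "(\<Sum>z\<in>boundary A. mu A z * (Y (insert z A) - Y A)) = (\<Sum>z\<in>boundary A. mu A z * Y (insert z A)) - Y A"
      using mu_sum_1[OF A] by (simp add: right_diff_distrib sum_subtractf sum_distrib_right[symmetric])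
    moreover have "(\<Sum>z\<in>boundary A. mu A z * Y (insert z A)) \<le> (\<Sum>z\<in>?N A. mu A z * Y (insert z A))"
    proof -
      have "(\<Sum>z\<in>boundary A - ?N A. mu A z * Y (insert z A)) \<le> 0"
        using A Y by (intro sum_nonpos mult_nonneg_nonpos mu_nonneg) auto
      moreover have "(\<Sum>z\<in>boundary A. mu A z * Y (insert z A)) = (\<Sum>z\<in>boundary A - ?N A. mu A z * Y (insert z A)) + (\<Sum>z\<in>?N A. mu A z * Y (insert z A))"
        using A by (intro sum.subset_diff) auto
      ultimately show ?thesis by simp
    qed
    moreover have "(\<Sum>z\<in>target 8 ` places 8 A. mu A z) \<le> 1 - (\<Sum>z\<in>?N A. mu A z)"
    proof -
      have "(\<Sum>z\<in>target 8 ` places 8 A. mu A z) = (\<Sum>z\<in>{z \<in> target 8 ` places 8 A. 0 < mu A z}. mu A z)"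
      proof (rule sum.mono_neutral_right)
        show "\<forall>z\<in>target 8 ` places 8 A - {z \<in> target 8 ` places 8 A. 0 < mu A z}. mu A z = 0"
        proof
          fix z assume "z \<in> target 8 ` places 8 A - {z \<in> target 8 ` places 8 A. 0 < mu A z}"
          then have "\<not> 0 < mu A z" by blast
          then show "mu A z = 0" using mu_nonneg[OF A(1), of z] by linarith
        qed
      qed (use A in \<open>auto simp: finite_places\<close>)
      also have "\<dots> \<le> (\<Sum>z\<in>boundary A - ?N A. mu A z)"
      proof (intro sum_mono2)
        show "{z \<in> target 8 ` places 8 A. 0 < mu A z} \<subseteq> boundary A - ?N A"
        proof
          fix z assume "z \<in> {z \<in> target 8 ` places 8 A. 0 < mu A z}"
          then obtain P where P: "P \<in> places 8 A" "z = target 8 P" "0 < mu A z" by blast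
          have "z \<in> boundary A" unfolding P(2) by (rule placed.target_boundary[OF placed_intro[OF A(1) _ P(1)]]) simp
          moreover have "num_holes A < num_holes (insert z A)" using num_holes_target[OF A P(1)] P(2,3) by simp
          ultimately show "z \<in> boundary A - ?N A" by simp
        qed
      qed (use A in \<open>auto simp: mu_nonneg\<close>)
      also have "\<dots> = 1 - (\<Sum>z\<in>?N A. mu A z)"
        using A sum.subset_diff[of "?N A" "boundary A" "mu A"] mu_sum_1[OF A] by simp
      finally show ?thesis .
    qed
    then have "C * (\<Sum>z\<in>target 8 ` places 8 A. mu A z) \<le> C * (1 - (\<Sum>z\<in>?N A. mu A z))"
      using c by (intro mult_left_mono)
    ultimately show ?thesis using drift[OF A] by linarith
  qed
  show ?thesis
  proof (rule decay_to_zero[where q = q and \<Psi> = \<Psi> and c = c and C = C and N = N])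
    show "p \<le> q m" for m using p by (simp add: q_def)
    show "\<Psi> m \<le> 0" for m unfolding \<Psi>_def using fin Y by (intro sum_nonpos mult_nonneg_nonpos) auto
    show "0 < N" unfolding N_def using a by (auto simp: clusters_def card_gt_0_iff)
    show "\<Psi> m + q m * (c / real (N + m)) - C * (q m - q (Suc m)) \<le> \<Psi> (Suc m)" for m
    proof -
      have q: "q (Suc m) = (\<Sum>l\<in>steady_runs n m. wt (n + m) l * (\<Sum>z\<in>?N (hd l). mu (hd l) z))"
        unfolding q_def using steady_weight_sum[of n m "\<lambda>_. 1"] by simp
      have "\<Psi> m + q m * (c / real (N + m)) - C * (q m - q (Suc m)) =
        (\<Sum>l\<in>steady_runs n m. wt (n + m) l * (Y (hd l) + c / real (N + m) - C * (1 - (\<Sum>z\<in>?N (hd l). mu (hd l) z))))"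
        unfolding q unfolding \<Psi>_def q_def
        by (simp add: sum.distrib sum_subtractf sum_distrib_left sum_distrib_right algebra_simps)
      also have "\<dots> \<le> (\<Sum>l\<in>steady_runs n m. wt (n + m) l * (\<Sum>z\<in>?N (hd l). mu (hd l) z * Y (insert z (hd l))))"
      proof (intro sum_mono mult_left_mono)
        fix l assume l: "l \<in> steady_runs n m"
        show "Y (hd l) + c / real (N + m) - C * (1 - (\<Sum>z\<in>?N (hd l). mu (hd l) z))
            \<le> (\<Sum>z\<in>?N (hd l). mu (hd l) z * Y (insert z (hd l)))"
          using one_step[OF fin(1,2)[OF l]] unfolding fin(3)[OF l] .
      qed simp
      also have "\<dots> = \<Psi> (Suc m)" unfolding \<Psi>_def by (rule steady_weight_sum[symmetric])
      finally show ?thesis .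
    qed
  qed (use c in auto)
qed

lemma AE_new_hole: "AE \<omega> in M. X 0 \<omega> = a \<longrightarrow> (\<exists>i\<ge>n. num_holes (X i \<omega>) < num_holes (X (Suc i) \<omega>))"
proof -
  let ?E = "{\<omega> \<in> space M. X 0 \<omega> = a \<and> (\<forall>i\<ge>n. num_holes (X (Suc i) \<omega>) \<le> num_holes (X i \<omega>))}"
  have pairs: "Measurable.pred M (\<lambda>\<omega>. num_holes (X (Suc i) \<omega>) \<le> num_holes (X i \<omega>))" for i
  proof -
    have [measurable]: "Measurable.pred M (\<lambda>\<omega>. num_holes (X j \<omega>) = N)"
      "Measurable.pred M (\<lambda>\<omega>. num_holes (X j \<omega>) \<le> N)" for j N by (rule sets_state)+
    have "Measurable.pred M (\<lambda>\<omega>. \<exists>N. num_holes (X i \<omega>) = N \<and> num_holes (X (Suc i) \<omega>) \<le> N)" by measurable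
    then show ?thesis by simp
  qed
  note pairs [measurable]
  have [measurable]: "Measurable.pred M (\<lambda>\<omega>. X 0 \<omega> = a)" by (rule sets_state)
  have E: "?E \<in> sets M" by measurable
  have "prob ?E \<le> (\<Sum>l\<in>steady_runs n m. wt (n + m) l)" for m
  proof -
    have "AE \<omega> in M. \<omega> \<in> ?E \<longrightarrow> \<omega> \<in> {\<omega> \<in> space M. hist X (n + m) \<omega> \<in> steady_runs n m}"
      using AE_runs
    proof eventually_elim
      case (elim \<omega>)
      have "hist X (n + m) \<omega> \<in> steady_runs n m" if \<omega>: "\<omega> \<in> ?E"
      proof (induction m)
        case 0
        then show ?case using elim \<omega> by (simp add: steady_runs_def)
      next
        case (Suc m)
        have "hist X (Suc (n + m)) \<omega> \<in> runs (Suc (n + m))" using elim \<omega> by blast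
        then have "X (Suc (n + m)) \<omega> \<in> offspring (X (n + m) \<omega>)"
          by (auto simp: runs_def)
        then have "X (Suc (n + m)) \<omega> \<in> steady (X (n + m) \<omega>)" using \<omega> by (simp add: steady_def)
        then show ?case using Suc by (auto simp: steady_runs_def intro!: bexI[of _ "hist X (n + m) \<omega>"])
      qed
      then show ?case by auto
    qed
    moreover have "{\<omega> \<in> space M. hist X (n + m) \<omega> \<in> steady_runs n m} \<in> sets M"
      by (rule sets_hist_in[OF finite_steady_runs])
    ultimately have "prob ?E \<le> prob {\<omega> \<in> space M. hist X (n + m) \<omega> \<in> steady_runs n m}"
      by (intro finite_measure_mono_AE)
    then show ?thesis by (simp add: prob_hist_in[OF finite_steady_runs])
  qed
  then have "prob ?E \<le> 0" by (rule steady_forever_null)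
  then have "prob ?E = 0" using measure_nonneg[of M ?E] by simp
  then have "AE \<omega> in M. \<omega> \<notin> ?E" using prob_eq_0[OF E] by simp
  then show ?thesis using AE_space by eventually_elim (auto simp: not_less)
qed

theorem AE_holes_tend_to_infinity:
  "AE \<omega> in M. X 0 \<omega> = a \<longrightarrow> filterlim (\<lambda>n. num_holes (X n \<omega>)) at_top sequentially"
proof -
  have "AE \<omega> in M. \<forall>n. X 0 \<omega> = a \<longrightarrow> (\<exists>i\<ge>n. num_holes (X i \<omega>) < num_holes (X (Suc i) \<omega>))"
    unfolding AE_all_countable by (intro allI AE_new_hole)
  then show ?thesis using AE_runs
  proof eventually_elim
    case (elim \<omega>)
    show ?case
    proof
      assume "X 0 \<omega> = a"
      then have new: "\<exists>i\<ge>n. num_holes (X i \<omega>) < num_holes (X (Suc i) \<omega>)"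
        and run: "hist X n \<omega> \<in> runs n" for n using elim by auto
      have "num_holes (X n \<omega>) \<le> num_holes (X (Suc n) \<omega>)" for n
      proof -
        have "X (Suc n) \<omega> \<in> offspring (X n \<omega>)" using run[of "Suc n"] by (auto simp: runs_def)
        moreover have "finite (X n \<omega>)" "X n \<omega> \<noteq> {}" using runs_finite_hd[OF run[of n]] by auto
        ultimately show ?thesis using num_holes_mono[of "X n \<omega>"] by (auto simp: offspring_def)
      qed
      then have mono: "num_holes (X i \<omega>) \<le> num_holes (X j \<omega>)" if "i \<le> j" for i j
        using that by (rule lift_Suc_mono_le)
      have unbounded: "\<exists>n. N \<le> num_holes (X n \<omega>)" for N
      proof (induction N)
        case (Suc N)
        then obtain n where n: "N \<le> num_holes (X n \<omega>)" by blast
        obtain i where i: "n \<le> i" "num_holes (X i \<omega>) < num_holes (X (Suc i) \<omega>)" using new by blast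
        then show ?case using n mono[OF i(1)] by (intro exI[of _ "Suc i"]) simp
      qed simp
      show "filterlim (\<lambda>n. num_holes (X n \<omega>)) at_top sequentially"
        unfolding filterlim_at_top eventually_sequentially
      proof (rule allI)
        fix N
        obtain n where "N \<le> num_holes (X n \<omega>)" using unbounded by blast
        then have "\<forall>m\<ge>n. N \<le> num_holes (X m \<omega>)" using mono order_trans by blast
        then show "\<exists>n0. \<forall>n\<ge>n0. N \<le> num_holes (X n \<omega>)" by blast
      qed
    qed
  qed
qed

end

theorem corollary3p1p1:
  fixes M :: "'w measure" and A :: "nat \<Rightarrow> 'w \<Rightarrow> (int \<times> int) set" and a :: "(int \<times> int) set"
  assumes "is_DLA M A"
    and "finite a" and "a \<noteq> {}" and "lattice_connected a"
    and "\<P>(\<omega> in M. A 0 \<omega> = a) > 0"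
  shows "cond_prob M (\<lambda>\<omega>. filterlim (\<lambda>n. num_holes (A n \<omega>)) at_top sequentially)
                     (\<lambda>\<omega>. A 0 \<omega> = a) = 1"
proof -
  interpret dla_chain M A a using assms by unfold_locales (auto simp: clusters_def)
  let ?L = "\<lambda>\<omega>. filterlim (\<lambda>n. num_holes (A n \<omega>)) at_top sequentially"
  have [measurable]: "Measurable.pred M (\<lambda>\<omega>. N \<le> num_holes (A n \<omega>))" for N n by (rule sets_state)
  have "Measurable.pred M (\<lambda>\<omega>. \<forall>N. \<exists>n0. \<forall>n\<ge>n0. N \<le> num_holes (A n \<omega>))" by measurable
  then have [measurable]: "Measurable.pred M ?L" unfolding filterlim_at_top eventually_sequentially .
  have [measurable]: "Measurable.pred M (\<lambda>\<omega>. A 0 \<omega> = a)" by (rule sets_state)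
  have "prob {\<omega> \<in> space M. ?L \<omega> \<and> A 0 \<omega> = a} = prob {\<omega> \<in> space M. A 0 \<omega> = a}"
  proof (rule finite_measure_eq_AE)
    show "AE \<omega> in M. (\<omega> \<in> {\<omega> \<in> space M. ?L \<omega> \<and> A 0 \<omega> = a}) = (\<omega> \<in> {\<omega> \<in> space M. A 0 \<omega> = a})"
      using AE_holes_tend_to_infinity by eventually_elim auto
  qed measurable
  then show ?thesis using assms(5) by (simp add: cond_prob_def)
qed

end
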